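(* Let $G = \langle x, y ; r\rangle$ and $H = \langle u, y ; s\rangle$ be two-generator one-relator groups, suppose $r(x,y) = s(x^e, y)$ for some integer $e > 0$, and suppose that the exponent sum of $r$ with respect to $y$ is nonzero. Then $G$ is an infinite cyclic extension of a free group of finite rank if and only if $H$ is an infinite cyclic extension of a free group of finite rank. Moreover, let $p$ and $q$ be the exponent sums of $r$ with respect to $x$ and $y$, respectively, let $m = (p,q)$ be the greatest common divisor of $p$ and $q$, and let $a = p/m$ and $b = q/m$. If $G$ is an infinite cyclic extension of a group of finite rank $k$ and $H$ is an infinite cyclic extension of a group of finite rank $\ell$, then $$k = 1 + (a,e)(\ell - 1) + |b|(e - 1),$$ where $(a,e)$ is the greatest common divisor of $a$ and $e$.
   Context: $\langle x,y; r\rangle$ denotes the group with generators $x, y$ and the single defining relator $r$, a word in the free group $F(x,y)$; $s = s(u,y)$ is a word in the free group $F(u,y)$, and $s(x^e,y)$ is obtained by substituting $x^e$ for $u$. A group $G$ is an infinite cyclic extension of a group $N$ if $N$ is (isomorphic to) a normal subgroup of $G$ with $G/N$ infinite cyclic. The rank of a finitely generated group is the minimal number of elements in a generating set. *)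

theory Defs
  imports "HOL-Algebra.Algebra"
begin

section \<open>Free groups\<close>

text \<open>The letter \<^term>\<open>(True, a)\<close> stands for the generator \<^term>\<open>a\<close>, and \<^term>\<open>(False, a)\<close>
  for its inverse. The elements of a free group are the freely reduced words.\<close>

type_synonym 'a word = "(bool \<times> 'a) list"

definition reduced :: "'a word \<Rightarrow> bool" where
  "reduced = successively (\<lambda>(b, a) (c, a'). \<not> (a = a' \<and> b \<noteq> c))"

fun push :: "bool \<times> 'a \<Rightarrow> 'a word \<Rightarrow> 'a word" where
  "push l [] = [l]"
| "push (b, a) ((c, a') # w) = (if a = a' \<and> b \<noteq> c then w else (b, a) # (c, a') # w)"

definition reduce :: "'a word \<Rightarrow> 'a word" where
  "reduce w = foldr push w []"

definition free_group :: "'a set \<Rightarrow> 'a word monoid" where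
  "free_group S = \<lparr>carrier = {w. snd ` set w \<subseteq> S \<and> reduced w},
                   monoid.mult = (\<lambda>v w. reduce (v @ w)),
                   one = []\<rparr>"

definition gen :: "'a \<Rightarrow> 'a word" where
  "gen a = [(True, a)]"

text \<open>The value in \<^term>\<open>G\<close> of a word whose generators \<^term>\<open>a\<close> are replaced by \<^term>\<open>f a\<close>. On
  \<^term>\<open>free_group S\<close> this is the homomorphism to \<^term>\<open>G\<close> that extends \<^term>\<open>f\<close>; with
  a free group as \<^term>\<open>G\<close> it is substitution into words.\<close>

definition word_eval :: "('g, 'm) monoid_scheme \<Rightarrow> ('a \<Rightarrow> 'g) \<Rightarrow> 'a word \<Rightarrow> 'g" where
  "word_eval G f w =
     foldr (\<lambda>(b, a) g. (if b then f a else inv\<^bsub>G\<^esub> f a) \<otimes>\<^bsub>G\<^esub> g) w \<one>\<^bsub>G\<^esub>"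

definition exponent_sum :: "'a \<Rightarrow> 'a word \<Rightarrow> int" where
  "exponent_sum a w = (\<Sum>(b, c)\<leftarrow>w. if c = a then (if b then 1 else - 1) else 0)"

definition is_free_group :: "('g, 'm) monoid_scheme \<Rightarrow> bool" where
  "is_free_group N \<longleftrightarrow>
     group N \<and> (\<exists>B \<subseteq> carrier N. word_eval N (\<lambda>g. g) \<in> iso (free_group B) N)"


section \<open>Presentations, extensions and rank\<close>

definition normal_closure :: "('g, 'm) monoid_scheme \<Rightarrow> 'g set \<Rightarrow> 'g set" where
  "normal_closure G R = \<Inter> {K. K \<lhd> G \<and> R \<subseteq> K}"

definition presented_group :: "'a set \<Rightarrow> 'a word set \<Rightarrow> 'a word set monoid" where
  "presented_group S R = free_group S Mod normal_closure (free_group S) R"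

definition infinite_cyclic_extension ::
    "('g, 'm) monoid_scheme \<Rightarrow> ('h, 'n) monoid_scheme \<Rightarrow> bool" where
  "infinite_cyclic_extension G N \<longleftrightarrow>
     group G \<and> group N \<and>
     (\<exists>K. K \<lhd> G \<and> G\<lparr>carrier := K\<rparr> \<cong> N \<and>
          cyclic_group (G Mod K) \<and> infinite (carrier (G Mod K)))"

definition finitely_generated :: "('g, 'm) monoid_scheme \<Rightarrow> bool" where
  "finitely_generated N \<longleftrightarrow> (\<exists>T \<subseteq> carrier N. finite T \<and> generate N T = carrier N)"

text \<open>Meaningful only for finitely generated groups.\<close>

definition group_rank :: "('g, 'm) monoid_scheme \<Rightarrow> nat" where
  "group_rank N =
     (LEAST k. \<exists>T \<subseteq> carrier N. finite T \<and> card T = k \<and> generate N T = carrier N)"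


section \<open>Basic facts\<close>

lemma reduced_Nil [simp]: "reduced []"
  by (simp add: reduced_def)

lemma reduced_Cons:
  "reduced (l # w) \<longleftrightarrow>
     reduced w \<and> (w = [] \<or> \<not> (snd l = snd (hd w) \<and> fst l \<noteq> fst (hd w)))"
  by (cases w) (auto simp: reduced_def case_prod_beta)

lemma reduced_push: "reduced w \<Longrightarrow> reduced (push l w)"
  by (induction l w rule: push.induct) (auto simp: reduced_Cons)

lemma push_letters: "snd ` set (push l w) \<subseteq> insert (snd l) (snd ` set w)"
  by (induction l w rule: push.induct) auto

lemma push_cancel: "reduced w \<Longrightarrow> b \<noteq> c \<Longrightarrow> push (b, a) (push (c, a) w) = w"
proof (cases w)
  case (Cons l v)
  assume "reduced w" "b \<noteq> c"
  with Cons show ?thesis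
    by (cases l; cases v) (auto simp: reduced_Cons)
qed auto

lemma reduced_foldr_push: "reduced w \<Longrightarrow> reduced (foldr push v w)"
  by (induction v) (auto intro: reduced_push)

lemma reduced_reduce: "reduced (reduce w)"
  by (simp add: reduce_def reduced_foldr_push)

lemma foldr_push_letters: "snd ` set (foldr push v w) \<subseteq> snd ` set v \<union> snd ` set w"
proof (induction v)
  case (Cons l v)
  have "snd ` set (foldr push (l # v) w) \<subseteq> insert (snd l) (snd ` set (foldr push v w))"
    using push_letters[of l "foldr push v w"] by simp
  also have "\<dots> \<subseteq> snd ` set (l # v) \<union> snd ` set w"
    using insert_mono[OF Cons.IH, of "snd l"] by simp
  finally show ?case .
qed simp

lemma reduce_letters: "snd ` set (reduce w) \<subseteq> snd ` set w"
  using foldr_push_letters[of w "[]"] by (simp add: reduce_def)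

lemma reduce_reduced: "reduced w \<Longrightarrow> reduce w = w"
proof (induction w)
  case (Cons l w)
  then show ?case
    by (cases l; cases w) (auto simp: reduce_def reduced_Cons)
qed (simp add: reduce_def)

lemma foldr_push_push:
  "reduced v \<Longrightarrow> reduced w \<Longrightarrow> foldr push (push l v) w = push l (foldr push v w)"
proof (induction l v rule: push.induct)
  case (2 b a c a' v)
  then show ?case
    using push_cancel[of "foldr push v w" b c a]
    by (auto simp: reduced_Cons reduced_foldr_push)
qed auto

lemma foldr_push_reduce: "reduced w \<Longrightarrow> foldr push (reduce v) w = foldr push v w"
  by (induction v) (auto simp: reduce_def foldr_push_push reduced_foldr_push)

lemma foldr_push_foldr_push:
  "reduced v \<Longrightarrow> reduced w \<Longrightarrow> foldr push (foldr push u v) w = foldr push u (foldr push v w)"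
  by (induction u) (simp_all add: foldr_push_push reduced_foldr_push)

lemma reduce_append: "reduce (v @ w) = foldr push v (reduce w)"
  by (simp add: reduce_def)

lemma free_group_sel [simp]:
  "carrier (free_group S) = {w. snd ` set w \<subseteq> S \<and> reduced w}"
  "\<one>\<^bsub>free_group S\<^esub> = []"
  "v \<otimes>\<^bsub>free_group S\<^esub> w = reduce (v @ w)"
  by (simp_all add: free_group_def)

lemma group_free_group: "group (free_group S)"
proof (rule groupI)
  fix u v w assume u: "u \<in> carrier (free_group S)"
    and v: "v \<in> carrier (free_group S)" and w: "w \<in> carrier (free_group S)"
  show "u \<otimes>\<^bsub>free_group S\<^esub> v \<in> carrier (free_group S)"
    using u v subset_trans[OF reduce_letters[of "u @ v"], of S]
    by (simp add: reduced_reduce image_Un)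
  show "u \<otimes>\<^bsub>free_group S\<^esub> v \<otimes>\<^bsub>free_group S\<^esub> w
      = u \<otimes>\<^bsub>free_group S\<^esub> (v \<otimes>\<^bsub>free_group S\<^esub> w)"
    using u v w
    by (simp add: reduce_append reduce_reduced reduced_foldr_push foldr_push_foldr_push)
next
  fix w assume w: "w \<in> carrier (free_group S)"
  then show "\<one>\<^bsub>free_group S\<^esub> \<otimes>\<^bsub>free_group S\<^esub> w = w"
    by (simp add: reduce_reduced)
  define v where "v = rev (map (\<lambda>(b, a). (\<not> b, a)) w)"
  have "foldr push (rev (map (\<lambda>(b, a). (\<not> b, a)) w)) w = []" if "reduced w" for w :: "'a word"
    using that
  proof (induction w)
    case (Cons l w)
    have "push (\<not> fst l, snd l) (l # w) = w"
      by (cases l) auto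
    then show ?case
      using Cons by (simp add: case_prod_beta reduced_Cons)
  qed simp
  then have inv: "reduce (v @ w) = []"
    using w by (simp add: reduce_append reduce_reduced v_def)
  have "reduce v \<in> carrier (free_group S)"
    using w reduce_letters[of v] by (force simp: reduced_reduce v_def)
  moreover have "reduce v \<otimes>\<^bsub>free_group S\<^esub> w = \<one>\<^bsub>free_group S\<^esub>"
    using w inv by (simp add: reduce_append foldr_push_reduce reduced_reduce)
  ultimately show "\<exists>v \<in> carrier (free_group S). v \<otimes>\<^bsub>free_group S\<^esub> w = \<one>\<^bsub>free_group S\<^esub>"
    by blast
qed simp

lemma normal_normal_closure:
  assumes "group G" "R \<subseteq> carrier G"
  shows "normal_closure G R \<lhd> G"
proof -
  interpret group G by fact
  have "carrier G \<lhd> G"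
    by (simp add: normal_inv_iff subgroup_self)
  then have ne: "{K. K \<lhd> G \<and> R \<subseteq> K} \<noteq> {}"
    using assms by blast
  show ?thesis
    unfolding normal_inv_iff normal_closure_def
    using subgroups_Inter[OF _ ne] by (auto simp: normal_inv_iff)
qed

lemma group_presented_group:
  "R \<subseteq> carrier (free_group S) \<Longrightarrow> group (presented_group S R)"
  unfolding presented_group_def
  by (intro normal.factorgroup_is_group normal_normal_closure group_free_group)

lemma word_eval_hom:
  fixes G (structure)
  assumes "group G" "f \<in> S \<rightarrow> carrier G"
  shows "word_eval G f \<in> hom (free_group S) G"
proof -
  interpret group G by fact
  let ?l = "\<lambda>(b, a). if b then f a else inv f a"
  have l: "?l z \<in> carrier G" if "snd z \<in> S" for z
    using that assms(2) by (auto simp: case_prod_beta)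
  have eval_Cons: "word_eval G f (z # w) = ?l z \<otimes> word_eval G f w" for z w
    by (simp add: word_eval_def case_prod_beta)
  have closed: "word_eval G f w \<in> carrier G" if "snd ` set w \<subseteq> S" for w
    using that
  proof (induction w)
    case (Cons z w)
    then show ?case
      using l[of z] by (simp add: eval_Cons)
  qed (simp add: word_eval_def)
  have push: "word_eval G f (push z w) = ?l z \<otimes> word_eval G f w"
    if "snd z \<in> S" "snd ` set w \<subseteq> S" for z w
    using that
  proof (induction z w rule: push.induct)
    case (2 b a c a' w)
    then have "f a \<in> carrier G" "word_eval G f w \<in> carrier G"
      using assms(2) closed by auto
    then show ?case
      by (auto simp: eval_Cons m_assoc[symmetric])
  qed (simp add: eval_Cons)
  have "word_eval G f (foldr push v w) = word_eval G f v \<otimes> word_eval G f w"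
    if "snd ` set v \<subseteq> S" "snd ` set w \<subseteq> S" for v w
    using that
  proof (induction v)
    case Nil
    then show ?case
      using closed[of w] by (simp add: word_eval_def)
  next
    case (Cons z v)
    have "snd ` set (foldr push v w) \<subseteq> S"
      using Cons.prems by (intro subset_trans[OF foldr_push_letters]) simp
    then show ?case
      using Cons l[of z] closed[of v] closed[of w]
      by (simp add: push eval_Cons m_assoc)
  qed
  then show ?thesis
    using closed by (auto simp: hom_def reduce_append reduce_reduced)
qed

end

(* G is the amalgamated product of H and <x> over <u> = <x^e>. As the abelianizations have rank one, G and H have
   only one normal subgroup each with infinite cyclic quotient: the kernel K of a homomorphism phi from G to the
   integers with phi x = b and phi y = -a, and the intersection of K and H. Since phi x is not zero, K meets <x>
   trivially, so K acts on the Bass-Serre tree with trivial edge stabilizers, with gcd(a,e) orbits of vertices of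
   one type (stabilized by conjugates of the intersection of K and H), |b| orbits of vertices of the other type
   (with trivial stabilizers) and e|b| orbits of edges. The rank formula is Grushko's theorem for the resulting
   splitting of K. It is proved by Stallings' folding: a graph, labelled by elements of the two factors, whose
   loops generate K is folded until its one-coloured components carry generators of the factors of K, and then its
   vertices and edges are counted. Freeness passes from K to its subgroups by the Nielsen-Schreier theorem; it
   passes to K because a surjection from a free group onto K splits if the kernel in H is free. *)

theory Submission
  imports Defs "HOL-Combinatorics.Permutations"
begin

section \<open>Homomorphisms out of presented groups\<close>

text \<open>The amalgam is never constructed and no tree appears: \<open>G\<close> is known only
  through homomorphisms out of it. Its universal property is applied to two targets. The
  permutations of a set of normal forms show that alternating products are nontrivial; a wreath
  product carries a cocycle from \<open>H\<close> to \<open>G\<close> in the proof of freeness. The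
  values \<open>b\<close> and \<open>-a\<close> are forced up to sign by surjectivity and
  \<open>p b = a q\<close>. Since \<open>a\<close> and \<open>b\<close> are coprime, the image of
  \<open>H\<close> in the integers is generated by \<open>gcd (e b) a = gcd a e\<close>, that of
  \<open>x\<close> by \<open>b\<close> and that of \<open>x^e\<close> by \<open>e b\<close>. These
  indices are the numbers of orbits, and the formula is the Euler characteristic count
  \<open>k - 1 = gcd a e (l - 1) + |b| (0 - 1) + e |b|\<close>. In the formula \<open>K\<close> need
  not be free, so ranks are minimal numbers of generators. One inequality only needs a graph with
  few independent loops; the other has to extract generators of the factors from arbitrary
  generators of \<open>K\<close>. Trivial edge stabilizers keep this an argument about plain graphs:
  a fold merges two vertices and relabels by an element of \<open>C\<close>.\<close>

lemma (in group) inv_cancel: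
  assumes "a \<in> carrier G" "b \<in> carrier G"
  shows "inv a \<otimes> (a \<otimes> b) = b" "a \<otimes> (inv a \<otimes> b) = b"
  using assms by (simp_all add: m_assoc[symmetric])

lemma word_eval_Nil [simp]: "word_eval G f [] = \<one>\<^bsub>G\<^esub>"
  by (simp add: word_eval_def)

lemma word_eval_Cons [simp]:
  "word_eval G f ((s, a) # w) = (if s then f a else inv\<^bsub>G\<^esub> f a) \<otimes>\<^bsub>G\<^esub> word_eval G f w"
  by (simp add: word_eval_def)

lemma word_eval_closed:
  assumes "group G" "f ` snd ` set w \<subseteq> carrier G"
  shows "word_eval G f w \<in> carrier G"
proof -
  interpret group G by fact
  show ?thesis using assms(2) by (induction w) auto
qed

lemma word_eval_cong:
  "(\<And>a. a \<in> snd ` set w \<Longrightarrow> f a = g a) \<Longrightarrow> word_eval G f w = word_eval G g w"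
  by (induction w) (force simp del: word_eval_Cons simp: word_eval_def split: prod.splits)+

lemma hom_word_eval:
  assumes "group A" "group B" "h \<in> hom A B" "f ` snd ` set w \<subseteq> carrier A"
  shows "h (word_eval A f w) = word_eval B (\<lambda>a. h (f a)) w"
proof -
  interpret group_hom A B h
    using assms by (simp add: group_hom_def group_hom_axioms_def)
  show ?thesis using assms(4)
  proof (induction w)
    case (Cons z w)
    obtain s a where z: "z = (s, a)" by force
    have "word_eval A f w \<in> carrier A"
      using Cons.prems by (intro word_eval_closed assms) auto
    with Cons show ?case by (auto simp: z)
  qed simp
qed

lemma gen_closed [simp]: "gen a \<in> carrier (free_group S) \<longleftrightarrow> a \<in> S"
  by (simp add: gen_def reduced_Cons)

lemma word_eval_gen [simp]: "group G \<Longrightarrow> f a \<in> carrier G \<Longrightarrow> word_eval G f (gen a) = f a"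
  by (simp add: gen_def group.is_monoid)

lemma inv_gen:
  assumes "a \<in> S"
  shows "inv\<^bsub>free_group S\<^esub> gen a = [(False, a)]"
  by (rule group.inv_equality[OF group_free_group])
     (use assms in \<open>auto simp: gen_def reduce_def reduced_Cons\<close>)

lemma word_eval_free_group:
  assumes "w \<in> carrier (free_group S)"
  shows "word_eval (free_group S) gen w = w"
proof -
  have "word_eval (free_group S) gen w = reduce w" if "snd ` set w \<subseteq> S" for w
    using that
  proof (induction w)
    case Nil then show ?case by (simp add: reduce_def)
  next
    case (Cons z w)
    obtain s a where z: "z = (s, a)" by force
    have "a \<in> S" using Cons.prems z by auto
    moreover have "foldr push (reduce w) [] = foldr push w []"
      using reduce_reduced[OF reduced_reduce[of w]] by (simp add: reduce_def)
    ultimately show ?case using Cons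
      by (auto simp: z inv_gen) (auto simp: reduce_def gen_def)
  qed
  then show ?thesis using assms by (simp add: reduce_reduced)
qed

lemma hom_eq_on_generate:
  assumes "group A" "group B" "h \<in> hom A B" "k \<in> hom A B" "T \<subseteq> carrier A"
    and "\<And>t. t \<in> T \<Longrightarrow> h t = k t" "g \<in> generate A T"
  shows "h g = k g"
proof -
  interpret h: group_hom A B h
    using assms by (simp add: group_hom_def group_hom_axioms_def)
  interpret k: group_hom A B k
    using assms by (simp add: group_hom_def group_hom_axioms_def)
  show ?thesis using assms(7)
  proof induction
    case (incl t) then show ?case using assms by simp
  next
    case (inv t) then show ?case using assms by (metis h.hom_inv k.hom_inv subsetD)
  next
    case (eng g1 g2)
    then show ?case using h.G.generate_in_carrier[OF assms(5)] by simp
  qed simp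
qed

definition pgen :: "'a set \<Rightarrow> 'a word set \<Rightarrow> 'a \<Rightarrow> 'a word set" where
  "pgen S R a = normal_closure (free_group S) R #>\<^bsub>free_group S\<^esub> gen a"

context
  fixes S :: "'a set" and R :: "'a word set"
  assumes R: "R \<subseteq> carrier (free_group S)"
begin

lemma pgen_closed: "a \<in> S \<Longrightarrow> pgen S R a \<in> carrier (presented_group S R)"
  by (auto simp: pgen_def presented_group_def carrier_FactGroup simp del: free_group_sel)

lemma rcos_hom: "(\<lambda>w. normal_closure (free_group S) R #>\<^bsub>free_group S\<^esub> w)
    \<in> hom (free_group S) (presented_group S R)"
  unfolding presented_group_def
  by (intro normal.r_coset_hom_Mod normal_normal_closure group_free_group R)

lemma word_eval_pgen:
  assumes "w \<in> carrier (free_group S)"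
  shows "word_eval (presented_group S R) (pgen S R) w
       = normal_closure (free_group S) R #>\<^bsub>free_group S\<^esub> w"
proof -
  have "gen ` snd ` set w \<subseteq> carrier (free_group S)"
  proof -
    have "snd ` set w \<subseteq> S" using assms by simp
    then show ?thesis by (auto simp del: free_group_sel)
  qed
  from hom_word_eval[OF group_free_group group_presented_group[OF R] rcos_hom this]
  show ?thesis
    using word_eval_free_group[OF assms] by (simp add: pgen_def [abs_def])
qed

lemma word_eval_relator:
  assumes "\<rho> \<in> R"
  shows "word_eval (presented_group S R) (pgen S R) \<rho> = \<one>\<^bsub>presented_group S R\<^esub>"
proof -
  interpret N: normal "normal_closure (free_group S) R" "free_group S"
    by (rule normal_normal_closure[OF group_free_group R])
  have "\<rho> \<in> normal_closure (free_group S) R"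
    using assms by (auto simp: normal_closure_def)
  then have "normal_closure (free_group S) R #>\<^bsub>free_group S\<^esub> \<rho> = normal_closure (free_group S) R"
    using assms R N.coset_join2 N.subgroup_axioms by blast
  then show ?thesis
    using word_eval_pgen[of \<rho>] assms R by (auto simp: presented_group_def)
qed

lemma generate_pgen: "generate (presented_group S R) (pgen S R ` S) = carrier (presented_group S R)"
proof
  interpret group "presented_group S R" by (rule group_presented_group[OF R])
  have sub: "pgen S R ` S \<subseteq> carrier (presented_group S R)" using pgen_closed by auto
  show "generate (presented_group S R) (pgen S R ` S) \<subseteq> carrier (presented_group S R)"
    by (rule generate_incl[OF sub])
  show "carrier (presented_group S R) \<subseteq> generate (presented_group S R) (pgen S R ` S)"
  proof
    fix g assume "g \<in> carrier (presented_group S R)"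
    then obtain w where w: "w \<in> carrier (free_group S)"
      "g = normal_closure (free_group S) R #>\<^bsub>free_group S\<^esub> w"
      by (auto simp: presented_group_def carrier_FactGroup)
    have "word_eval (presented_group S R) (pgen S R) v \<in> generate (presented_group S R) (pgen S R ` S)"
      if "snd ` set v \<subseteq> S" for v
      using that
    proof (induction v)
      case Nil then show ?case by (simp add: generate.one)
    next
      case (Cons z v)
      obtain s a where z: "z = (s, a)" by force
      show ?case using Cons by (auto simp: z intro!: generate.eng intro: generate.incl generate.inv)
    qed
    from this[of w] show "g \<in> generate (presented_group S R) (pgen S R ` S)"
      using word_eval_pgen[OF w(1)] w by simp
  qed
qed

text \<open>Von Dyck's theorem: the kernel of the evaluation is normal and contains the relators,
  hence their normal closure, so the evaluation factors through the quotient.\<close>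

lemma presented_group_hom_exists:
  assumes W: "group W" and f: "f \<in> S \<rightarrow> carrier W"
    and rel: "\<And>\<rho>. \<rho> \<in> R \<Longrightarrow> word_eval W f \<rho> = \<one>\<^bsub>W\<^esub>"
  obtains T where "T \<in> hom (presented_group S R) W" "\<And>a. a \<in> S \<Longrightarrow> T (pgen S R a) = f a"
proof -
  interpret F: group "free_group S" by (rule group_free_group)
  have hom: "word_eval W f \<in> hom (free_group S) W"
    by (rule word_eval_hom[OF W f])
  interpret group_hom "free_group S" W "word_eval W f"
    using W hom by (simp add: group_hom_def group_hom_axioms_def group_free_group)
  interpret N: normal "normal_closure (free_group S) R" "free_group S"
    by (rule normal_normal_closure[OF group_free_group R])
  have "normal_closure (free_group S) R \<subseteq> kernel (free_group S) W (word_eval W f)"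
    unfolding normal_closure_def using normal_kernel R rel
    by (intro Inter_lower) (auto simp: kernel_def)
  then obtain T where T: "T \<in> hom (free_group S Mod normal_closure (free_group S) R) W"
    "\<And>w. w \<in> carrier (free_group S) \<Longrightarrow>
       T (normal_closure (free_group S) R #>\<^bsub>free_group S\<^esub> w) = word_eval W f w"
    using FactGroup_universal_kernel[OF N.normal_axioms] by metis
  show thesis
  proof
    show "T \<in> hom (presented_group S R) W" using T(1) by (simp add: presented_group_def)
    fix a assume "a \<in> S"
    then show "T (pgen S R a) = f a"
      using T(2)[of "gen a"] f word_eval_gen[OF W, of f a]
      by (auto simp: pgen_def Pi_iff simp del: free_group_sel)
  qed
qed

end

text \<open>A homomorphism to the integers sees a word only through its exponent sums. For a relator
  this becomes a linear equation for the images of the generators.\<close>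

lemma word_eval_integer:
  assumes "snd ` set w \<subseteq> {x, y}" "x \<noteq> y"
  shows "word_eval integer_group f w = f x * exponent_sum x w + f y * exponent_sum y w"
  using assms(1)
proof (induction w)
  case Nil then show ?case by (simp add: exponent_sum_def)
next
  case (Cons z w)
  obtain s a where z: "z = (s, a)" by force
  show ?case using Cons assms(2) by (auto simp: z exponent_sum_def algebra_simps)
qed

section \<open>Wreath products and the Nielsen--Schreier theorem\<close>

text \<open>Homomorphisms \<open>T\<close> into the wreath product that lie over a homomorphism \<open>\<phi>\<close> to \<open>P\<close> are cocycles:
  \<open>fst (T (g h)) a = fst (T g) a \<cdot> fst (T h) (a \<cdot> \<phi> g)\<close>.\<close>

definition wreath :: "('p, 'm) monoid_scheme \<Rightarrow> ('q, 'n) monoid_scheme \<Rightarrow> (('p \<Rightarrow> 'q) \<times> 'p) monoid" where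
  "wreath P Q = \<lparr>carrier = (carrier P \<rightarrow>\<^sub>E carrier Q) \<times> carrier P,
     monoid.mult = (\<lambda>(f, p) (g, q). (\<lambda>a\<in>carrier P. f a \<otimes>\<^bsub>Q\<^esub> g (a \<otimes>\<^bsub>P\<^esub> p), p \<otimes>\<^bsub>P\<^esub> q)),
     one = (\<lambda>a\<in>carrier P. \<one>\<^bsub>Q\<^esub>, \<one>\<^bsub>P\<^esub>)\<rparr>"

lemma wreath_sel [simp]:
  "carrier (wreath P Q) = (carrier P \<rightarrow>\<^sub>E carrier Q) \<times> carrier P"
  "(f, p) \<otimes>\<^bsub>wreath P Q\<^esub> (g, q) = (\<lambda>a\<in>carrier P. f a \<otimes>\<^bsub>Q\<^esub> g (a \<otimes>\<^bsub>P\<^esub> p), p \<otimes>\<^bsub>P\<^esub> q)"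
  "\<one>\<^bsub>wreath P Q\<^esub> = (\<lambda>a\<in>carrier P. \<one>\<^bsub>Q\<^esub>, \<one>\<^bsub>P\<^esub>)"
  by (simp_all add: wreath_def)

lemma group_wreath:
  assumes "group P" "group Q"
  shows "group (wreath P Q)"
proof -
  interpret P: group P by fact
  interpret Q: group Q by fact
  show ?thesis
  proof (rule groupI)
    fix v assume "v \<in> carrier (wreath P Q)"
    then obtain f p where v: "v = (f, p)" "f \<in> carrier P \<rightarrow>\<^sub>E carrier Q" "p \<in> carrier P"
      by auto
    let ?w = "(\<lambda>a\<in>carrier P. inv\<^bsub>Q\<^esub> f (a \<otimes>\<^bsub>P\<^esub> inv\<^bsub>P\<^esub> p), inv\<^bsub>P\<^esub> p)"
    have "?w \<in> carrier (wreath P Q)" "?w \<otimes>\<^bsub>wreath P Q\<^esub> v = \<one>\<^bsub>wreath P Q\<^esub>"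
      using v by (auto simp: PiE_iff)
    then show "\<exists>w\<in>carrier (wreath P Q). w \<otimes>\<^bsub>wreath P Q\<^esub> v = \<one>\<^bsub>wreath P Q\<^esub>" by blast
  qed (auto simp: PiE_iff P.m_assoc Q.m_assoc extensional_def fun_eq_iff)
qed

lemma wreath_mult_components:
  assumes "v \<in> carrier (wreath P Q)" "w \<in> carrier (wreath P Q)"
  shows "snd (v \<otimes>\<^bsub>wreath P Q\<^esub> w) = snd v \<otimes>\<^bsub>P\<^esub> snd w"
    and "a \<in> carrier P \<Longrightarrow>
      fst (v \<otimes>\<^bsub>wreath P Q\<^esub> w) a = fst v a \<otimes>\<^bsub>Q\<^esub> fst w (a \<otimes>\<^bsub>P\<^esub> snd v)"
  by (cases v; cases w; simp)+

section \<open>Schreier transversals and subgroups of free groups\<close>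

lemma generate_free_group: "generate (free_group S) (gen ` S) = carrier (free_group S)"
proof
  interpret group "free_group S" by (rule group_free_group)
  have sub: "gen ` S \<subseteq> carrier (free_group S)" by (auto simp del: free_group_sel)
  show "generate (free_group S) (gen ` S) \<subseteq> carrier (free_group S)"
    by (rule generate_incl[OF sub])
  have "word_eval (free_group S) gen w \<in> generate (free_group S) (gen ` S)"
    if "snd ` set w \<subseteq> S" for w
    using that
  proof (induction w)
    case Nil then show ?case by (simp add: generate.one del: free_group_sel)
  next
    case (Cons z w)
    obtain s a where z: "z = (s, a)" by force
    show ?case using Cons
      by (auto simp: z simp del: free_group_sel intro!: generate.eng intro: generate.incl generate.inv)
  qed
  then show "carrier (free_group S) \<subseteq> generate (free_group S) (gen ` S)"
    using word_eval_free_group[of _ S] by fastforce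
qed

text \<open>The new letter either stays or cancels the last letter of \<open>v\<close>. In the
  length-lexicographic order the first case is settled by comparing prefixes, the second by length
  alone.\<close>

lemma reduce_snoc:
  "reduced v \<Longrightarrow> reduce (v @ [l]) = v @ [l] \<or> length (reduce (v @ [l])) < length v"
proof (induction v)
  case (Cons z v)
  have len: "length (push z w) \<le> Suc (length w)" for w :: "'a word"
    by (induction z w rule: push.induct) auto
  have "reduced v" using Cons.prems by (simp add: reduced_Cons)
  from Cons.IH[OF this] show ?case
  proof
    assume "reduce (v @ [l]) = v @ [l]"
    then have "reduce ((z # v) @ [l]) = push z (v @ [l])" by (simp add: reduce_def)
    then show ?thesis using Cons.prems
      by (cases z; cases l; cases v) (auto simp: reduced_Cons)
  next
    assume "length (reduce (v @ [l])) < length v"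
    then show ?thesis using len[of "reduce (v @ [l])"] by (simp add: reduce_def)
  qed
qed (cases l, simp add: reduce_def)

lemma reduced_append1: "reduced (v @ w) \<Longrightarrow> reduced v"
  by (simp add: reduced_def successively_append_iff)

text \<open>The coset representatives are prefix closed since they are least for the length-lexicographic order.\<close>

lemma schreier_transversal:
  fixes F (structure)
  assumes F_def: "F = free_group S" and L: "subgroup L F"
  obtains t where
    "\<And>g. g \<in> carrier F \<Longrightarrow> t g \<in> L #> g"
    "\<And>g l. g \<in> carrier F \<Longrightarrow> l \<in> L \<Longrightarrow> t (l \<otimes> g) = t g"
    "t [] = []"
    "\<And>w z. w @ [z] \<in> carrier F \<Longrightarrow> t (w @ [z]) = w @ [z] \<Longrightarrow> t w = w"
proof -
  interpret group F by (simp add: F_def group_free_group)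
  interpret L: subgroup L F by fact
  obtain r :: "(bool \<times> 'a) rel" where r: "well_order_on UNIV r"
    using well_order_on by blast
  define R where "R = lenlex (r - Id)"
  have wf: "wf R"
    using r by (auto simp: R_def well_order_on_def)
  have tot: "v = w \<or> (v, w) \<in> R \<or> (w, v) \<in> R" for v w
  proof -
    have "total (r - Id)" using r by (auto simp: well_order_on_def linear_order_on_def)
    then have "total R" by (auto simp: R_def intro: total_lenlex)
    then show ?thesis by (auto simp: total_on_def)
  qed
  define lst where "lst A w \<longleftrightarrow> w \<in> A \<and> (\<forall>v\<in>A. (v, w) \<notin> R)" for A w
  have ex: "\<exists>w. lst A w" if "x \<in> A" for A x
    using wfE_min[OF wf that] unfolding lst_def by metis
  \<comment> \<open>The choice looks only at the coset, so \<open>t\<close> is constant on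
    it.\<close>
  define t where "t g = (SOME w. lst (L #> g) w)" for g
  have self: "g \<in> L #> g" if "g \<in> carrier F" for g
    using that L.one_closed by (force simp: r_coset_def)
  have t: "lst (L #> g) (t g)" if "g \<in> carrier F" for g
    unfolding t_def by (rule someI_ex) (rule ex[OF self[OF that]])
  have len: "(v, w) \<in> R" if "length v < length w" for v w
    using that by (simp add: R_def lenlex_conv)
  have tco: "t h = t g" if "g \<in> carrier F" "h \<in> L #> g" for g h
    using repr_independence[OF that(2,1) L] by (simp add: t_def)
  have t_mem: "t g \<in> L #> g" if "g \<in> carrier F" for g
    using t[OF that] by (simp add: lst_def)
  show thesis
  proof
    show "t g \<in> L #> g" if "g \<in> carrier F" for g
      using t_mem that by (simp only: F_def)
    show "t (l \<otimes> g) = t g" if "g \<in> carrier F" "l \<in> L" for g l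
      using tco[of g "l \<otimes> g"] that L.subset by (auto simp: r_coset_def F_def simp del: free_group_sel)
    have "\<one> = []" by (simp add: F_def)
    then have "[] \<in> L #> []" "lst (L #> []) (t [])"
      using self[of "[]"] t[of "[]"] one_closed by auto
    then show "t [] = []"
      using len[of "[]" "t []"] by (auto simp: lst_def)
    fix w z assume wz: "w @ [z] \<in> carrier F" and twz: "t (w @ [z]) = w @ [z]"
    have w: "w \<in> carrier F" and z: "[z] \<in> carrier F" and wz': "w @ [z] \<in> carrier F"
      using wz reduced_append1[of w "[z]"] by (auto simp: F_def reduced_Cons)
    have wz_eq: "w \<otimes> [z] = w @ [z]"
      using wz by (simp add: F_def reduce_reduced)
    show "t w = w"
    proof (rule ccontr)
      assume "t w \<noteq> w"
      moreover have "(w, t w) \<notin> R" using t[OF w] self[OF w] by (auto simp: lst_def)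
      ultimately have lt: "(t w, w) \<in> R" using tot by blast
      then have le: "length (t w) \<le> length w" by (simp add: R_def lenlex_length)
      have tw: "t w \<in> carrier F" using t_mem[OF w] w L.subset by (auto simp: r_coset_def)
      \<comment> \<open>If \<open>t w\<close> precedes \<open>w\<close>, then
        \<open>t w \<otimes> [z]\<close> lies in the coset of \<open>w @ [z]\<close> and precedes
        this word: if nothing cancels, because the order respects appending a letter, otherwise
        because it is shorter.\<close>
      obtain l where l: "l \<in> L" "t w = l \<otimes> w" using t_mem[OF w] by (auto simp: r_coset_def)
      have "t w \<otimes> [z] = l \<otimes> (w @ [z])"
        using l w z L.subset by (simp add: m_assoc wz_eq[symmetric] subset_iff)
      then have "t w \<otimes> [z] \<in> L #> (w @ [z])"
        using l(1) by (auto simp: r_coset_def)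
      then have notR: "(t w \<otimes> [z], w @ [z]) \<notin> R"
        using t[OF wz'] twz by (auto simp: lst_def)
      have "reduced (t w)" using tw by (simp add: F_def)
      from reduce_snoc[OF this, of z] show False
      proof
        assume "reduce (t w @ [z]) = t w @ [z]"
        then have "(t w @ [z], w @ [z]) \<notin> R" using notR by (simp add: F_def)
        moreover have "(t w @ [z], w @ [z]) \<in> R"
          using lt unfolding R_def lenlex_conv
          by (auto intro: lex_append_rightI)
        ultimately show False by simp
      next
        assume "length (reduce (t w @ [z])) < length (t w)"
        then show False using notR le len[of "reduce (t w @ [z])" "w @ [z]"] by (simp add: F_def)
      qed
    qed
  qed
qed

text \<open>Nielsen--Schreier for an embedding \<open>j\<close> with image \<open>L\<close>. A
  homomorphism from \<open>F\<close> to its wreath product with the free group \<open>Q\<close> on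
  the nontrivial Schreier generators gives a rewriting map \<open>s\<close>, inverse to the
  evaluation \<open>ev\<close>. The wreath product is taken over \<open>F\<close> itself instead of
  the cosets of \<open>L\<close>; \<open>\<sigma>_coset\<close> restores the dependence on cosets
  only.\<close>

theorem is_free_group_if_embeds:
  fixes A and F (structure)
  assumes A: "group A" and F_def: "F = free_group S" and j: "j \<in> hom A F" and inj: "inj_on j (carrier A)"
  shows "is_free_group A"
proof -
  interpret A: group A by fact
  interpret F: group F by (simp add: F_def group_free_group)
  interpret j: group_hom A F j
    using j by (simp add: group_hom_def group_hom_axioms_def A F.is_group)
  define L where "L = j ` carrier A"
  interpret L: subgroup L F
    unfolding L_def by (rule j.img_is_subgroup)
  obtain t where t_mem: "\<And>g. g \<in> carrier F \<Longrightarrow> t g \<in> L #> g"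
    and t_inv: "\<And>g l. g \<in> carrier F \<Longrightarrow> l \<in> L \<Longrightarrow> t (l \<otimes> g) = t g"
    and t_one: "t [] = []"
    and t_pre: "\<And>w z. w @ [z] \<in> carrier F \<Longrightarrow> t (w @ [z]) = w @ [z] \<Longrightarrow> t w = w"
    using schreier_transversal[OF F_def L.subgroup_axioms] by blast
  have F_one: "\<one> = []" by (simp add: F_def)
  have t_closed [simp]: "t g \<in> carrier F" if "g \<in> carrier F" for g
    using t_mem[OF that] that L.subset by (auto simp: r_coset_def)
  have t_L: "t g = t h" if "g \<in> carrier F" "h \<in> carrier F" "g \<otimes> inv h \<in> L" for g h
    using t_inv[OF that(2,3)] that by (simp add: F.m_assoc)
  have t_L': "g \<otimes> inv t g \<in> L" "t g \<otimes> inv g \<in> L" if g: "g \<in> carrier F" for g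
  proof -
    obtain l where l: "l \<in> L" "t g = l \<otimes> g" using t_mem[OF g] by (auto simp: r_coset_def)
    then have "t g \<otimes> inv g = l" using g L.subset by (auto simp: F.m_assoc)
    with l(1) show 1: "t g \<otimes> inv g \<in> L" by simp
    show "g \<otimes> inv t g \<in> L"
      using L.m_inv_closed[OF 1] g by (simp add: F.inv_mult_group)
  qed
  have t_t: "t (t g) = t g" if "g \<in> carrier F" for g
    using t_L[of "t g" g] t_L'(2)[of g] that by simp
  have gen_F [simp]: "gen b \<in> carrier F \<longleftrightarrow> b \<in> S" for b by (simp add: F_def del: free_group_sel)

  \<comment> \<open>The Schreier generators, as elements of \<open>F\<close>. Their preimages in
    \<open>A\<close> form \<open>Y\<close>, except for the identity, which cannot belong to a
    basis.\<close>
  define \<gamma> where "\<gamma> g b = t g \<otimes> gen b \<otimes> inv t (g \<otimes> gen b)" for g b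
  define ji where "ji = inv_into (carrier A) j"
  have ji [simp]: "ji l \<in> carrier A" "j (ji l) = l" if "l \<in> L" for l
    using that by (auto simp: ji_def L_def inv_into_into f_inv_into_f)
  have ji_j [simp]: "ji (j a) = a" if "a \<in> carrier A" for a
    using that inj by (simp add: ji_def)
  have \<gamma>_L: "\<gamma> g b \<in> L" if g: "g \<in> carrier F" "b \<in> S" for g b
  proof -
    have "\<gamma> g b = (t g \<otimes> inv g) \<otimes> ((g \<otimes> gen b) \<otimes> inv t (g \<otimes> gen b))"
      using that by (simp add: \<gamma>_def F.m_assoc F.inv_solve_left)
    then show ?thesis using t_L'[of g] t_L'[of "g \<otimes> gen b"] that by simp
  qed
  define Y where "Y = {ji (\<gamma> g b) |g b. g \<in> carrier F \<and> b \<in> S \<and> \<gamma> g b \<noteq> \<one>}"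
  have Y: "Y \<subseteq> carrier A" using \<gamma>_L by (auto simp: Y_def)
  define Q where "Q = free_group Y"
  interpret Q: group Q by (simp add: Q_def group_free_group)
  \<comment> \<open>Edges of the Schreier tree have trivial \<open>\<gamma> g b\<close> and must
    vanish in \<open>Q\<close> as well.\<close>
  define sym where "sym g b = (if \<gamma> g b = \<one> then \<one>\<^bsub>Q\<^esub> else gen (ji (\<gamma> g b)))" for g b
  have sym_Q: "sym g b \<in> carrier Q" if "g \<in> carrier F" "b \<in> S" for g b
    using that Q.one_closed by (auto simp: sym_def Q_def Y_def simp del: free_group_sel)
  have \<gamma>_inv: "\<gamma> (l \<otimes> g) b = \<gamma> g b" if "l \<in> L" "g \<in> carrier F" "b \<in> S" for l g b
    using that L.subset t_inv[of "g \<otimes> gen b" l] t_inv[of g l] by (auto simp: \<gamma>_def F.m_assoc)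
  have \<gamma>_t: "\<gamma> (t g) b = \<gamma> g b" if "g \<in> carrier F" "b \<in> S" for g b
  proof -
    have "\<gamma> ((t g \<otimes> inv g) \<otimes> g) b = \<gamma> g b"
      using that t_L' by (intro \<gamma>_inv) auto
    then show ?thesis using that by (simp add: F.m_assoc)
  qed

  define W where "W = wreath F Q"
  interpret W: group W unfolding W_def by (intro group_wreath F.is_group Q.is_group)
  define \<Phi> where "\<Phi> = word_eval W (\<lambda>b. (\<lambda>g\<in>carrier F. sym g b, gen b))"
  have f: "(\<lambda>b. (\<lambda>g\<in>carrier F. sym g b, gen b)) \<in> S \<rightarrow> carrier W"
    using sym_Q by (auto simp: W_def)
  interpret \<Phi>: group_hom F W \<Phi>
    using word_eval_hom[OF W.is_group f] F.is_group W.is_group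
    by (simp only: group_hom_def group_hom_axioms_def \<Phi>_def F_def)
  have \<Phi>_gen: "\<Phi> (gen b) = (\<lambda>g\<in>carrier F. sym g b, gen b)" if "b \<in> S" for b
    unfolding \<Phi>_def using f that by (intro word_eval_gen W.is_group) auto
  have gen_S: "generate F (gen ` S) = carrier F" by (simp add: F_def generate_free_group del: free_group_sel)
  have \<Phi>_W: "\<Phi> w \<in> carrier (wreath F Q)" if "w \<in> carrier F" for w
    using \<Phi>.hom_closed[OF that] by (simp only: W_def)
  have \<Phi>_mult: "\<Phi> (v \<otimes> w) = \<Phi> v \<otimes>\<^bsub>wreath F Q\<^esub> \<Phi> w" if "v \<in> carrier F" "w \<in> carrier F" for v w
    using that by (simp add: W_def)
  have snd_hom: "(\<lambda>w. snd (\<Phi> w)) \<in> hom F F"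
    using \<Phi>_W
    by (auto intro!: homI simp: \<Phi>_mult wreath_mult_components[OF \<Phi>_W \<Phi>_W] mem_Times_iff
        simp del: \<Phi>.hom_mult)
  have id_hom: "(\<lambda>w. w) \<in> hom F F" by (simp add: hom_def)
  have gen_sub: "gen ` S \<subseteq> carrier F" by auto
  have snd_\<Phi>: "snd (\<Phi> w) = w" if "w \<in> carrier F" for w
    by (rule hom_eq_on_generate[OF F.is_group F.is_group snd_hom id_hom gen_sub])
       (use that gen_S \<Phi>_gen in auto)
  define \<sigma> where "\<sigma> g w = fst (\<Phi> w) g" for g w
  have \<sigma>_closed [simp]: "\<sigma> g w \<in> carrier Q" if "g \<in> carrier F" "w \<in> carrier F" for g w
    using \<Phi>_W[OF that(2)] that(1) by (auto simp: \<sigma>_def PiE_iff)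
  have \<sigma>_mult: "\<sigma> g (v \<otimes> w) = \<sigma> g v \<otimes>\<^bsub>Q\<^esub> \<sigma> (g \<otimes> v) w"
    if "g \<in> carrier F" "v \<in> carrier F" "w \<in> carrier F" for g v w
    using that by (simp add: \<sigma>_def \<Phi>_mult wreath_mult_components[OF \<Phi>_W \<Phi>_W] snd_\<Phi> del: \<Phi>.hom_mult)
  have \<sigma>_gen: "\<sigma> g (gen b) = sym g b" if "g \<in> carrier F" "b \<in> S" for g b
    using that by (simp add: \<sigma>_def \<Phi>_gen)
  have \<sigma>_one: "\<sigma> g \<one> = \<one>\<^bsub>Q\<^esub>" if "g \<in> carrier F" for g
    using that by (simp add: \<sigma>_def W_def)
  have \<sigma>_inv: "\<sigma> g (inv w) = inv\<^bsub>Q\<^esub> \<sigma> (g \<otimes> inv w) w" if "g \<in> carrier F" "w \<in> carrier F" for g w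
    using \<sigma>_mult[of g "inv w" w] that by (intro Q.inv_equality[symmetric]) (simp_all add: \<sigma>_one)
  \<comment> \<open>Left invariance under \<open>L\<close> turns the cocycle identity at
    \<open>\<one>\<close> into multiplicativity on \<open>L\<close>.\<close>
  have \<sigma>_coset: "\<sigma> (l \<otimes> g) w = \<sigma> g w" if "l \<in> L" "g \<in> carrier F" "w \<in> carrier F" for l g w
  proof -
    have l: "l \<in> carrier F" using that L.subset by auto
    have S: "gen ` S \<subseteq> carrier F" by auto
    have "w \<in> generate F (gen ` S)" using that gen_S by simp
    then have "w \<in> carrier F \<and> (\<forall>g\<in>carrier F. \<sigma> (l \<otimes> g) w = \<sigma> g w)"
    proof induction
      case one then show ?case using l by (simp add: \<sigma>_one)
    next
      case (incl h)
      then show ?case using l that by (auto simp: \<sigma>_gen sym_def \<gamma>_inv)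
    next
      case (inv h)
      then show ?case using l that by (auto simp: \<sigma>_inv \<sigma>_gen sym_def \<gamma>_inv F.m_assoc)
    next
      case (eng v w) then show ?case using l by (simp add: \<sigma>_mult F.m_assoc)
    qed
    then show ?thesis using that by simp
  qed

  define ev where "ev = word_eval A (\<lambda>g. g)"
  interpret ev: group_hom Q A ev
    unfolding group_hom_def group_hom_axioms_def ev_def Q_def
    using Y by (intro conjI group_free_group A word_eval_hom) auto
  have ev_gen: "ev (gen y) = y" if "y \<in> Y" for y
    unfolding ev_def using Y that A by (intro word_eval_gen) auto
  have ev_sym: "j (ev (sym g b)) = \<gamma> g b" if "g \<in> carrier F" "b \<in> S" for g b
  proof (cases "\<gamma> g b = \<one>")
    case False
    then have "ji (\<gamma> g b) \<in> Y" using that by (auto simp: Y_def)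
    with False show ?thesis using \<gamma>_L[OF that] by (simp add: sym_def ev_gen)
  qed (simp add: sym_def)
  \<comment> \<open>The value telescopes: the representative that ends one factor cancels with the
    one that begins the next.\<close>
  have ev_\<sigma>: "j (ev (\<sigma> g w)) = t g \<otimes> w \<otimes> inv t (g \<otimes> w)"
    if "g \<in> carrier F" "w \<in> carrier F" for g w
  proof -
    have "w \<in> generate F (gen ` S)" using that gen_S by simp
    then have "w \<in> carrier F \<and> (\<forall>g\<in>carrier F. j (ev (\<sigma> g w)) = t g \<otimes> w \<otimes> inv t (g \<otimes> w))"
    proof induction
      case one then show ?case by (simp add: \<sigma>_one)
    next
      case (incl h)
      then show ?case by (auto simp: \<sigma>_gen ev_sym \<gamma>_def)
    next
      case (inv h)
      then show ?case by (auto simp: \<sigma>_inv \<sigma>_gen ev_sym sym_Q \<gamma>_def F.m_assoc F.inv_mult_group)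
    next
      case (eng v w)
      then show ?case by (auto simp: \<sigma>_mult F.m_assoc F.inv_cancel)
    qed
    then show ?thesis using that by simp
  qed

  \<comment> \<open>All prefixes of a representative are representatives, so each of its letters
    contributes a trivial Schreier generator.\<close>
  have \<sigma>_t: "\<sigma> \<one> c = \<one>\<^bsub>Q\<^esub>" if "c \<in> carrier F" "t c = c" for c
    using that
  proof (induction c rule: rev_induct)
    case Nil then show ?case using \<sigma>_one[of "\<one>"] by (simp add: F_one)
  next
    case (snoc z w)
    obtain s b where z: "z = (s, b)" by force
    have w: "w \<in> carrier F" and b: "b \<in> S"
      using snoc.prems reduced_append1[of w "[z]"] by (auto simp: F_def z)
    have tw: "t w = w" using t_pre snoc.prems by blast
    have IH: "\<sigma> \<one> w = \<one>\<^bsub>Q\<^esub>" using snoc.IH w tw by simp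
    have e: "[z] = (if s then gen b else inv gen b)"
      using b by (simp add: F_def inv_gen z) (simp add: gen_def)
    have wz: "w @ [z] = w \<otimes> [z]"
      using snoc.prems by (simp add: F_def reduce_reduced)
    show ?case
    proof (cases s)
      case True
      then have wz': "w @ [z] = w \<otimes> gen b" using wz e by simp
      then have "\<gamma> w b = \<one>"
        using snoc.prems tw w b by (simp add: \<gamma>_def)
      then show ?thesis unfolding wz' using w b by (simp add: \<sigma>_mult IH \<sigma>_gen sym_def)
    next
      case False
      then have wz': "w @ [z] = w \<otimes> inv gen b" using wz e by simp
      have "\<gamma> (w \<otimes> inv gen b) b = \<one>"
        using snoc.prems tw w b unfolding wz' by (simp add: \<gamma>_def F.m_assoc)
      then show ?thesis unfolding wz' using w b by (simp add: \<sigma>_mult IH \<sigma>_inv \<sigma>_gen sym_def)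
    qed
  qed
  \<comment> \<open>In \<open>t g \<otimes> gen b \<otimes> inv d\<close> the outer factors
    contribute nothing, so rewriting returns the symbol of the generator. This makes
    \<open>s\<close> a left inverse of \<open>ev\<close> on the basis.\<close>
  have \<sigma>_\<gamma>: "\<sigma> \<one> (\<gamma> g b) = sym g b" if g: "g \<in> carrier F" and b: "b \<in> S" for g b
  proof -
    define d where "d = t (g \<otimes> gen b)"
    have d: "d \<in> carrier F" "t d = d" using g b t_t by (auto simp: d_def)
    have \<gamma>: "\<gamma> g b = t g \<otimes> gen b \<otimes> inv d" by (simp add: \<gamma>_def d_def)
    have "\<sigma> \<one> (\<gamma> g b) = \<sigma> \<one> (t g) \<otimes>\<^bsub>Q\<^esub> sym (t g) b \<otimes>\<^bsub>Q\<^esub> inv\<^bsub>Q\<^esub> \<sigma> (\<gamma> g b) d"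
      using g b d sym_Q by (simp add: \<gamma> \<sigma>_mult \<sigma>_gen \<sigma>_inv)
    also have "\<sigma> (\<gamma> g b) d = \<sigma> \<one> d"
      using \<sigma>_coset[of "\<gamma> g b" "\<one>" d] \<gamma>_L[OF g b] d L.subset by auto
    also have "\<dots> = \<one>\<^bsub>Q\<^esub>" using \<sigma>_t d by simp
    also have "\<sigma> \<one> (t g) = \<one>\<^bsub>Q\<^esub>" using \<sigma>_t t_t g by simp
    also have "sym (t g) b = sym g b" using \<gamma>_t[OF g b] by (simp add: sym_def)
    finally show ?thesis using sym_Q[OF g b] by simp
  qed

  define s where "s a = \<sigma> \<one> (j a)" for a
  have j_L: "j a \<in> L" if "a \<in> carrier A" for a using that by (auto simp: L_def)
  have s_hom: "s \<in> hom A Q"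
  proof (rule homI)
    fix a b assume a: "a \<in> carrier A" and b: "b \<in> carrier A"
    show "s (a \<otimes>\<^bsub>A\<^esub> b) = s a \<otimes>\<^bsub>Q\<^esub> s b"
      using a b \<sigma>_coset[of "j a" "\<one>" "j b"] j_L by (simp add: s_def \<sigma>_mult)
  qed (simp add: s_def)
  have ev_s: "ev (s a) = a" if a: "a \<in> carrier A" for a
  proof -
    have "t (j a) = t \<one>" using t_L[of "j a" "\<one>"] a j_L by simp
    then have "j (ev (s a)) = j a" using a t_one by (simp add: s_def ev_\<sigma> F_one[symmetric])
    then show ?thesis using inj a by (auto simp: inj_on_def s_def)
  qed
  have "(\<lambda>q. s (ev q)) \<in> hom Q Q"
    using s_hom by (auto simp: hom_def Pi_iff)
  moreover have "(\<lambda>q. q) \<in> hom Q Q" by (simp add: hom_def)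
  moreover have "s (ev v) = v" if v: "v \<in> gen ` Y" for v
  proof -
    obtain g b where gb: "v = gen (ji (\<gamma> g b))" "g \<in> carrier F" "b \<in> S" "\<gamma> g b \<noteq> \<one>"
      using v unfolding Y_def by blast
    then have "ji (\<gamma> g b) \<in> Y" by (auto simp: Y_def)
    then show ?thesis using gb \<gamma>_L[OF gb(2,3)] by (simp add: ev_gen s_def \<sigma>_\<gamma>) (simp add: sym_def)
  qed
  moreover have "gen ` Y \<subseteq> carrier Q" by (auto simp: Q_def simp del: free_group_sel)
  moreover have "generate Q (gen ` Y) = carrier Q" by (simp add: Q_def generate_free_group del: free_group_sel)
  ultimately have s_ev: "s (ev v) = v" if "v \<in> carrier Q" for v
    using hom_eq_on_generate[OF Q.is_group Q.is_group, of "\<lambda>q. s (ev q)" "\<lambda>q. q" "gen ` Y" v] that by simp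
  have "bij_betw ev (carrier Q) (carrier A)"
    by (rule bij_betw_byWitness[of _ s]) (use s_ev ev_s s_hom in \<open>auto simp: hom_def\<close>)
  then have "word_eval A (\<lambda>g. g) \<in> iso (free_group Y) A"
    using ev.homh by (simp add: iso_def ev_def Q_def)
  then show ?thesis using Y A by (auto simp: is_free_group_def)
qed

corollary is_free_group_embedding:
  assumes "is_free_group N" "group A" "h \<in> hom A N" "inj_on h (carrier A)"
  shows "is_free_group A"
proof -
  obtain B where B: "word_eval N (\<lambda>g. g) \<in> iso (free_group B) N"
    using assms(1) by (auto simp: is_free_group_def)
  define k where "k = inv_into (carrier (free_group B)) (word_eval N (\<lambda>g. g))"
  have k: "k \<in> iso N (free_group B)"
    unfolding k_def by (rule group.iso_set_sym[OF group_free_group B])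
  have "k \<circ> h \<in> hom A (free_group B)"
    using k assms(3) by (auto simp: iso_def hom_def Pi_iff simp del: free_group_sel)
  moreover have "inj_on (k \<circ> h) (carrier A)"
  proof (rule comp_inj_on[OF assms(4)])
    have "h ` carrier A \<subseteq> carrier N" using assms(3) by (auto simp: hom_def)
    then show "inj_on k (h ` carrier A)"
      using k by (auto simp: iso_def bij_betw_def intro: inj_on_subset)
  qed
  ultimately show ?thesis by (rule is_free_group_if_embeds[OF assms(2) refl])
qed

section \<open>Graphs labelled by group elements\<close>

text \<open>Only end points and label are recorded, and edges may be traversed backwards. The labels
  of closed walks at \<open>v\<close> thus form the image of the fundamental group in
  \<open>G\<close>.\<close>

inductive walk :: "('g, 'm) monoid_scheme \<Rightarrow> ('v \<times> 'g \<times> 'v) set \<Rightarrow> 'v \<Rightarrow> 'g \<Rightarrow> 'v \<Rightarrow> bool"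
  for G E where
  walk_nil: "walk G E v \<one>\<^bsub>G\<^esub> v"
| walk_fwd: "(v, g, w) \<in> E \<Longrightarrow> walk G E w h z \<Longrightarrow> walk G E v (g \<otimes>\<^bsub>G\<^esub> h) z"
| walk_bwd: "(w, g, v) \<in> E \<Longrightarrow> walk G E w h z \<Longrightarrow> walk G E v (inv\<^bsub>G\<^esub> g \<otimes>\<^bsub>G\<^esub> h) z"

context group
begin

lemma walk_label:
  assumes "subgroup A G" "E \<subseteq> V \<times> A \<times> W" "walk G E v g w"
  shows "g \<in> A"
proof -
  interpret A: subgroup A G by fact
  show ?thesis using assms(3,2) by induction auto
qed

lemma walk_closed:
  assumes "E \<subseteq> V \<times> carrier G \<times> W" "walk G E v g w"
  shows "g \<in> carrier G"
  using walk_label[OF subgroup_self assms] .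

lemma walk_vertex: "walk G E v g w \<Longrightarrow> E \<subseteq> V \<times> A \<times> V \<Longrightarrow> v \<in> V \<Longrightarrow> w \<in> V"
  by (induction rule: walk.induct) auto

lemma walk_trans:
  assumes E: "E \<subseteq> V \<times> carrier G \<times> W" and "walk G E v g w" "walk G E w h z"
  shows "walk G E v (g \<otimes> h) z"
  using assms(2,3)
proof induction
  case (walk_nil v)
  then show ?case using walk_closed[OF E] by simp
next
  case (walk_fwd v g w k z')
  then have "g \<in> carrier G" "k \<in> carrier G" "h \<in> carrier G" using E walk_closed[OF E] by auto
  with walk_fwd show ?case by (auto simp: m_assoc intro: walk.walk_fwd)
next
  case (walk_bwd w g v k z')
  then have "g \<in> carrier G" "k \<in> carrier G" "h \<in> carrier G" using E walk_closed[OF E] by auto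
  with walk_bwd show ?case by (auto simp: m_assoc intro: walk.walk_bwd)
qed

lemma walk_edge:
  assumes "E \<subseteq> V \<times> carrier G \<times> W" "(v, g, w) \<in> E"
  shows "walk G E v g w"
  using walk_fwd[OF assms(2) walk_nil, of G] assms by auto

lemma walk_edge_inv:
  assumes "E \<subseteq> V \<times> carrier G \<times> W" "(v, g, w) \<in> E"
  shows "walk G E w (inv g) v"
  using walk_bwd[OF assms(2) walk_nil, of G] assms by auto

lemma walk_inv:
  assumes E: "E \<subseteq> V \<times> carrier G \<times> W" and "walk G E v g w"
  shows "walk G E w (inv g) v"
  using assms(2)
proof induction
  case (walk_nil v)
  then show ?case using walk.walk_nil[of G] by simp
next
  case (walk_fwd v g w k z)
  then have "g \<in> carrier G" "k \<in> carrier G" using E walk_closed[OF E] by auto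
  then show ?case
    using walk_trans[OF E walk_fwd.IH walk_edge_inv[OF E walk_fwd.hyps(1)]] by (simp add: inv_mult_group)
next
  case (walk_bwd w g v k z)
  then have "g \<in> carrier G" "k \<in> carrier G" using E walk_closed[OF E] by auto
  then show ?case
    using walk_trans[OF E walk_bwd.IH walk_edge[OF E walk_bwd.hyps(1)]] by (simp add: inv_mult_group)
qed

text \<open>The factors \<open>inv \<gamma> w \<otimes> \<gamma> w\<close> at intermediate vertices
  cancel, so it suffices to check edges. In a fold, \<open>\<rho>\<close> identifies two vertices
  and \<open>\<gamma>\<close> records the change of labels.\<close>

lemma walk_map:
  assumes E: "E \<subseteq> V \<times> carrier G \<times> W" and E': "E' \<subseteq> V' \<times> carrier G \<times> W'"
    and \<gamma>: "\<And>z. \<gamma> z \<in> carrier G"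
    and edge: "\<And>a g b. (a, g, b) \<in> E \<Longrightarrow> walk G E' (\<rho> a) (\<gamma> a \<otimes> g \<otimes> inv \<gamma> b) (\<rho> b)"
    and "walk G E v g w"
  shows "walk G E' (\<rho> v) (\<gamma> v \<otimes> g \<otimes> inv \<gamma> w) (\<rho> w)"
  using assms(5)
proof induction
  case (walk_nil v)
  then show ?case using walk.walk_nil[of G E' "\<rho> v"] \<gamma> by simp
next
  case (walk_fwd v g w k z)
  then have c: "g \<in> carrier G" "k \<in> carrier G" using E walk_closed[OF E] by auto
  have "walk G E' (\<rho> v) ((\<gamma> v \<otimes> g \<otimes> inv \<gamma> w) \<otimes> (\<gamma> w \<otimes> k \<otimes> inv \<gamma> z)) (\<rho> z)"
    by (rule walk_trans[OF E' edge[OF walk_fwd.hyps(1)] walk_fwd.IH])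
  then show ?case using c \<gamma> by (simp add: m_assoc inv_cancel)
next
  case (walk_bwd w g v k z)
  then have c: "g \<in> carrier G" "k \<in> carrier G" using E walk_closed[OF E] by auto
  have "walk G E' (\<rho> v) (inv (\<gamma> w \<otimes> g \<otimes> inv \<gamma> v) \<otimes> (\<gamma> w \<otimes> k \<otimes> inv \<gamma> z)) (\<rho> z)"
    by (rule walk_trans[OF E' walk_inv[OF E' edge[OF walk_bwd.hyps(1)]] walk_bwd.IH])
  then show ?case using c \<gamma> by (simp add: m_assoc inv_cancel inv_mult_group)
qed

lemma walk_mono: "walk G E v g w \<Longrightarrow> E \<subseteq> E' \<Longrightarrow> walk G E' v g w"
  by (induction rule: walk.induct) (auto intro: walk.intros)

lemma walk_leaves:
  "walk G E v g z \<Longrightarrow> v \<in> Z \<Longrightarrow> z \<notin> Z \<Longrightarrow>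
     \<exists>(a, h, b) \<in> E. a \<in> Z \<and> b \<notin> Z \<or> a \<notin> Z \<and> b \<in> Z"
proof (induction rule: walk.induct)
  case (walk_fwd v g w h z)
  then show ?case by (cases "w \<in> Z") blast+
next
  case (walk_bwd w g v h z)
  then show ?case by (cases "w \<in> Z") blast+
qed simp

lemma subgroup_loops:
  assumes E: "E \<subseteq> V \<times> carrier G \<times> W"
  shows "subgroup {g. walk G E v g v} G"
proof (rule subgroupI)
  show "{g. walk G E v g v} \<subseteq> carrier G" using walk_closed[OF E] by blast
  show "{g. walk G E v g v} \<noteq> {}" using walk_nil[of G E v] by blast
  show "inv g \<in> {g. walk G E v g v}" if "g \<in> {g. walk G E v g v}" for g
    using walk_inv[OF E, of v g v] that by blast
  show "g \<otimes> h \<in> {g. walk G E v g v}" if "g \<in> {g. walk G E v g v}" "h \<in> {g. walk G E v g v}" for g h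
    using walk_trans[OF E, of v g v h v] that by blast
qed

section \<open>Spanning trees and generators of loop groups\<close>

lemma finite_component:
  assumes "finite E"
  shows "finite {z. \<exists>g. walk G E v g z}"
proof (rule finite_subset)
  let ?V = "insert v (fst ` E \<union> (snd \<circ> snd) ` E)"
  have E: "E \<subseteq> ?V \<times> UNIV \<times> ?V" by force
  show "{z. \<exists>g. walk G E v g z} \<subseteq> ?V"
  proof
    fix z assume "z \<in> {z. \<exists>g. walk G E v g z}"
    then obtain g where "walk G E v g z" by blast
    from walk_vertex[OF this E] show "z \<in> ?V" by simp
  qed
qed (use assms in simp)

text \<open>As long as a tree misses a vertex of the component, some edge crosses its boundary and
  can be added. The potential \<open>t\<close> is built as the label of the walk inside the tree,
  hence is multiplicative along tree edges.\<close>

lemma spanning_tree: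
  assumes E: "E \<subseteq> V \<times> carrier G \<times> W" and fin: "finite E"
  obtains T t where "T \<subseteq> E" "card T + 1 = card {z. \<exists>g. walk G E v g z}"
    "\<And>z. t z \<in> carrier G" "t v = \<one>" "\<And>z. \<exists>g. walk G E v g z \<Longrightarrow> walk G E v (t z) z"
    "\<And>a g b. (a, g, b) \<in> T \<Longrightarrow> (\<exists>g. walk G E v g a) \<and> t b = t a \<otimes> g"
proof -
  define Z where "Z = {z. \<exists>g. walk G E v g z}"
  have finZ: "finite Z" unfolding Z_def by (rule finite_component[OF fin])
  have vZ: "v \<in> Z" using walk_nil[of G E v] by (auto simp: Z_def)
  \<comment> \<open>\<open>Y\<close> is the vertex set of a partial tree with edge set
    \<open>T\<close>.\<close>
  define st where "st Y T t \<longleftrightarrow> v \<in> Y \<and> Y \<subseteq> Z \<and> T \<subseteq> E \<and> card T + 1 = card Y \<and>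
    (\<forall>z. t z \<in> carrier G) \<and> t v = \<one> \<and> (\<forall>z\<in>Y. walk G E v (t z) z) \<and>
    (\<forall>(a, g, b)\<in>T. a \<in> Y \<and> b \<in> Y \<and> t b = t a \<otimes> g)" for Y T t
  have "\<exists>Y T t. st Y T t \<and> card Y = Suc k" if "Suc k \<le> card Z" for k
    using that
  proof (induction k)
    case 0
    have "st {v} {} (\<lambda>_. \<one>)" using vZ walk_nil[of G E v] by (simp add: st_def)
    then show ?case by (metis One_nat_def card.empty card_insert_disjoint empty_iff finite.emptyI)
  next
    case (Suc k)
    then obtain Y T t where st: "st Y T t" and card: "card Y = Suc k" by auto
    have YZ: "Y \<subseteq> Z" and vY: "v \<in> Y" using st by (auto simp: st_def)
    have "finite Y" using YZ finZ finite_subset by blast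
    have "finite T" using st fin finite_subset by (auto simp: st_def)
    have "Y \<noteq> Z" using card Suc.prems by auto
    then obtain z where z: "z \<in> Z" "z \<notin> Y" using YZ by auto
    then obtain g where "walk G E v g z" by (auto simp: Z_def)
    from walk_leaves[OF this vY z(2)] obtain a h b
      where e: "(a, h, b) \<in> E" and ab: "a \<in> Y \<and> b \<notin> Y \<or> a \<notin> Y \<and> b \<in> Y" by auto
    have h: "h \<in> carrier G" using E e by auto
    have "(a, h, b) \<notin> T" using st ab by (auto simp: st_def)
    \<comment> \<open>\<open>c\<close> is the end of the crossing edge outside \<open>Y\<close>. If
      the edge points towards the tree, the potential of \<open>c\<close> involves the inverse
      label.\<close>
    define c where "c = (if a \<in> Y then b else a)"
    define k' where "k' = (if a \<in> Y then t a \<otimes> h else t b \<otimes> inv h)"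
    have tc: "t z \<in> carrier G" for z using st by (auto simp: st_def)
    have c: "c \<notin> Y" using ab by (auto simp: c_def)
    have walk: "walk G E v k' c"
    proof (cases "a \<in> Y")
      case True
      then show ?thesis using st walk_trans[OF E _ walk_edge[OF E e]] by (auto simp: st_def c_def k'_def)
    next
      case False
      then show ?thesis using st ab walk_trans[OF E _ walk_edge_inv[OF E e]] by (auto simp: st_def c_def k'_def)
    qed
    have k': "k' \<in> carrier G" using tc h by (auto simp: k'_def)
    have "st (insert c Y) (insert (a, h, b) T) (t(c := k'))"
    proof -
      have "c \<in> Z" using walk by (auto simp: Z_def)
      have old: "a' \<in> Y \<and> b' \<in> Y \<and> t b' = t a' \<otimes> g'" if "(a', g', b') \<in> T" for a' g' b'
        using st that by (auto simp: st_def)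
      have new: "(t(c := k')) b = (t(c := k')) a \<otimes> h" "a \<in> insert c Y" "b \<in> insert c Y"
        using ab tc h by (auto simp: c_def k'_def m_assoc)
      show ?thesis
        unfolding st_def
      proof (intro conjI ballI allI)
        show "card (insert (a, h, b) T) + 1 = card (insert c Y)"
          using st c \<open>finite Y\<close> \<open>finite T\<close> \<open>(a, h, b) \<notin> T\<close> by (simp add: st_def)
        show "(t(c := k')) v = \<one>" using st c vY by (auto simp: st_def)
        show "walk G E v ((t(c := k')) z) z" if "z \<in> insert c Y" for z
          using that walk st c by (auto simp: st_def)
        show "case x of (a', g', b') \<Rightarrow> a' \<in> insert c Y \<and> b' \<in> insert c Y \<and> (t(c := k')) b' = (t(c := k')) a' \<otimes> g'"
          if "x \<in> insert (a, h, b) T" for x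
          using that new old c by (auto simp del: fun_upd_apply) (auto dest!: old)
      qed (use st e \<open>c \<in> Z\<close> k' tc in \<open>auto simp: st_def\<close>)
    qed
    moreover have "card (insert c Y) = Suc (Suc k)" using card c \<open>finite Y\<close> by simp
    ultimately show ?case by blast
  qed
  from this[of "card Z - 1"] obtain Y T t where st: "st Y T t" and "card Y = card Z"
    using vZ finZ by (metis One_nat_def Suc_pred card_gt_0_iff empty_iff le_refl)
  moreover have "Y \<subseteq> Z" using st by (simp add: st_def)
  ultimately have "Y = Z" using finZ card_subset_eq by blast
  show thesis
    by (rule that[of T t]) (use st \<open>Y = Z\<close> in \<open>auto simp: st_def Z_def\<close>)
qed

text \<open>One closed walk through each edge outside a spanning tree suffices, since tree edges
  become \<open>\<one>\<close>. Their number is edges minus vertices plus one in the component;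
  distinct edges may yield equal loops, hence the inequality.\<close>

lemma loops_generators:
  assumes E: "E \<subseteq> V \<times> carrier G \<times> W" and fin: "finite E"
  obtains S where "finite S" "S \<subseteq> {g. walk G E v g v}" "generate G S = {g. walk G E v g v}"
    "card S + card {z. \<exists>g. walk G E v g z} \<le> card {x\<in>E. \<exists>g. walk G E v g (fst x)} + 1"
proof -
  obtain T t where T: "T \<subseteq> E" and cT: "card T + 1 = card {z. \<exists>g. walk G E v g z}"
    and t: "\<And>z. t z \<in> carrier G" "t v = \<one>" "\<And>z. \<exists>g. walk G E v g z \<Longrightarrow> walk G E v (t z) z"
    and tT: "\<And>a g b. (a, g, b) \<in> T \<Longrightarrow> (\<exists>g. walk G E v g a) \<and> t b = t a \<otimes> g"
    by (rule spanning_tree[OF E fin, of v]) (rule that)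
  define EZ where "EZ = {x\<in>E. \<exists>g. walk G E v g (fst x)}"
  define S where "S = (\<lambda>(a, g, b). t a \<otimes> g \<otimes> inv t b) ` (EZ - T)"
  have finEZ: "finite EZ" using fin by (simp add: EZ_def)
  have TE: "T \<subseteq> EZ" using T tT by (force simp: EZ_def)
  have S_loops: "S \<subseteq> {g. walk G E v g v}"
  proof
    fix s assume "s \<in> S"
    then obtain a g b where abg: "(a, g, b) \<in> EZ" and s: "s = t a \<otimes> g \<otimes> inv t b"
      by (auto simp: S_def)
    then have s: "s = t a \<otimes> g \<otimes> inv t b" "(a, g, b) \<in> E" "\<exists>g. walk G E v g a"
      by (simp_all add: EZ_def)
    have 1: "walk G E v (t a \<otimes> g) b" by (rule walk_trans[OF E t(3)[OF s(3)] walk_edge[OF E s(2)]])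
    then have "walk G E b (inv t b) v" by (intro walk_inv[OF E] t(3)) auto
    from walk_trans[OF E 1 this] show "s \<in> {g. walk G E v g v}" by (simp add: s)
  qed
  have S_carrier: "S \<subseteq> carrier G" using S_loops walk_closed[OF E] by blast
  \<comment> \<open>Stated for all walks in the component, since the induction leaves the base
    point; the potentials close each walk up.\<close>
  have gen: "t a \<otimes> g \<otimes> inv t b \<in> generate G S" if "walk G E a g b" "\<exists>g. walk G E v g a" for a g b
    using that
  proof induction
    case (walk_nil a)
    show ?case using t(1)[of a] by (simp add: generate.one)
  next
    case (walk_fwd a g b k z)
    have c: "g \<in> carrier G" "k \<in> carrier G"
      using E walk_fwd.hyps(1) walk_closed[OF E walk_fwd.hyps(2)] by auto
    have "t a \<otimes> g \<otimes> inv t b \<in> generate G S"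
    proof (cases "(a, g, b) \<in> T")
      case True
      then have "t b = t a \<otimes> g" using tT by blast
      then have "t a \<otimes> g \<otimes> inv t b = \<one>" using r_inv[OF t(1)[of b]] by simp
      then show ?thesis by (simp add: generate.one)
    next
      case False
      then have "(a, g, b) \<in> EZ - T"
        using walk_fwd.hyps(1) walk_fwd.prems by (simp add: EZ_def)
      then have "t a \<otimes> g \<otimes> inv t b \<in> S" unfolding S_def by (rule image_eqI[rotated]) simp
      then show ?thesis by (rule generate.incl)
    qed
    moreover obtain h where "walk G E v h a" using walk_fwd.prems by blast
    from walk_trans[OF E this walk_edge[OF E walk_fwd.hyps(1)]]
    have "t b \<otimes> k \<otimes> inv t z \<in> generate G S" by (intro walk_fwd.IH exI)
    ultimately have "(t a \<otimes> g \<otimes> inv t b) \<otimes> (t b \<otimes> k \<otimes> inv t z) \<in> generate G S"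
      by (rule generate.eng)
    then show ?case using c t(1) by (simp add: m_assoc inv_cancel)
  next
    case (walk_bwd b g a k z)
    have c: "g \<in> carrier G" "k \<in> carrier G"
      using E walk_bwd.hyps(1) walk_closed[OF E walk_bwd.hyps(2)] by auto
    obtain h where "walk G E v h a" using walk_bwd.prems by blast
    from walk_trans[OF E this walk_edge_inv[OF E walk_bwd.hyps(1)]]
    have b: "\<exists>g. walk G E v g b" by (rule exI)
    have "t b \<otimes> g \<otimes> inv t a \<in> generate G S"
    proof (cases "(b, g, a) \<in> T")
      case True
      then have "t a = t b \<otimes> g" using tT by blast
      then have "t b \<otimes> g \<otimes> inv t a = \<one>" using r_inv[OF t(1)[of a]] by simp
      then show ?thesis by (simp add: generate.one)
    next
      case False
      then have "(b, g, a) \<in> EZ - T" using walk_bwd.hyps(1) b by (simp add: EZ_def)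
      then have "t b \<otimes> g \<otimes> inv t a \<in> S" unfolding S_def by (rule image_eqI[rotated]) simp
      then show ?thesis by (rule generate.incl)
    qed
    then have "inv (t b \<otimes> g \<otimes> inv t a) \<otimes> (t b \<otimes> k \<otimes> inv t z) \<in> generate G S"
      by (rule generate.eng[OF generate_m_inv_closed[OF S_carrier] walk_bwd.IH[OF b]])
    then show ?case using c t(1) by (simp add: m_assoc inv_cancel inv_mult_group)
  qed
  show thesis
  proof
    show "finite S" using finEZ by (simp add: S_def)
    show "S \<subseteq> {g. walk G E v g v}" by fact
    show "generate G S = {g. walk G E v g v}"
    proof
      show "generate G S \<subseteq> {g. walk G E v g v}"
        by (rule generate_subgroup_incl[OF S_loops subgroup_loops[OF E]])
      show "{g. walk G E v g v} \<subseteq> generate G S"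
      proof
        fix g assume g: "g \<in> {g. walk G E v g v}"
        then have "t v \<otimes> g \<otimes> inv t v \<in> generate G S" by (intro gen) auto
        then show "g \<in> generate G S" using g t(2) walk_closed[OF E] by auto
      qed
    qed
    have "card S \<le> card (EZ - T)" unfolding S_def using finEZ by (intro card_image_le) auto
    also have "\<dots> = card EZ - card T" using TE finEZ by (simp add: card_Diff_subset finite_subset)
    finally have "card S + card T \<le> card EZ" using card_mono[OF finEZ TE] by simp
    then show "card S + card {z. \<exists>g. walk G E v g z} \<le> card {x\<in>E. \<exists>g. walk G E v g (fst x)} + 1"
      using cT by (simp add: EZ_def)
  qed
qed

text \<open>The component of \<open>v\<close> is replaced by a star, whose edges may be chosen freely, and loops at \<open>v\<close>.\<close>

lemma exchange_edge:
  assumes E: "E \<subseteq> V \<times> A \<times> V" and A: "subgroup A G" and fin: "finite E" and v: "v \<in> V"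
    and vgw: "walk G E v g w" and ne: "v \<noteq> w"
  obtains E' where "finite E'" "card E' < card E" "E' \<subseteq> V \<times> A \<times> V"
    "\<And>a h b. (a, h, b) \<in> E' \<Longrightarrow> walk G E a h b"
    "\<And>a h b. (a, h, b) \<in> E \<Longrightarrow> walk G (insert (v, g, w) E') a h b"
proof -
  have A_sub: "A \<subseteq> carrier G" by (rule subgroup.subset[OF A])
  have E_car: "E \<subseteq> V \<times> carrier G \<times> V" using E A_sub by auto
  define Z where "Z = {z. \<exists>g. walk G E v g z}"
  define EZ where "EZ = {x\<in>E. fst x \<in> Z}"
  obtain S where S: "finite S" "S \<subseteq> {g. walk G E v g v}" "generate G S = {g. walk G E v g v}"
    and cS: "card S + card Z \<le> card EZ + 1"
    by (rule loops_generators[OF E_car fin, of v]) (rule that, simp_all add: Z_def EZ_def)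
  have finZ: "finite Z" unfolding Z_def by (rule finite_component[OF fin])
  have vZ: "v \<in> Z" and wZ: "w \<in> Z" using vgw walk_nil[of G E v] by (auto simp: Z_def)
  \<comment> \<open>The chosen walk to \<open>w\<close> has label \<open>g\<close>, so that
    \<open>(v, g, w)\<close> is the star edge to \<open>w\<close>.\<close>
  define t where "t z = (if z = v then \<one> else if z = w then g else SOME h. walk G E v h z)" for z
  have t: "walk G E v (t z) z" if "z \<in> Z" for z
  proof -
    have "walk G E v (SOME h. walk G E v h z) z" by (rule someI_ex) (use that in \<open>simp add: Z_def\<close>)
    then show ?thesis using vgw walk_nil[of G E v] by (auto simp: t_def)
  qed
  \<comment> \<open>The star edge to \<open>w\<close> is left out, which saves one edge; the centre
    \<open>v\<close> has none.\<close>
  define E' where "E' = (E - EZ) \<union> ((\<lambda>z. (v, t z, z)) ` (Z - {v, w}) \<union> (\<lambda>s. (v, s, v)) ` S)"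
  have ZV: "Z \<subseteq> V" using walk_vertex[OF _ E v] by (auto simp: Z_def)
  have walkE': "walk G E a h b" if "(a, h, b) \<in> E'" for a h b
  proof -
    consider "(a, h, b) \<in> E" | "a = v" "h = t b" "b \<in> Z" | "a = v" "b = v" "h \<in> S"
      using \<open>(a, h, b) \<in> E'\<close> by (auto simp: E'_def)
    then show ?thesis using t S(2) by cases (simp_all add: walk_edge[OF E_car] subset_iff)
  qed
  have E'_sub: "E' \<subseteq> V \<times> A \<times> V"
  proof
    fix x assume x: "x \<in> E'"
    obtain a h b where abh: "x = (a, h, b)" using prod_cases3 by blast
    with x have "h \<in> A" using walk_label[OF A E walkE'[of a h b]] by simp
    moreover have "a \<in> V" "b \<in> V" using x abh E ZV v by (auto simp: E'_def)
    ultimately show "x \<in> V \<times> A \<times> V" by (simp add: abh)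
  qed
  have finEZ: "finite EZ" using fin by (simp add: EZ_def)
  define D where "D = insert (v, g, w) E'"
  have D: "D \<subseteq> UNIV \<times> carrier G \<times> UNIV"
    using E'_sub A_sub walk_closed[OF E_car vgw] unfolding D_def by blast
  have tD: "walk G D v (t z) z" if z: "z \<in> Z" for z
  proof -
    consider "z = v" | "z \<noteq> v" "z = w" | "z \<in> Z - {v, w}" using z by auto
    then show ?thesis
    proof cases
      case 1 then show ?thesis using walk_nil[of G D v] by (simp add: t_def)
    next
      case 2
      then have "(v, t z, z) \<in> D" by (simp add: t_def D_def)
      then show ?thesis by (rule walk_edge[OF D])
    next
      case 3
      then have "(v, t z, z) \<in> D" by (simp add: D_def E'_def)
      then show ?thesis by (rule walk_edge[OF D])
    qed
  qed
  have loops: "walk G D v h v" if "walk G E v h v" for h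
  proof -
    have "S \<subseteq> {g. walk G D v g v}"
    proof
      fix s assume "s \<in> S"
      then have "(v, s, v) \<in> D" by (simp add: D_def E'_def)
      then show "s \<in> {g. walk G D v g v}" by (simp add: walk_edge[OF D])
    qed
    from generate_subgroup_incl[OF this subgroup_loops[OF D]] that S(3) show ?thesis by blast
  qed
  show thesis
  proof
    show "finite E'" using fin finZ S(1) by (simp add: E'_def)
    let ?X = "(\<lambda>z. (v, t z, z)) ` (Z - {v, w}) \<union> (\<lambda>s. (v, s, v)) ` S"
    have "card ?X \<le> card (Z - {v, w}) + card S"
      using finZ S(1) by (intro order_trans[OF card_Un_le] add_mono card_image_le) auto
    moreover have "card (Z - {v, w}) = card Z - 2"
      using vZ wZ ne by (subst card_Diff_subset) auto
    moreover have "2 \<le> card Z" using card_mono[OF finZ, of "{v, w}"] vZ wZ ne by simp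
    moreover have "card (E - EZ) = card E - card EZ" "card EZ \<le> card E"
      using fin finEZ by (auto simp: EZ_def intro!: card_Diff_subset card_mono)
    moreover have "card E' \<le> card (E - EZ) + card ?X" unfolding E'_def by (rule card_Un_le)
    ultimately show "card E' < card E" using cS by linarith
    show "E' \<subseteq> V \<times> A \<times> V" by fact
    show "walk G E a h b" if "(a, h, b) \<in> E'" for a h b by (rule walkE'[OF that])
    show "walk G (insert (v, g, w) E') a h b" if e: "(a, h, b) \<in> E" for a h b
    proof (cases "a \<in> Z")
      case False
      then have "(a, h, b) \<in> D" using e by (simp add: D_def E'_def EZ_def)
      then show ?thesis using walk_edge[OF D] by (simp add: D_def)
    next
      case True
      have va: "walk G E v (t a) a" by (rule t[OF True])
      have vb: "walk G E v (t a \<otimes> h) b" by (rule walk_trans[OF E_car va walk_edge[OF E_car e]])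
      then have bZ: "b \<in> Z" by (auto simp: Z_def)
      have c: "t a \<in> carrier G" "t b \<in> carrier G" "h \<in> carrier G"
        using walk_closed[OF E_car t[OF True]] walk_closed[OF E_car t[OF bZ]] e E_car by auto
      have "walk G D v (t a \<otimes> h \<otimes> inv t b) v"
        by (intro loops walk_trans[OF E_car vb] walk_inv[OF E_car] t bZ)
      from walk_trans[OF D walk_inv[OF D tD[OF True]] walk_trans[OF D this tD[OF bZ]]]
      show ?thesis using c by (simp add: D_def m_assoc inv_cancel)
    qed
  qed
qed

end

section \<open>Ranks of kernels in amalgamated products\<close>

text \<open>The integer is the degree of the vertex; the natural number tells vertices of equal
  degree apart.\<close>

type_synonym vertex = "nat \<times> int"

text \<open>Nonempty reduced products whose first factor has colour \<open>i\<close>. The normal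
  form theorem for amalgams enters solely as the statement that they are nontrivial.\<close>

inductive alternating :: "('g, 'm) monoid_scheme \<Rightarrow> (bool \<Rightarrow> 'g set) \<Rightarrow> 'g set \<Rightarrow> bool \<Rightarrow> 'g \<Rightarrow> bool"
  for G A C where
  alternating_single: "g \<in> A i \<Longrightarrow> g \<notin> C \<Longrightarrow> alternating G A C i g"
| alternating_Cons: "g \<in> A i \<Longrightarrow> g \<notin> C \<Longrightarrow> alternating G A C (\<not> i) h \<Longrightarrow> alternating G A C i (g \<otimes>\<^bsub>G\<^esub> h)"

text \<open>The group is the amalgamated product of \<open>A True\<close> and \<open>A False\<close> over \<open>C\<close>, and the kernel \<open>K\<close> of \<open>\<phi>\<close> meets
  \<open>C\<close> trivially. So \<open>K\<close> acts on the Bass--Serre tree with trivial edge stabilizers.\<close>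

locale graded_amalgam = group +
  fixes A :: "bool \<Rightarrow> 'a set" and C :: "'a set" and \<phi> :: "'a \<Rightarrow> int" and M :: int and \<delta> :: "bool \<Rightarrow> int"
  assumes A: "subgroup (A i) G" and C: "subgroup C G" and C_sub: "C \<subseteq> A i"
    and \<phi>_mult: "g \<in> carrier G \<Longrightarrow> h \<in> carrier G \<Longrightarrow> \<phi> (g \<otimes> h) = \<phi> g + \<phi> h"
    and \<phi>_inj: "c \<in> C \<Longrightarrow> \<phi> c = 0 \<Longrightarrow> c = \<one>"
    and \<phi>_A: "\<phi> ` A i = {k. \<delta> i dvd k}" and \<phi>_C: "\<phi> ` C = {k. M dvd k}"
    and \<phi>_surj: "\<phi> ` carrier G = UNIV"
    and M_pos: "M > 0" and \<delta>_pos: "\<delta> i > 0"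
    and gen: "generate G (\<Union>i. A i) = carrier G"
    and alt_ne: "alternating G A C i g \<Longrightarrow> g \<noteq> \<one>"
begin

definition "K = {g \<in> carrier G. \<phi> g = 0}"

lemma A_closed: "g \<in> A i \<Longrightarrow> g \<in> carrier G"
  using subgroup.subset[OF A] by auto

lemma C_closed [simp]: "g \<in> C \<Longrightarrow> g \<in> carrier G"
  using subgroup.subset[OF C] by auto

lemma A_sub [simp]: "A i \<subseteq> carrier G"
  using subgroup.subset[OF A] .

lemmas A_mult [simp] = subgroup.m_closed[OF A]
lemmas A_inv [simp] = subgroup.m_inv_closed[OF A]
lemmas A_one [simp] = subgroup.one_closed[OF A]
lemmas C_mult [simp] = subgroup.m_closed[OF C]
lemmas C_inv [simp] = subgroup.m_inv_closed[OF C]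
lemmas C_one [simp] = subgroup.one_closed[OF C]

lemma C_A: "c \<in> C \<Longrightarrow> c \<in> A i"
  using C_sub by auto

lemma \<phi>_one [simp]: "\<phi> \<one> = 0"
  using \<phi>_mult[of \<one> \<one>] by simp

lemma \<phi>_inv [simp]: "g \<in> carrier G \<Longrightarrow> \<phi> (inv g) = - \<phi> g"
  using \<phi>_mult[of g "inv g"] by simp

lemma \<delta>_dvd_M: "\<delta> i dvd M"
proof -
  have "M \<in> \<phi> ` C" by (simp add: \<phi>_C)
  then have "M \<in> \<phi> ` A i" using C_sub by blast
  then show ?thesis by (simp add: \<phi>_A)
qed

lemma ex_C: "M dvd k \<Longrightarrow> \<exists>c\<in>C. \<phi> c = k"
  using \<phi>_C by (metis (mono_tags, lifting) imageE mem_Collect_eq)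

lemma ex_A: "\<delta> i dvd k \<Longrightarrow> \<exists>a\<in>A i. \<phi> a = k"
  using \<phi>_A by (metis (mono_tags, lifting) imageE mem_Collect_eq)

lemma \<phi>_C_dvd: "c \<in> C \<Longrightarrow> M dvd \<phi> c"
  using \<phi>_C by blast

lemma \<phi>_A_dvd: "a \<in> A i \<Longrightarrow> \<delta> i dvd \<phi> a"
  using \<phi>_A by blast

lemma subgroup_K: "subgroup K G"
  by (rule subgroupI) (auto simp: K_def \<phi>_mult)

lemma subgroup_AK: "subgroup (A i \<inter> K) G"
  using subgroups_Inter_pair[OF A subgroup_K] .

lemma alternating_A: "alternating G A C i g \<Longrightarrow> g \<in> carrier G"
  by (induction rule: alternating.induct) (auto intro: A_closed)

lemma alternating_C_mult:
  assumes "alternating G A C i g" "c \<in> C"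
  shows "alternating G A C i (c \<otimes> g)"
proof -
  have ne: "c \<otimes> h \<notin> C" if "h \<in> A i" "h \<notin> C" for h i
  proof
    assume "c \<otimes> h \<in> C"
    then have "inv c \<otimes> (c \<otimes> h) \<in> C" using assms(2) by simp
    then show False using that assms(2) A_closed[OF that(1)] by (simp add: inv_cancel)
  qed
  show ?thesis using assms(1)
  proof cases
    case alternating_single
    then show ?thesis using ne assms(2) by (intro alternating.alternating_single) (auto simp: C_A)
  next
    case (alternating_Cons h k)
    have "alternating G A C i ((c \<otimes> h) \<otimes> k)"
      using alternating_Cons ne assms(2) by (intro alternating.alternating_Cons) (auto simp: C_A)
    then show ?thesis
      using alternating_Cons assms(2) alternating_A A_closed[of h i] by (simp add: m_assoc)
  qed
qed

text \<open>Multiplying by the inverse of an element of \<open>A i\<close> leaves an alternating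
  product, either with one more factor or, for an element of \<open>C\<close>, with a changed first
  factor. So it cannot give \<open>\<one>\<close>.\<close>

lemma alternating_notin:
  assumes "alternating G A C (\<not> i) g" shows "g \<notin> A i"
proof
  assume g: "g \<in> A i"
  show False
  proof (cases "g \<in> C")
    case True
    then have "alternating G A C (\<not> i) (inv g \<otimes> g)" using C_inv alternating_C_mult[OF assms] by blast
    then show False using alt_ne[of "\<not> i" "inv g \<otimes> g"] True by simp
  next
    case False
    have "inv g \<notin> C"
    proof
      assume "inv g \<in> C"
      then have "inv (inv g) \<in> C" by (rule C_inv)
      then show False using False A_closed[OF g] by simp
    qed
    then have "alternating G A C i (inv g \<otimes> g)" using assms g by (intro alternating_Cons) simp_all
    then show False using alt_ne[of i "inv g \<otimes> g"] A_closed[OF g] by simp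
  qed
qed

lemma alternating_notin_C: "alternating G A C i g \<Longrightarrow> g \<notin> C"
  using alternating_notin[of "\<not> i" g] C_sub[of "\<not> i"] by auto

abbreviation cwalk :: "(bool \<Rightarrow> ('v \<times> 'a \<times> 'v) set) \<Rightarrow> 'v \<Rightarrow> 'a \<Rightarrow> 'v \<Rightarrow> bool" where
  "cwalk E \<equiv> walk G (\<Union>i. E i)"

abbreviation "v0 \<equiv> (0::nat, 0::int)"

text \<open>The last inequality bounds the first Betti number of the connected graph by
  \<open>n\<close>. The degrees \<open>snd v\<close> follow \<open>\<phi>\<close>, so that loops
  have labels in \<open>K\<close>.\<close>

definition graph :: "vertex set \<Rightarrow> (bool \<Rightarrow> (vertex \<times> 'a \<times> vertex) set) \<Rightarrow> nat \<Rightarrow> bool" where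
  "graph V E n \<longleftrightarrow> finite V \<and> v0 \<in> V \<and> (\<forall>i. finite (E i) \<and> E i \<subseteq> V \<times> A i \<times> V) \<and>
     (\<forall>i v g w. (v, g, w) \<in> E i \<longrightarrow> snd w = snd v + \<phi> g) \<and>
     (\<forall>v\<in>V. \<exists>g. cwalk E v0 g v) \<and>
     card (E True) + card (E False) + 1 \<le> card V + n"

text \<open>Vertices stand for edge orbits of \<open>K\<close> on the tree, that is, for residues
  modulo \<open>M\<close>, and one-coloured components for vertex orbits. Before folding, an orbit
  may be represented several times, but none may be missing.\<close>

definition full :: "vertex set \<Rightarrow> (bool \<Rightarrow> (vertex \<times> 'a \<times> vertex) set) \<Rightarrow> bool" where
  "full V E \<longleftrightarrow> (\<forall>j. \<exists>v\<in>V. M dvd snd v - j) \<and> (\<forall>g\<in>K. cwalk E v0 g v0)"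

lemma graph_sub: "graph V E n \<Longrightarrow> (\<Union>i. E i) \<subseteq> V \<times> carrier G \<times> V"
  unfolding graph_def using A_sub by blast

lemma graph_sub1: "graph V E n \<Longrightarrow> E i \<subseteq> V \<times> A i \<times> V"
  unfolding graph_def by blast

lemma graph_sub1': "graph V E n \<Longrightarrow> E i \<subseteq> V \<times> carrier G \<times> V"
  unfolding graph_def using A_sub by blast

lemma walk_grade:
  assumes D: "D \<subseteq> V \<times> carrier G \<times> W" and grade: "\<And>v g w. (v, g, w) \<in> D \<Longrightarrow> \<nu> w = \<nu> v + \<phi> g"
    and "walk G D v g w"
  shows "\<nu> w = \<nu> v + \<phi> g"
  using assms(3)
proof induction
  case (walk_fwd v g w h z)
  then have "g \<in> carrier G" "h \<in> carrier G" using D walk_closed[OF D] by auto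
  then show ?case using walk_fwd grade[of v g w] by (simp add: \<phi>_mult)
next
  case (walk_bwd w g v h z)
  then have "g \<in> carrier G" "h \<in> carrier G" using D walk_closed[OF D] by auto
  then show ?case using walk_bwd grade[of w g v] by (simp add: \<phi>_mult)
qed simp

lemma graph_grade:
  assumes "graph V E n" "cwalk E v g w" shows "snd w = snd v + \<phi> g"
proof (rule walk_grade[OF graph_sub[OF assms(1)] _ assms(2)])
  show "snd w = snd v + \<phi> g" if "(v, g, w) \<in> (\<Union>i. E i)" for v g w
    using that assms(1) unfolding graph_def by blast
qed

lemma graph_grade1:
  assumes "graph V E n" "walk G (E i) v g w" shows "snd w = snd v + \<phi> g"
  by (rule graph_grade[OF assms(1) walk_mono[OF assms(2)]]) blast

subsection \<open>Construction of a graph from generators\<close>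

text \<open>The new edge comes with a new vertex, so the bound on the Betti number is kept.\<close>

lemma graph_add_edge:
  assumes g: "graph V E n" and "v \<in> V" "a \<in> A i"
  shows "\<exists>V' E' w. graph V' E' n \<and> V \<subseteq> V' \<and> (\<forall>i. E i \<subseteq> E' i) \<and> w \<in> V' \<and>
    cwalk E' v a w"
proof -
  have fin: "finite V" using g by (simp add: graph_def)
  obtain k where k: "k \<notin> fst ` V" using ex_new_if_finite[of "fst ` V"] fin by auto
  define w where "w = (k, snd v + \<phi> a)"
  have w: "w \<notin> V" using k by (force simp: w_def)
  define E' where "E' j = (if j = i then insert (v, a, w) (E j) else E j)" for j
  have sub: "E j \<subseteq> E' j" for j by (auto simp: E'_def)
  have E'_sub: "E' j \<subseteq> insert w V \<times> A j \<times> insert w V" for j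
    using graph_sub1[OF g, of j] assms(2,3) by (auto simp: E'_def)
  then have E'_sub': "(\<Union>i. E' i) \<subseteq> insert w V \<times> carrier G \<times> insert w V" using A_sub by blast
  have "(v, a, w) \<in> (\<Union>i. E' i)" by (auto simp: E'_def)
  then have vw: "cwalk E' v a w" by (rule walk_edge[OF E'_sub'])
  have old: "\<exists>g. cwalk E' v0 g z" if "z \<in> V" for z
  proof -
    obtain h where "cwalk E v0 h z" using g \<open>z \<in> V\<close> unfolding graph_def by blast
    moreover have "(\<Union>i. E i) \<subseteq> (\<Union>i. E' i)" using sub by (rule UN_mono[OF subset_refl])
    ultimately have "cwalk E' v0 h z" by (rule walk_mono)
    then show ?thesis by (rule exI)
  qed
  obtain h where "cwalk E' v0 h v" using old[OF assms(2)] by blast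
  from walk_trans[OF E'_sub' this vw] have new: "\<exists>g. cwalk E' v0 g w" by (rule exI)
  have "card (E' True) + card (E' False) \<le> card (E True) + card (E False) + 1"
    using g by (cases i) (auto simp: E'_def graph_def card_insert_if)
  moreover have "card (insert w V) = card V + 1" using w fin by simp
  moreover have "card (E True) + card (E False) + 1 \<le> card V + n" using g by (simp add: graph_def)
  ultimately have card: "card (E' True) + card (E' False) + 1 \<le> card (insert w V) + n" by linarith
  have grade: "snd z = snd y + \<phi> h" if "(y, h, z) \<in> E' j" for j y h z
  proof (cases "(y, h, z) \<in> E j")
    case True
    then show ?thesis using g unfolding graph_def by blast
  next
    case False
    then have "(y, h, z) = (v, a, w)" using that by (auto simp: E'_def split: if_splits)
    then show ?thesis by (simp add: w_def)
  qed
  have "finite (E' j)" for j using g by (simp add: E'_def graph_def)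
  then have "graph (insert w V) E' n"
    unfolding graph_def using E'_sub card grade old new fin g by (simp add: graph_def)
  then show ?thesis using sub vw by blast
qed

lemma graph_add_walk:
  assumes "g \<in> generate G (\<Union>i. A i)" "graph V E n" "v \<in> V"
  shows "\<exists>V' E' w. graph V' E' n \<and> V \<subseteq> V' \<and> (\<forall>i. E i \<subseteq> E' i) \<and> w \<in> V' \<and>
    cwalk E' v g w"
  using assms
proof (induction g arbitrary: V E v)
  case one
  then show ?case using walk_nil[of G _ v] by blast
next
  case (incl a)
  then show ?case using graph_add_edge by blast
next
  case (inv a)
  then obtain i where "a \<in> A i" by blast
  then have "inv a \<in> A i" by simp
  then show ?case using graph_add_edge[OF inv(2,3)] by blast
next
  case (eng g h)
  obtain V1 E1 w1 where 1: "graph V1 E1 n" "V \<subseteq> V1" "\<forall>i. E i \<subseteq> E1 i" "w1 \<in> V1"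
    "cwalk E1 v g w1" using eng.IH(1)[OF eng.prems] by blast
  obtain V2 E2 w2 where 2: "graph V2 E2 n" "V1 \<subseteq> V2" "\<forall>i. E1 i \<subseteq> E2 i" "w2 \<in> V2"
    "cwalk E2 w1 h w2" using eng.IH(2)[OF 1(1,4)] by blast
  have "(\<Union>i. E1 i) \<subseteq> (\<Union>i. E2 i)" using 2(3) by blast
  then have "cwalk E2 v g w1" by (rule walk_mono[OF 1(5)])
  from walk_trans[OF graph_sub[OF 2(1)] this 2(5)]
  have "cwalk E2 v (g \<otimes> h) w2" .
  moreover have "V \<subseteq> V2" "\<forall>i. E i \<subseteq> E2 i" using 1(2,3) 2(2,3) by blast+
  ultimately show ?case using 2(1,4) by blast
qed

text \<open>The walk for \<open>k\<close> ends in degree 0 and can be closed by an edge with label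
  \<open>\<one>\<close>. This is the only edge added without a new vertex, hence
  \<open>Suc n\<close>.\<close>

lemma graph_add_loop:
  assumes g: "graph V E n" and "k \<in> K"
  shows "\<exists>V' E'. graph V' E' (Suc n) \<and> V \<subseteq> V' \<and> (\<forall>i. E i \<subseteq> E' i) \<and> cwalk E' v0 k v0"
proof -
  have k: "k \<in> generate G (\<Union>i. A i)" "\<phi> k = 0" using assms(2) gen by (auto simp: K_def)
  have "v0 \<in> V" using g by (simp add: graph_def)
  from graph_add_walk[OF k(1) g this] obtain V1 E1 w where 1: "graph V1 E1 n" "V \<subseteq> V1"
    "\<forall>i. E i \<subseteq> E1 i" "w \<in> V1" "cwalk E1 v0 k w" by blast
  have w: "snd w = 0" using graph_grade[OF 1(1,5)] k(2) by simp
  define E' where "E' = E1(True := insert (w, \<one>, v0) (E1 True))"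
  have sub: "E1 j \<subseteq> E' j" for j by (auto simp: E'_def)
  then have sub': "(\<Union>i. E1 i) \<subseteq> (\<Union>i. E' i)" by blast
  have v0: "v0 \<in> V1" using 1(1) by (simp add: graph_def)
  have E'_sub: "E' j \<subseteq> V1 \<times> A j \<times> V1" for j
    using graph_sub1[OF 1(1), of j] 1(4) v0 by (auto simp: E'_def)
  then have E'_sub': "(\<Union>i. E' i) \<subseteq> V1 \<times> carrier G \<times> V1" using A_sub by blast
  have "(w, \<one>, v0) \<in> (\<Union>i. E' i)" by (auto simp: E'_def)
  from walk_trans[OF E'_sub' walk_mono[OF 1(5) sub'] walk_edge[OF E'_sub' this]]
  have loop: "cwalk E' v0 k v0" using assms(2) by (simp add: K_def)
  have "\<exists>g. cwalk E' v0 g z" if "z \<in> V1" for z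
  proof -
    obtain h where "cwalk E1 v0 h z" using 1(1) \<open>z \<in> V1\<close> unfolding graph_def by blast
    from walk_mono[OF this sub'] show ?thesis by (rule exI)
  qed
  moreover have "card (E' True) + card (E' False) \<le> card (E1 True) + card (E1 False) + 1"
    using 1(1) by (auto simp: E'_def graph_def card_insert_if)
  ultimately have "graph V1 E' (Suc n)"
    using 1(1) E'_sub w unfolding graph_def by (auto simp: E'_def)
  then show ?thesis using 1(2,3) sub loop by blast
qed

text \<open>A subdivided bouquet of the elements of \<open>S\<close>, with branches attached that
  reach the remaining residues; branches do not change the Betti number.\<close>

lemma ex_full_graph:
  assumes S: "finite S" "S \<subseteq> K" "generate G S = K"
  shows "\<exists>V E. graph V E (card S) \<and> full V E"
proof -
  have "\<exists>V E. graph V E (card S) \<and> (\<forall>s\<in>S. cwalk E v0 s v0)"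
    using S(1,2)
  proof (induction S)
    case empty
    have "graph {v0} (\<lambda>_. {}) 0" using walk_nil[of G _ v0] by (auto simp: graph_def)
    then show ?case by auto
  next
    case (insert k S)
    then obtain V E where VE: "graph V E (card S)" "\<forall>s\<in>S. cwalk E v0 s v0" by auto
    obtain V' E' where VE': "graph V' E' (Suc (card S))" "\<forall>i. E i \<subseteq> E' i" "cwalk E' v0 k v0"
      using graph_add_loop[OF VE(1), of k] insert.prems by auto
    have "(\<Union>i. E i) \<subseteq> (\<Union>i. E' i)" using VE'(2) by blast
    then have "cwalk E' v0 s v0" if "s \<in> S" for s
      using VE(2) that walk_mono[of "\<Union>i. E i" v0 s v0] by blast
    then have "\<forall>s\<in>insert k S. cwalk E' v0 s v0" using VE'(3) by simp
    then show ?case using VE'(1) insert.hyps by (intro exI conjI) simp_all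
  qed
  then obtain V E where VE: "graph V E (card S)" "\<forall>s\<in>S. cwalk E v0 s v0" by blast
  have "\<exists>V' E'. graph V' E' (card S) \<and> (\<forall>i. E i \<subseteq> E' i) \<and> (\<forall>j\<in>J. \<exists>v\<in>V'. M dvd snd v - j)"
    if "finite J" for J
    using that
  proof induction
    case empty
    then show ?case using VE by blast
  next
    case (insert j J)
    then obtain V1 E1 where 1: "graph V1 E1 (card S)" "\<forall>i. E i \<subseteq> E1 i" "\<forall>j\<in>J. \<exists>v\<in>V1. M dvd snd v - j"
      by blast
    have "j \<in> \<phi> ` carrier G" using \<phi>_surj by simp
    then obtain g where g: "g \<in> carrier G" "\<phi> g = j" by blast
    have "v0 \<in> V1" using 1(1) by (simp add: graph_def)
    with graph_add_walk[of g V1 E1 "card S" v0] g gen 1(1)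
    obtain V2 E2 w where 2: "graph V2 E2 (card S)" "V1 \<subseteq> V2" "\<forall>i. E1 i \<subseteq> E2 i" "w \<in> V2"
      "cwalk E2 v0 g w" by blast
    have "snd w = j" using graph_grade[OF 2(1,5)] g by simp
    then have "\<exists>v\<in>V2. M dvd snd v - j" using 2(4) by (intro bexI[of _ w]) auto
    moreover have "\<forall>j\<in>J. \<exists>v\<in>V2. M dvd snd v - j" using 1(3) 2(2) by blast
    moreover have "\<forall>i. E i \<subseteq> E2 i" using 1(2) 2(3) by blast
    ultimately show ?case using 2(1) by blast
  qed
  from this[of "{0..<M}"] obtain V' E' where V': "graph V' E' (card S)" "\<forall>i. E i \<subseteq> E' i"
    "\<forall>j\<in>{0..<M}. \<exists>v\<in>V'. M dvd snd v - j" by auto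
  have "\<exists>v\<in>V'. M dvd snd v - j" for j
  proof -
    have "j mod M \<in> {0..<M}" using M_pos by simp
    then obtain v where v: "v \<in> V'" "M dvd snd v - j mod M" using V'(3) by blast
    have "M dvd j mod M - j" by (simp add: mod_eq_dvd_iff[symmetric])
    from dvd_add[OF v(2) this] v(1) show ?thesis by (intro bexI[of _ v]) simp_all
  qed
  moreover have "cwalk E' v0 k v0" if "k \<in> K" for k
  proof -
    have "(\<Union>i. E i) \<subseteq> (\<Union>i. E' i)" using V'(2) by blast
    then have "S \<subseteq> {g. cwalk E' v0 g v0}"
      using VE(2) walk_mono[of "\<Union>i. E i" v0 _ v0] by blast
    from generate_subgroup_incl[OF this subgroup_loops[OF graph_sub[OF V'(1)]]] S(3) that
    show ?thesis by blast
  qed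
  ultimately show ?thesis using V'(1) unfolding full_def by blast
qed

subsection \<open>Folding\<close>

text \<open>Two distinct vertices joined in one colour by a path with label \<open>c \<in> C\<close> can be identified,
  after all labels at one of them have been changed by \<open>c\<close>.\<close>

lemma fold_tie_aux:
  assumes g: "graph V E n" "full V E" and c: "c \<in> C" and v: "v \<in> V" and w: "w \<in> V"
    and vw: "v \<noteq> w" "w \<noteq> v0" and walk: "walk G (E i) v c w"
  shows "\<exists>V' E'. graph V' E' n \<and> full V' E' \<and> card V' < card V"
proof -
  have fin: "finite (E i)" "finite V" using g(1) by (simp_all add: graph_def)
  \<comment> \<open>Within colour \<open>i\<close> the edges are rearranged so that the tie becomes
    a single edge; \<open>E1\<close> omits it, since it is about to be contracted.\<close>
  obtain E1 where E1: "finite E1" "card E1 < card (E i)" "E1 \<subseteq> V \<times> A i \<times> V"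
    and E1_walk: "\<And>a h b. (a, h, b) \<in> E1 \<Longrightarrow> walk G (E i) a h b"
    and E_walk: "\<And>a h b. (a, h, b) \<in> E i \<Longrightarrow> walk G (insert (v, c, w) E1) a h b"
    by (rule exchange_edge[OF graph_sub1[OF g(1)] A fin(1) v walk vw(1)]) (rule that)
  define \<rho> where "\<rho> z = (if z = w then v else z)" for z
  \<comment> \<open>As \<open>c\<close> lies in both factors, relabelling keeps every edge at
    \<open>w\<close> in its colour; the degree of \<open>w\<close> changes by a multiple of
    \<open>M\<close>.\<close>
  define \<gamma> where "\<gamma> z = (if z = w then c else \<one>)" for z
  define con where "con = image (\<lambda>(a, h, b). (\<rho> a, \<gamma> a \<otimes> h \<otimes> inv \<gamma> b, \<rho> b))"
  define E' where "E' j = con (if j = i then E1 else E j)" for j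
  define V' where "V' = V - {w}"
  have \<gamma>: "\<gamma> z \<in> C" for z using c by (simp add: \<gamma>_def)
  have \<rho>: "\<rho> z \<in> V'" if "z \<in> V" for z using that v vw by (auto simp: \<rho>_def V'_def)
  have old_sub: "(if j = i then E1 else E j) \<subseteq> V \<times> A j \<times> V" for j
    using E1(3) graph_sub1[OF g(1)] by simp
  have E'_sub: "E' j \<subseteq> V' \<times> A j \<times> V'" for j
  proof
    fix z assume "z \<in> E' j"
    then obtain a h b where abh: "(a, h, b) \<in> (if j = i then E1 else E j)"
      "z = (\<rho> a, \<gamma> a \<otimes> h \<otimes> inv \<gamma> b, \<rho> b)" by (auto simp: E'_def con_def)
    then have "a \<in> V" "b \<in> V" "h \<in> A j" using old_sub[of j] by blast+
    then show "z \<in> V' \<times> A j \<times> V'" using \<rho> C_A[OF \<gamma>] by (simp add: abh(2))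
  qed
  then have E'_sub': "(\<Union>j. E' j) \<subseteq> V' \<times> carrier G \<times> V'" using A_sub by blast
  have con_walk: "cwalk E' (\<rho> a) (\<gamma> a \<otimes> h \<otimes> inv \<gamma> b) (\<rho> b)"
    if "(a, h, b) \<in> (if j = i then E1 else E j)" for a h b j
  proof (rule walk_edge[OF E'_sub'])
    have "(\<rho> a, \<gamma> a \<otimes> h \<otimes> inv \<gamma> b, \<rho> b) \<in> E' j"
      unfolding E'_def con_def by (rule image_eqI[OF _ that]) simp
    then show "(\<rho> a, \<gamma> a \<otimes> h \<otimes> inv \<gamma> b, \<rho> b) \<in> (\<Union>j. E' j)" by blast
  qed
  have ins_sub: "insert (v, c, w) E1 \<subseteq> V \<times> carrier G \<times> V" 
  proof -
    have "E1 \<subseteq> V \<times> carrier G \<times> V" using E1(3) A_sub[of i] by blast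
    then show ?thesis using v w c by simp
  qed
  have edge_walk: "cwalk E' (\<rho> a) (\<gamma> a \<otimes> h \<otimes> inv \<gamma> b) (\<rho> b)"
    if "(a, h, b) \<in> (\<Union>j. E j)" for a h b
  proof -
    obtain j where j: "(a, h, b) \<in> E j" using \<open>(a, h, b) \<in> (\<Union>j. E j)\<close> by blast
    show ?thesis
    proof (cases "j = i")
      case False
      then show ?thesis using con_walk[of a h b j] j by simp
    next
      case True
      then have ab: "walk G (insert (v, c, w) E1) a h b" using E_walk j by simp
      show ?thesis
      proof (rule walk_map[OF ins_sub E'_sub' C_closed[OF \<gamma>] _ ab])
        fix a h b assume "(a, h, b) \<in> insert (v, c, w) E1"
        then consider "(a, h, b) = (v, c, w)" | "(a, h, b) \<in> E1" by blast
        then show "cwalk E' (\<rho> a) (\<gamma> a \<otimes> h \<otimes> inv \<gamma> b) (\<rho> b)"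
        proof cases
          case 1
          then show ?thesis using walk_nil[of G "\<Union>j. E' j" v] c vw by (simp add: \<rho>_def \<gamma>_def)
        next
          case 2
          then show ?thesis using con_walk[of a h b i] by simp
        qed
      qed
    qed
  qed
  have \<rho>0: "\<rho> v0 = v0" "\<gamma> v0 = \<one>" using vw by (auto simp: \<rho>_def \<gamma>_def)
  have walk_E': "cwalk E' v0 (h \<otimes> inv \<gamma> z) (\<rho> z)" if h: "cwalk E v0 h z" for h z
  proof -
    have "cwalk E' (\<rho> v0) (\<gamma> v0 \<otimes> h \<otimes> inv \<gamma> z) (\<rho> z)"
      by (rule walk_map[OF graph_sub[OF g(1)] E'_sub' C_closed[OF \<gamma>] _ h]) (rule edge_walk)
    then show ?thesis using \<rho>0 walk_closed[OF graph_sub[OF g(1)] h] by simp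
  qed
  have snd_w: "snd w = snd v + \<phi> c" by (rule graph_grade1[OF g(1) walk])
  have snd_\<rho>: "snd (\<rho> z) = snd z - \<phi> (\<gamma> z)" for z using snd_w by (simp add: \<rho>_def \<gamma>_def)
  have grade: "snd b' = snd a' + \<phi> h'" if "(a', h', b') \<in> E' j" for j a' h' b'
  proof -
    obtain a h b where abh: "(a, h, b) \<in> (if j = i then E1 else E j)"
      "a' = \<rho> a" "h' = \<gamma> a \<otimes> h \<otimes> inv \<gamma> b" "b' = \<rho> b"
      using \<open>(a', h', b') \<in> E' j\<close> by (auto simp: E'_def con_def)
    have "walk G (E j) a h b"
      using abh(1) E1_walk walk_edge[OF graph_sub1'[OF g(1)]] by (cases "j = i") auto
    then have "snd b = snd a + \<phi> h" by (rule graph_grade1[OF g(1)])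
    moreover have "h \<in> carrier G" using abh(1) old_sub[of j] A_sub[of j] by blast
    ultimately show ?thesis using C_closed[OF \<gamma>] by (simp add: abh snd_\<rho> \<phi>_mult)
  qed
  have finE': "finite (E' j)" for j
    using E1(1) g(1) by (simp add: E'_def con_def graph_def)
  have card_E': "card (E' i) < card (E i)" "card (E' (\<not> i)) \<le> card (E (\<not> i))"
    using E1 g(1) le_less_trans[OF card_image_le[OF E1(1)]]
    by (auto simp: E'_def con_def graph_def intro: card_image_le)
  have card_V': "card V = card V' + 1" using w fin(2) card_Suc_Diff1[of V w] by (simp add: V'_def)
  have "card (E True) + card (E False) + 1 \<le> card V + n" using g(1) by (simp add: graph_def)
  then have "card (E' True) + card (E' False) + 1 \<le> card V' + n"
    using card_E' card_V' by (cases i) simp_all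
  moreover have "\<exists>h. cwalk E' v0 h z" if "z \<in> V'" for z
  proof -
    have "z \<in> V" "\<rho> z = z" using \<open>z \<in> V'\<close> by (auto simp: V'_def \<rho>_def)
    then obtain h where "cwalk E v0 h z" using g(1) unfolding graph_def by blast
    from walk_E'[OF this] show ?thesis unfolding \<open>\<rho> z = z\<close> by (rule exI)
  qed
  moreover have "v0 \<in> V'" using g(1) vw by (auto simp: V'_def graph_def)
  ultimately have "graph V' E' n"
    unfolding graph_def using fin(2) finE' E'_sub grade by (simp add: V'_def)
  moreover have "full V' E'"
    unfolding full_def
  proof (intro conjI allI ballI)
    fix j
    obtain z where z: "z \<in> V" "M dvd snd z - j" using g(2) unfolding full_def by blast
    have "M dvd (snd z - j) - \<phi> (\<gamma> z)" by (rule dvd_diff[OF z(2) \<phi>_C_dvd[OF \<gamma>]])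
    then have "M dvd snd (\<rho> z) - j" by (simp add: snd_\<rho> algebra_simps)
    then show "\<exists>v\<in>V'. M dvd snd v - j" using \<rho>[OF z(1)] by blast
  next
    fix k assume "k \<in> K"
    then have "cwalk E v0 k v0" using g(2) unfolding full_def by blast
    from walk_E'[OF this] \<rho>0 \<open>k \<in> K\<close> show "cwalk E' v0 k v0" by (simp add: K_def)
  qed
  moreover have "card V' < card V" using card_V' by linarith
  ultimately show ?thesis by blast
qed

definition tie_free :: "vertex set \<Rightarrow> (bool \<Rightarrow> (vertex \<times> 'a \<times> vertex) set) \<Rightarrow> bool" where
  "tie_free V E \<longleftrightarrow> (\<forall>i v w c. v \<in> V \<and> w \<in> V \<and> c \<in> C \<and> walk G (E i) v c w \<longrightarrow> v = w)"

lemma ex_tie_free_graph: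
  assumes "graph V E n" "full V E"
  shows "\<exists>V E. graph V E n \<and> full V E \<and> tie_free V E"
  using assms
proof (induction "card V" arbitrary: V E rule: less_induct)
  case less
  show ?case
  proof (cases "tie_free V E")
    case False
    then obtain i v w c where t: "v \<in> V" "w \<in> V" "c \<in> C" "walk G (E i) v c w" "v \<noteq> w"
      unfolding tie_free_def by blast
    \<comment> \<open>The base vertex has to survive, so if \<open>w\<close> is \<open>v0\<close>
      the tie is read backwards.\<close>
    have "walk G (E i) w (inv c) v" by (rule walk_inv[OF graph_sub1'[OF less.prems(1)] t(4)])
    then have "\<exists>V' E'. graph V' E' n \<and> full V' E' \<and> card V' < card V"
      using fold_tie_aux[OF less.prems t(3,1,2,5) _ t(4)]
        fold_tie_aux[OF less.prems C_inv[OF t(3)] t(2,1) t(5)[symmetric]] t(5)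
      by (cases "w = v0") blast+
    then show ?thesis using less.hyps by blast
  qed (use less.prems in blast)
qed

subsection \<open>Tie-free graphs\<close>

inductive alt_walk ::
    "(bool \<Rightarrow> ('v \<times> 'a \<times> 'v) set) \<Rightarrow> bool \<Rightarrow> 'v \<Rightarrow> 'a \<Rightarrow> 'v \<Rightarrow> bool" for E where
  alt_walk_single: "walk G (E i) v g w \<Longrightarrow> g \<notin> C \<Longrightarrow> alt_walk E i v g w"
| alt_walk_Cons: "walk G (E i) v g w \<Longrightarrow> g \<notin> C \<Longrightarrow> alt_walk E (\<not> i) w h z
    \<Longrightarrow> alt_walk E i v (g \<otimes> h) z"

context
  fixes V E n
  assumes g: "graph V E n" and full: "full V E" and tf: "tie_free V E"
begin

lemma alt_walk_label: "alt_walk E i v g w \<Longrightarrow> alternating G A C i g"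
proof (induction rule: alt_walk.induct)
  case (alt_walk_single i v g w)
  then show ?case using walk_label[OF A graph_sub1[OF g]] by (intro alternating_single)
next
  case (alt_walk_Cons i v k w h z)
  then show ?case using walk_label[OF A graph_sub1[OF g]] by (intro alternating_Cons)
qed

text \<open>Without ties the walk is closed, so its label has degree 0, and \<open>C\<close> meets
  \<open>K\<close> trivially.\<close>

lemma tie_free_C:
  assumes "walk G (E i) v c w" "c \<in> C" "v \<in> V"
  shows "v = w \<and> c = \<one>"
proof -
  have "w \<in> V" by (rule walk_vertex[OF assms(1) graph_sub1[OF g] assms(3)])
  then have "v = w" using tf assms unfolding tie_free_def by blast
  moreover have "\<phi> c = 0" using graph_grade1[OF g assms(1)] \<open>v = w\<close> by simp
  ultimately show ?thesis using \<phi>_inj[OF assms(2)] by simp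
qed

text \<open>A new segment merges with the first syllable if the colours agree. A syllable that falls
  into \<open>C\<close> is trivial by \<open>tie_free_C\<close>; it disappears and what remains is
  still alternating.\<close>

lemma alt_walk_prepend:
  assumes vw: "walk G (E i) v g w" and v: "v \<in> V"
    and wz: "w = z \<and> h = \<one> \<or> (\<exists>j. alt_walk E j w h z)"
  shows "v = z \<and> g \<otimes> h = \<one> \<or> (\<exists>j. alt_walk E j v (g \<otimes> h) z)"
proof -
  have gc: "g \<in> carrier G" by (rule walk_closed[OF graph_sub1'[OF g] vw])
  have short: "v = y \<and> k = \<one> \<or> alt_walk E i v k y" if "walk G (E i) v k y" for k y
    using tie_free_C[OF that _ v] alt_walk_single[of E i, OF that] by blast
  from wz consider "w = z" "h = \<one>" | "alt_walk E (\<not> i) w h z" | "alt_walk E i w h z"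
    using ex_bool_eq[of "\<lambda>j. alt_walk E j w h z"] by (cases i) auto
  then show ?thesis
  proof cases
    case 1
    then show ?thesis using short[OF vw] gc by auto
  next
    case 2
    have "h \<in> carrier G" using alternating_A[OF alt_walk_label[OF 2]] .
    show ?thesis
    proof (cases "g \<in> C")
      case True
      with tie_free_C[OF vw _ v] have "v = w" "g = \<one>" by auto
      then show ?thesis using 2 \<open>h \<in> carrier G\<close> by auto
    next
      case False
      from alt_walk_Cons[of E i, OF vw this 2] show ?thesis by blast
    qed
  next
    case 3
    then show ?thesis
    proof cases
      case alt_walk_single
      have "walk G (E i) v (g \<otimes> h) z"
        by (rule walk_trans[OF graph_sub1'[OF g] vw alt_walk_single(1)])
      from short[OF this] show ?thesis by blast
    next
      case (alt_walk_Cons k y l)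
      have k: "k \<in> carrier G" by (rule walk_closed[OF graph_sub1'[OF g] alt_walk_Cons(2)])
      have l: "l \<in> carrier G" using alternating_A[OF alt_walk_label[OF alt_walk_Cons(4)]] .
      have vy: "walk G (E i) v (g \<otimes> k) y"
        by (rule walk_trans[OF graph_sub1'[OF g] vw alt_walk_Cons(2)])
      have e: "g \<otimes> h = (g \<otimes> k) \<otimes> l" using gc k l alt_walk_Cons(1) by (simp add: m_assoc)
      show ?thesis
      proof (cases "g \<otimes> k \<in> C")
        case True
        with tie_free_C[OF vy _ v] have "v = y" "g \<otimes> k = \<one>" by auto
        then show ?thesis using alt_walk_Cons(4) l unfolding e by auto
      next
        case False
        from alt_walk.alt_walk_Cons[of E i, OF vy this alt_walk_Cons(4)]
        show ?thesis unfolding e by blast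
      qed
    qed
  qed
qed

lemma walk_alternating:
  assumes "cwalk E v g w" "v \<in> V"
  shows "v = w \<and> g = \<one> \<or> (\<exists>i. alt_walk E i v g w)"
  using assms
proof induction
  case (walk_fwd v g w h z)
  then obtain i where i: "(v, g, w) \<in> E i" by blast
  then have "w \<in> V" using graph_sub1[OF g] by blast
  then show ?case
    using alt_walk_prepend[OF walk_edge[OF graph_sub1'[OF g] i] walk_fwd.prems] walk_fwd.IH by blast
next
  case (walk_bwd w g v h z)
  then obtain i where i: "(w, g, v) \<in> E i" by blast
  then have "w \<in> V" using graph_sub1[OF g] by blast
  then show ?case
    using alt_walk_prepend[OF walk_edge_inv[OF graph_sub1'[OF g] i] walk_bwd.prems] walk_bwd.IH by blast
qed simp

text \<open>An alternating label that starts in the other colour is not in \<open>A i\<close>. One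
  that starts in colour \<open>i\<close> has a single syllable, as otherwise its remainder would be
  such a label in \<open>A i\<close>.\<close>

lemma walk_monochromatic:
  assumes "cwalk E v a w" "v \<in> V" "a \<in> A i"
  shows "walk G (E i) v a w"
proof -
  from walk_alternating[OF assms(1,2)] consider "v = w" "a = \<one>"
    | "alt_walk E (\<not> i) v a w" | "alt_walk E i v a w"
    using ex_bool_eq[of "\<lambda>j. alt_walk E j v a w"] by (cases i) auto
  then show ?thesis
  proof cases
    case 1
    then show ?thesis using walk_nil[of G "E i" v] by simp
  next
    case 2
    then show ?thesis using alternating_notin[OF alt_walk_label[OF 2]] assms(3) by simp
  next
    case 3
    then show ?thesis
    proof cases
      case (alt_walk_Cons g y h)
      have alt: "alternating G A C (\<not> i) h" by (rule alt_walk_label[OF alt_walk_Cons(4)])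
      have gA: "g \<in> A i" by (rule walk_label[OF A graph_sub1[OF g] alt_walk_Cons(2)])
      then have "inv g \<otimes> a \<in> A i" using assms(3) by simp
      then have "h \<in> A i"
        using alt_walk_Cons(1) A_closed[OF gA] alternating_A[OF alt] by (simp add: inv_cancel)
      then show ?thesis using alternating_notin[OF alt] by simp
    qed
  qed
qed

text \<open>Closing \<open>h\<close> up by walks from the base vertex gives an element of
  \<open>K\<close>, and all of these label loops at \<open>v0\<close>.\<close>

lemma full_walk:
  assumes "v \<in> V" "w \<in> V" "h \<in> carrier G" "snd w = snd v + \<phi> h"
  shows "cwalk E v h w"
proof -
  note sub = graph_sub[OF g]
  obtain a where a: "cwalk E v0 a v" using g assms(1) unfolding graph_def by blast
  obtain b where b: "cwalk E v0 b w" using g assms(2) unfolding graph_def by blast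
  have c: "a \<in> carrier G" "b \<in> carrier G" using walk_closed[OF sub a] walk_closed[OF sub b] by auto
  have "snd v = \<phi> a" "snd w = \<phi> b" using graph_grade[OF g a] graph_grade[OF g b] by simp_all
  then have "a \<otimes> h \<otimes> inv b \<in> K" using c assms by (simp add: K_def \<phi>_mult)
  then have "cwalk E v0 (a \<otimes> h \<otimes> inv b) v0" using full unfolding full_def by blast
  from walk_trans[OF sub walk_inv[OF sub a] walk_trans[OF sub this b]]
  show ?thesis using c assms by (simp add: m_assoc inv_cancel)
qed

text \<open>An element of \<open>C\<close> of the right degree labels a walk from \<open>v\<close>
  to \<open>w\<close>. As alternating products avoid \<open>C\<close>, the alternating form of this
  walk is empty.\<close>

lemma tie_free_residues:
  assumes "v \<in> V" "w \<in> V" "M dvd snd w - snd v"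
  shows "v = w"
proof -
  obtain c where c: "c \<in> C" "\<phi> c = snd w - snd v" using ex_C[OF assms(3)] by blast
  have "cwalk E v c w" using c assms by (intro full_walk) simp_all
  from walk_alternating[OF this assms(1)] show ?thesis
    using alternating_notin_C[OF alt_walk_label] c(1) by blast
qed

lemma card_vertices: "int (card V) = M"
proof -
  have "bij_betw (\<lambda>v. snd v mod M) V {0..<M}"
    unfolding bij_betw_def
  proof
    show "inj_on (\<lambda>v. snd v mod M) V"
    proof (rule inj_onI)
      fix v w assume vw: "v \<in> V" "w \<in> V" "snd v mod M = snd w mod M"
      then have "M dvd snd w - snd v" by (metis mod_eq_dvd_iff)
      then show "v = w" by (rule tie_free_residues[OF vw(1,2)])
    qed
    show "(\<lambda>v. snd v mod M) ` V = {0..<M}"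
    proof
      show "(\<lambda>v. snd v mod M) ` V \<subseteq> {0..<M}" using M_pos by auto
      show "{0..<M} \<subseteq> (\<lambda>v. snd v mod M) ` V"
      proof
        fix j assume j: "j \<in> {0..<M}"
        obtain v where "v \<in> V" "M dvd snd v - j" using full unfolding full_def by blast
        then have "snd v mod M = j mod M" by (simp add: mod_eq_dvd_iff)
        then show "j \<in> (\<lambda>v. snd v mod M) ` V" using j \<open>v \<in> V\<close> by auto
      qed
    qed
  qed
  then show ?thesis using bij_betw_same_card M_pos by fastforce
qed

text \<open>The components of colour \<open>i\<close> correspond to the residues modulo
  \<open>\<delta> i\<close>, and the loop group of each is \<open>A i \<inter> K\<close> itself, not
  just a conjugate. The estimates of \<open>loops_generators\<close> are added up over these
  components, and the smallest of the \<open>\<delta> i\<close> generating sets satisfies the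
  average bound.\<close>

lemma ex_few_generators:
  "\<exists>T. finite T \<and> T \<subseteq> A i \<inter> K \<and> generate G T = A i \<inter> K \<and> \<delta> i * int (card T) + M \<le> int (card (E i)) + \<delta> i"
proof -
  note sub = graph_sub1'[OF g, of i]
  have fin: "finite (E i)" "finite V" using g by (simp_all add: graph_def)
  define J where "J = {0..<\<delta> i}"
  have J: "finite J" "J \<noteq> {}" "int (card J) = \<delta> i" using \<delta>_pos[of i] by (auto simp: J_def)
  have "\<exists>v\<in>V. \<delta> i dvd snd v - k" for k
  proof -
    obtain v where "v \<in> V" "M dvd snd v - k" using full unfolding full_def by blast
    then show ?thesis using \<delta>_dvd_M dvd_trans by blast
  qed
  then obtain b where b: "\<And>k. b k \<in> V" "\<And>k. \<delta> i dvd snd (b k) - k" by metis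
  define Z where "Z k = {z. \<exists>h. walk G (E i) (b k) h z}" for k
  have Z: "Z k = {z\<in>V. \<delta> i dvd snd z - k}" for k
  proof (rule Set.set_eqI)
    fix z
    show "z \<in> Z k \<longleftrightarrow> z \<in> {z\<in>V. \<delta> i dvd snd z - k}"
    proof
      assume "z \<in> Z k"
      then obtain h where h: "walk G (E i) (b k) h z" by (auto simp: Z_def)
      have "\<delta> i dvd (snd (b k) - k) + \<phi> h"
        by (rule dvd_add[OF b(2) \<phi>_A_dvd[OF walk_label[OF A graph_sub1[OF g] h]]])
      then show "z \<in> {z\<in>V. \<delta> i dvd snd z - k}"
        using graph_grade1[OF g h] walk_vertex[OF h graph_sub1[OF g] b(1)] by (simp add: algebra_simps)
    next
      assume z: "z \<in> {z\<in>V. \<delta> i dvd snd z - k}"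
      have "\<delta> i dvd (snd z - k) - (snd (b k) - k)" using z b(2) dvd_diff by blast
      then have "\<delta> i dvd snd z - snd (b k)" by simp
      then obtain a where a: "a \<in> A i" "\<phi> a = snd z - snd (b k)" using ex_A by blast
      have "cwalk E (b k) a z" using z b(1) a A_closed[OF a(1)] by (intro full_walk) simp_all
      from walk_monochromatic[OF this b(1) a(1)] show "z \<in> Z k" unfolding Z_def by blast
    qed
  qed
  have loops: "{h. walk G (E i) (b k) h (b k)} = A i \<inter> K" for k
  proof (rule Set.set_eqI)
    fix h
    show "h \<in> {h. walk G (E i) (b k) h (b k)} \<longleftrightarrow> h \<in> A i \<inter> K"
    proof
      assume "h \<in> {h. walk G (E i) (b k) h (b k)}"
      then have h: "walk G (E i) (b k) h (b k)" by simp
      then show "h \<in> A i \<inter> K"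
        using walk_label[OF A graph_sub1[OF g] h] graph_grade1[OF g h] A_closed by (auto simp: K_def)
    next
      assume h: "h \<in> A i \<inter> K"
      then have "cwalk E (b k) h (b k)" using b(1) by (intro full_walk) (auto simp: K_def)
      from walk_monochromatic[OF this b(1)] h show "h \<in> {h. walk G (E i) (b k) h (b k)}" by simp
    qed
  qed
  define EZ where "EZ k = {x\<in>E i. fst x \<in> Z k}" for k
  have "\<exists>S. finite S \<and> generate G S = A i \<inter> K \<and> S \<subseteq> A i \<inter> K \<and> card S + card (Z k) \<le> card (EZ k) + 1" for k
  proof -
    obtain S where "finite S" "S \<subseteq> {h. walk G (E i) (b k) h (b k)}"
      "generate G S = {h. walk G (E i) (b k) h (b k)}"
      "card S + card {z. \<exists>h. walk G (E i) (b k) h z} \<le> card {x\<in>E i. \<exists>h. walk G (E i) (b k) h (fst x)} + 1"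
      by (rule loops_generators[OF sub fin(1), of "b k"]) (rule that)
    then show ?thesis unfolding loops EZ_def Z_def mem_Collect_eq by blast
  qed
  then obtain S where S: "\<And>k. finite (S k)" "\<And>k. generate G (S k) = A i \<inter> K" "\<And>k. S k \<subseteq> A i \<inter> K"
    "\<And>k. card (S k) + card (Z k) \<le> card (EZ k) + 1" by metis
  have uniq: "k = l" if "k \<in> J" "l \<in> J" "\<delta> i dvd s - k" "\<delta> i dvd s - l" for k l s
  proof -
    have "s mod \<delta> i = k mod \<delta> i" "s mod \<delta> i = l mod \<delta> i" using that by (simp_all add: mod_eq_dvd_iff)
    then show ?thesis using that(1,2) by (simp add: J_def)
  qed
  have sumZ: "(\<Sum>k\<in>J. card (Z k)) = card V"
  proof -
    have "card (\<Union>k\<in>J. Z k) = (\<Sum>k\<in>J. card (Z k))"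
      using J(1) fin(2) uniq by (intro card_UN_disjoint) (auto simp: Z)
    moreover have "(\<Union>k\<in>J. Z k) = V"
    proof
      show "V \<subseteq> (\<Union>k\<in>J. Z k)"
      proof
        fix v assume v: "v \<in> V"
        have "snd v mod \<delta> i \<in> J" using \<delta>_pos by (simp add: J_def)
        moreover have "\<delta> i dvd snd v - snd v mod \<delta> i" by (simp add: mod_eq_dvd_iff[symmetric])
        ultimately show "v \<in> (\<Union>k\<in>J. Z k)" using v unfolding Z by blast
      qed
    qed (auto simp: Z)
    ultimately show ?thesis by simp
  qed
  have sumEZ: "(\<Sum>k\<in>J. card (EZ k)) \<le> card (E i)"
  proof -
    have "card (\<Union>k\<in>J. EZ k) = (\<Sum>k\<in>J. card (EZ k))"
      using J(1) fin(1) uniq by (intro card_UN_disjoint) (auto simp: Z EZ_def)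
    moreover have "card (\<Union>k\<in>J. EZ k) \<le> card (E i)"
      using fin(1) by (intro card_mono) (auto simp: EZ_def)
    ultimately show ?thesis by simp
  qed
  define k0 where "k0 = arg_min_on (\<lambda>k. card (S k)) J"
  have min: "card (S k0) \<le> card (S k)" if "k \<in> J" for k
    unfolding k0_def using arg_min_least[OF J(1,2) that] .
  have "card J * card (S k0) \<le> (\<Sum>k\<in>J. card (S k))" using sum_bounded_below[OF min] by simp
  moreover have "(\<Sum>k\<in>J. card (S k)) + (\<Sum>k\<in>J. card (Z k)) \<le> (\<Sum>k\<in>J. card (EZ k)) + card J"
    using sum_mono[of J "\<lambda>k. card (S k) + card (Z k)" "\<lambda>k. card (EZ k) + 1"] S(4)
    by (simp only: sum.distrib) simp
  ultimately have "card J * card (S k0) + card V \<le> card (E i) + card J" using sumZ sumEZ by linarith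
  then have "int (card J * card (S k0) + card V) \<le> int (card (E i) + card J)" by linarith
  then have "\<delta> i * int (card (S k0)) + M \<le> int (card (E i)) + \<delta> i" using J(3) card_vertices by simp
  then show ?thesis by (intro exI[of _ "S k0"] conjI S)
qed

end

section \<open>Grushko's inequality and its converse\<close>

theorem generators_of_factors:
  assumes "finite S" "S \<subseteq> K" "generate G S = K"
  obtains T where "\<And>i. finite (T i)" "\<And>i. T i \<subseteq> A i \<inter> K" "\<And>i. generate G (T i) = A i \<inter> K"
    "(\<Sum>i\<in>UNIV. \<delta> i * (int (card (T i)) - 1)) + M + 1 \<le> int (card S)"
proof -
  obtain V E where "graph V E (card S)" "full V E" using ex_full_graph[OF assms] by blast
  then obtain V E where g: "graph V E (card S)" "full V E" "tie_free V E"
    using ex_tie_free_graph by blast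
  from ex_few_generators[OF g] obtain T where T: "\<And>i. finite (T i)" "\<And>i. T i \<subseteq> A i \<inter> K"
    "\<And>i. generate G (T i) = A i \<inter> K"
    "\<And>i. \<delta> i * int (card (T i)) + M \<le> int (card (E i)) + \<delta> i" by metis
  \<comment> \<open>The vertices are counted twice against the edges, once in each colour, and once
    in their favour by the Betti bound, so one \<open>M\<close> remains.\<close>
  have "card (E True) + card (E False) + 1 \<le> card V + card S" using g(1) by (simp add: graph_def)
  then have "int (card (E True)) + int (card (E False)) + 1 \<le> M + int (card S)"
    using card_vertices[OF g] by linarith
  then have "(\<Sum>i\<in>UNIV. \<delta> i * (int (card (T i)) - 1)) + M + 1 \<le> int (card S)"
    using T(4)[of True] T(4)[of False] by (simp add: UNIV_bool algebra_simps)
  then show thesis by (rule that[OF T(1-3)])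
qed

text \<open>The folded graph is written down directly. Its vertices are the residues modulo
  \<open>M\<close>; each component of colour \<open>i\<close> is a star around a residue below
  \<open>\<delta> i\<close>, with the elements of \<open>T i\<close> as loops at the centre.\<close>

theorem generators_of_kernel:
  assumes T: "\<And>i. finite (T i)" "\<And>i. T i \<subseteq> A i \<inter> K" "\<And>i. generate G (T i) = A i \<inter> K"
  obtains S where "finite S" "S \<subseteq> K" "generate G S = K"
    "int (card S) \<le> (\<Sum>i\<in>UNIV. \<delta> i * (int (card (T i)) - 1)) + M + 1"
proof -
  have "\<exists>a\<in>A i. \<phi> a = j - j mod \<delta> i" for i j
    by (rule ex_A) (simp add: mod_eq_dvd_iff[symmetric])
  then obtain t0 where t0: "\<And>i j. t0 i j \<in> A i" "\<And>i j. \<phi> (t0 i j) = j - j mod \<delta> i" by metis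
  \<comment> \<open>\<open>t i j\<close> is the label of the walk from the centre to
    \<open>j\<close>; it is empty if \<open>j\<close> is a centre itself.\<close>
  define t where "t i j = (if j < \<delta> i then \<one> else t0 i j)" for i j
  have t: "t i j \<in> A i" "j \<ge> 0 \<Longrightarrow> \<phi> (t i j) = j - j mod \<delta> i" for i j
    using t0 by (auto simp: t_def)
  define V where "V = {0..<M}"
  define E where "E i = (\<lambda>j. (j mod \<delta> i, t i j, j)) ` {\<delta> i..<M} \<union> (\<lambda>(k, s). (k, s, k)) ` ({0..<\<delta> i} \<times> T i)" for i
  have \<delta>_le: "\<delta> i \<le> M" for i using \<delta>_dvd_M M_pos by (rule zdvd_imp_le)
  have E_sub: "E i \<subseteq> V \<times> A i \<times> V" for i
  proof -
    have "j mod \<delta> i \<in> V" if "j \<in> {\<delta> i..<M}" for j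
      using less_le_trans[OF pos_mod_bound[OF \<delta>_pos] \<delta>_le] \<delta>_pos by (simp add: V_def)
    moreover have "{\<delta> i..<M} \<subseteq> V" "{0..<\<delta> i} \<subseteq> V" using \<delta>_pos[of i] \<delta>_le[of i] by (auto simp: V_def)
    ultimately show ?thesis using t(1) T(2)[of i] by (auto simp: E_def)
  qed
  have E_sub': "E i \<subseteq> V \<times> carrier G \<times> V" for i using E_sub[of i] A_sub[of i] by blast
  have EE_sub: "(\<Union>i. E i) \<subseteq> V \<times> carrier G \<times> V" using E_sub' by blast
  have finE: "finite (E i)" for i using T(1) by (simp add: E_def)
  have cardE: "int (card (E i)) \<le> M + \<delta> i * (int (card (T i)) - 1)" for i
  proof -
    have "card (E i) \<le> card {\<delta> i..<M} + card ({0..<\<delta> i} \<times> T i)"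
      unfolding E_def using T(1) by (intro order_trans[OF card_Un_le] add_mono card_image_le) auto
    then have "int (card (E i)) \<le> int (card {\<delta> i..<M} + card ({0..<\<delta> i} \<times> T i))" by linarith
    also have "\<dots> = M + \<delta> i * (int (card (T i)) - 1)"
      using \<delta>_pos[of i] \<delta>_le[of i] by (simp add: card_cartesian_product algebra_simps)
    finally show ?thesis .
  qed
  have grade: "w = v + \<phi> g" if e: "(v, g, w) \<in> E i" for i v g w
  proof -
    consider "v = w mod \<delta> i" "g = t i w" "w \<ge> \<delta> i" | "v = w" "g \<in> T i"
      using e by (auto simp: E_def)
    then show ?thesis
    proof cases
      case 1
      then show ?thesis using t(2)[of w i] \<delta>_pos[of i] by simp
    next
      case 2
      then show ?thesis using T(2)[of i] by (auto simp: K_def)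
    qed
  qed
  have tree: "walk G (E i) (j mod \<delta> i) (t i j) j" if "j \<in> V" for i j
  proof (cases "j < \<delta> i")
    case True
    then show ?thesis using walk_nil[of G "E i" j] \<open>j \<in> V\<close> by (simp add: t_def V_def)
  next
    case False
    then have "(j mod \<delta> i, t i j, j) \<in> E i" using \<open>j \<in> V\<close> by (auto simp: E_def V_def)
    then show ?thesis by (rule walk_edge[OF E_sub'])
  qed
  have loop: "walk G (E i) k h k" if "k \<in> {0..<\<delta> i}" "h \<in> A i \<inter> K" for i k h
  proof -
    have "T i \<subseteq> {h. walk G (E i) k h k}"
    proof
      fix s assume "s \<in> T i"
      then have "(k, s, k) \<in> E i" using \<open>k \<in> {0..<\<delta> i}\<close> by (auto simp: E_def)
      then show "s \<in> {h. walk G (E i) k h k}" using walk_edge[OF E_sub'] by simp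
    qed
    from generate_subgroup_incl[OF this subgroup_loops[OF E_sub']] T(3)[of i] that(2)
    show ?thesis by blast
  qed
  \<comment> \<open>Both ends have the same centre, because \<open>\<delta> i\<close> divides the
    degree of \<open>a\<close>. Going through the centre turns \<open>a\<close> into an element of
    \<open>A i \<inter> K\<close>.\<close>
  have mono_walk: "cwalk E v a w" if vw: "v \<in> V" "w \<in> V" "a \<in> A i" "w = v + \<phi> a" for i v a w
  proof -
    have c: "t i v \<in> carrier G" "t i w \<in> carrier G" "a \<in> carrier G" using A_closed t(1) vw(3) by blast+
    have "\<delta> i dvd w - v" using \<phi>_A_dvd[OF vw(3)] vw(4) by simp
    then have mod: "w mod \<delta> i = v mod \<delta> i" by (simp add: mod_eq_dvd_iff)
    have "t i v \<otimes> a \<otimes> inv t i w \<in> A i \<inter> K"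
      using t vw mod A_closed[OF t(1)] A_closed[OF vw(3)] by (simp add: K_def \<phi>_mult V_def)
    moreover have "v mod \<delta> i \<in> {0..<\<delta> i}" using \<delta>_pos[of i] by simp
    ultimately have "walk G (E i) (v mod \<delta> i) (t i v \<otimes> a \<otimes> inv t i w) (w mod \<delta> i)"
      using loop mod by simp
    from walk_trans[OF E_sub' walk_inv[OF E_sub' tree[OF vw(1)]] walk_trans[OF E_sub' this tree[OF vw(2)]]]
    have "walk G (E i) v a w" using c by (simp add: m_assoc inv_cancel)
    moreover have "E i \<subseteq> (\<Union>i. E i)" by blast
    ultimately show ?thesis by (rule walk_mono)
  qed
  \<comment> \<open>The degree reached by \<open>a\<close> may fall outside \<open>{0..<M}\<close>.
    An element of \<open>C\<close> corrects this on the right; its inverse is then absorbed on the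
    left of the next factor, in the role of \<open>c0\<close>.\<close>
  have step: "\<exists>w\<in>V. \<exists>c\<in>C. cwalk E v (c0 \<otimes> a \<otimes> c) w"
    if "v \<in> V" "a \<in> A i" "c0 \<in> C" for i v a c0
  proof -
    define w where "w = (v + \<phi> (c0 \<otimes> a)) mod M"
    have a: "c0 \<otimes> a \<in> A i" using that C_A by simp
    have "M dvd w - (v + \<phi> (c0 \<otimes> a))" by (simp add: w_def mod_eq_dvd_iff[symmetric])
    then obtain c where c: "c \<in> C" "\<phi> c = w - (v + \<phi> (c0 \<otimes> a))" using ex_C by blast
    have "w \<in> V" using M_pos by (simp add: w_def V_def)
    moreover have "cwalk E v (c0 \<otimes> a \<otimes> c) w"
      using a c C_A[OF c(1)] A_closed[OF a] \<open>v \<in> V\<close> \<open>w \<in> V\<close> by (intro mono_walk[of _ _ _ i]) (simp_all add: \<phi>_mult)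
    ultimately show ?thesis using c(1) by blast
  qed
  have all: "\<exists>w\<in>V. \<exists>c\<in>C. cwalk E v (c0 \<otimes> g \<otimes> c) w"
    if "g \<in> generate G (\<Union>i. A i)" "v \<in> V" "c0 \<in> C" for g v c0
    using that
  proof (induction arbitrary: v c0)
    case one
    then show ?case using step[of v \<one> True c0] by simp
  next
    case (incl a)
    then obtain i where "a \<in> A i" by blast
    then show ?case using step incl by blast
  next
    case (inv a)
    then obtain i where "a \<in> A i" by blast
    then have "inv a \<in> A i" by simp
    then show ?case using step inv by blast
  next
    case (eng g h)
    have gh: "g \<in> carrier G" "h \<in> carrier G" using eng.hyps gen by auto
    obtain w1 c1 where 1: "w1 \<in> V" "c1 \<in> C" "cwalk E v (c0 \<otimes> g \<otimes> c1) w1"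
      using eng.IH(1)[OF eng.prems] by blast
    obtain w2 c2 where 2: "w2 \<in> V" "c2 \<in> C" "cwalk E w1 (inv c1 \<otimes> h \<otimes> c2) w2"
      using eng.IH(2)[OF 1(1) C_inv[OF 1(2)]] by blast
    have "cwalk E v (c0 \<otimes> (g \<otimes> h) \<otimes> c2) w2"
      using walk_trans[OF EE_sub 1(3) 2(3)] gh 1(2) 2(2) eng.prems(2) by (simp add: m_assoc inv_cancel)
    then show ?case using 2(1,2) by blast
  qed
  have grade_walk: "w = v + \<phi> g" if "cwalk E v g w" for v g w
    by (rule walk_grade[OF EE_sub _ that, of "\<lambda>v. v"]) (use grade in blast)
  have V0: "0 \<in> V" using M_pos by (simp add: V_def)
  have reach: "\<exists>c\<in>C. cwalk E 0 (g \<otimes> c) (\<phi> g)" if g: "g \<in> carrier G" "\<phi> g \<in> V" for g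
  proof -
    obtain w c where wc: "w \<in> V" "c \<in> C" "cwalk E 0 (g \<otimes> c) w"
      using all[of g 0 \<one>] g V0 gen by auto
    have "w = \<phi> g + \<phi> c" using grade_walk[OF wc(3)] g wc(2) by (simp add: \<phi>_mult)
    then have "M dvd w - \<phi> g" using \<phi>_C_dvd[OF wc(2)] by simp
    then have "w mod M = \<phi> g mod M" by (simp add: mod_eq_dvd_iff)
    then have "w = \<phi> g" using wc(1) g(2) by (simp add: V_def)
    then show ?thesis using wc by blast
  qed
  have loops: "{g. cwalk E 0 g 0} = K"
  proof (rule Set.set_eqI)
    fix g
    show "g \<in> {g. cwalk E 0 g 0} \<longleftrightarrow> g \<in> K"
    proof
      assume "g \<in> {g. cwalk E 0 g 0}"
      then show "g \<in> K" using grade_walk[of 0 g 0] walk_closed[OF EE_sub, of 0 g 0] by (simp add: K_def)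
    next
      assume "g \<in> K"
      then have g: "g \<in> carrier G" "\<phi> g = 0" by (simp_all add: K_def)
      then obtain c where c: "c \<in> C" "cwalk E 0 (g \<otimes> c) 0" using reach[of g] V0 by auto
      then have "\<phi> c = 0" using grade_walk[OF c(2)] g by (simp add: \<phi>_mult)
      then show "g \<in> {g. cwalk E 0 g 0}" using \<phi>_inj[OF c(1)] c(2) g(1) by simp
    qed
  qed
  have finEE: "finite (\<Union>i. E i)" using finE by simp
  obtain S where S: "finite S" "S \<subseteq> {g. cwalk E 0 g 0}"
    "generate G S = {g. cwalk E 0 g 0}"
    and cS: "card S + card {z. \<exists>g. cwalk E 0 g z}
      \<le> card {x\<in>(\<Union>i. E i). \<exists>g. cwalk E 0 g (fst x)} + 1"
    by (rule loops_generators[OF EE_sub finEE, of 0]) (rule that)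
  have "V \<subseteq> {z. \<exists>g. cwalk E 0 g z}"
  proof
    fix z assume z: "z \<in> V"
    have "z \<in> \<phi> ` carrier G" using \<phi>_surj by simp
    then obtain g where g: "g \<in> carrier G" "\<phi> g = z" by blast
    then show "z \<in> {z. \<exists>g. cwalk E 0 g z}" using reach[of g] z by blast
  qed
  then have "card V \<le> card {z. \<exists>g. cwalk E 0 g z}"
    by (rule card_mono[OF finite_component[OF finEE]])
  moreover have "card {x\<in>(\<Union>i. E i). \<exists>g. cwalk E 0 g (fst x)} \<le> card (\<Union>i. E i)"
    by (rule card_mono[OF finEE]) blast
  moreover have "card (\<Union>i. E i) \<le> card (E True) + card (E False)"
    using card_Un_le[of "E True" "E False"] by (simp add: UNIV_bool Un_commute)
  ultimately have "card S + card V \<le> card (E True) + card (E False) + 1" using cS by linarith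
  then have "int (card S) + M \<le> int (card (E True)) + int (card (E False)) + 1"
    using M_pos by (simp add: V_def)
  then have "int (card S) \<le> (\<Sum>i\<in>UNIV. \<delta> i * (int (card (T i)) - 1)) + M + 1"
    using cardE[of True] cardE[of False] by (simp add: UNIV_bool)
  then show thesis using that S unfolding loops by blast
qed

end

section \<open>Adjoining a root\<close>

definition perm_group :: "'a set \<Rightarrow> ('a \<Rightarrow> 'a) monoid" where
  "perm_group S = \<lparr>carrier = {f. f permutes S}, monoid.mult = (\<circ>), one = id\<rparr>"

lemma perm_group_sel [simp]:
  "carrier (perm_group S) = {f. f permutes S}"
  "f \<otimes>\<^bsub>perm_group S\<^esub> g = f \<circ> g"
  "\<one>\<^bsub>perm_group S\<^esub> = id"
  by (simp_all add: perm_group_def)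

lemma group_perm_group: "group (perm_group S)"
proof (rule groupI)
  fix f assume "f \<in> carrier (perm_group S)"
  then show "\<exists>g\<in>carrier (perm_group S). g \<otimes>\<^bsub>perm_group S\<^esub> f = \<one>\<^bsub>perm_group S\<^esub>"
    by (intro bexI[of _ "inv_into UNIV f"]) (auto simp: permutes_inv permutes_inv_o)
qed (auto simp: permutes_compose permutes_id o_assoc)

text \<open>The permutation representation of the amalgamated product of \<open>H\<close> with an infinite cyclic group,
  \<open>u\<close> being identified with the \<open>e\<close>-th power of a generator. The points \<open>(h, \<nu>)\<close> stand for normal forms:
  \<open>\<nu>\<close> lists the coset representatives and the exponents that follow \<open>h\<close>.\<close>

locale infinite_order = group +
  fixes u :: 'a and e :: int
  assumes u [simp]: "u \<in> carrier G" and inf: "u [^] (k::int) = \<one> \<Longrightarrow> k = 0" and e: "e > 0"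
begin

definition U :: "'a set" where "U = range (\<lambda>k::int. u [^] k)"

definition rep :: "'a \<Rightarrow> 'a" where
  "rep h = (if h \<in> U then \<one> else (SOME r. r \<in> U #> h))"

definition \<kappa> :: "'a \<Rightarrow> int" where
  "\<kappa> h = (SOME k. h = u [^] k \<otimes> rep h)"

lemma subgroup_U: "subgroup U G"
  unfolding U_def by (rule subgroupI) (auto simp flip: int_pow_mult int_pow_neg)

lemma u_inj: "u [^] (k::int) = u [^] l \<Longrightarrow> k = l"
  using inf[of "k - l"] by (simp add: int_pow_diff)

lemma rep_mem: "h \<in> carrier G \<Longrightarrow> rep h \<in> U #> h"
proof (cases "h \<in> U")
  case True
  then have "U #> h = U" using subgroup.subset[OF subgroup_U] subgroup_U by (intro coset_join2) auto
  then show ?thesis using True subgroup.one_closed[OF subgroup_U] by (simp add: rep_def)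
next
  case False
  assume h: "h \<in> carrier G"
  have "h \<in> U #> h" using h subgroup.one_closed[OF subgroup_U] by (force simp: r_coset_def)
  then show ?thesis using False someI[of "\<lambda>r. r \<in> U #> h"] by (simp add: rep_def)
qed

lemma rep_closed [simp]: "h \<in> carrier G \<Longrightarrow> rep h \<in> carrier G"
  using rep_mem[of h] subgroup.subset[OF subgroup_U] r_coset_subset_G[of U h] by blast

lemma rep_\<kappa>: assumes h: "h \<in> carrier G" shows "u [^] \<kappa> h \<otimes> rep h = h"
proof -
  obtain k :: int where "rep h = u [^] k \<otimes> h" using rep_mem[OF h] by (auto simp: r_coset_def U_def)
  then have "u [^] (- k) \<otimes> rep h = (u [^] (- k) \<otimes> u [^] k) \<otimes> h" using h by (simp add: m_assoc)
  also have "u [^] (- k) \<otimes> u [^] k = \<one>" by (simp flip: int_pow_mult)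
  finally have "h = u [^] (- k) \<otimes> rep h" using h by simp
  from someI[of "\<lambda>k. h = u [^] k \<otimes> rep h", OF this] show ?thesis by (simp add: \<kappa>_def)
qed

lemma \<kappa>_eqI: assumes "h \<in> carrier G" "u [^] k \<otimes> rep h = h" shows "\<kappa> h = k"
proof -
  have "u [^] k \<otimes> rep h = u [^] \<kappa> h \<otimes> rep h" using assms(2) rep_\<kappa>[OF assms(1)] by simp
  then have "u [^] k = u [^] \<kappa> h" using assms(1) by simp
  then show ?thesis using u_inj by metis
qed

lemma rep_mult [simp]:
  fixes k :: int
  assumes h: "h \<in> carrier G" shows "rep (u [^] k \<otimes> h) = rep h"
proof -
  have k: "u [^] k \<in> U" by (auto simp: U_def)
  have *: "u [^] k \<otimes> h \<in> U \<longleftrightarrow> h \<in> U"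
  proof
    assume "u [^] k \<otimes> h \<in> U"
    then have "inv (u [^] k) \<otimes> (u [^] k \<otimes> h) \<in> U"
      using k subgroup.m_closed[OF subgroup_U] subgroup.m_inv_closed[OF subgroup_U] by blast
    then show "h \<in> U" using h by (simp add: inv_cancel)
  qed (use k subgroup.m_closed[OF subgroup_U] in blast)
  have "U #> (u [^] k \<otimes> h) = U #> h"
  proof (rule repr_independence[symmetric, OF _ h subgroup_U])
    show "u [^] k \<otimes> h \<in> U #> h" using k by (auto simp: r_coset_def)
  qed
  then show ?thesis by (simp add: rep_def *)
qed

lemma \<kappa>_mult [simp]: assumes h: "h \<in> carrier G" shows "\<kappa> (u [^] k \<otimes> h) = k + \<kappa> h"
  using h rep_\<kappa>[OF h] by (intro \<kappa>_eqI) (simp_all add: int_pow_mult m_assoc)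

lemma rep_rep [simp]: assumes h: "h \<in> carrier G" shows "rep (rep h) = rep h"
  using rep_mult[of "rep h" "\<kappa> h"] rep_\<kappa>[OF h] h by simp

lemma \<kappa>_rep [simp]: "h \<in> carrier G \<Longrightarrow> rep h = h \<Longrightarrow> \<kappa> h = 0"
  by (rule \<kappa>_eqI) simp_all

lemma rep_one [simp]: "rep \<one> = \<one>"
  using subgroup.one_closed[OF subgroup_U] by (simp add: rep_def)

lemma rep_pow [simp]: "rep (u [^] (k::int)) = \<one>" and \<kappa>_pow [simp]: "\<kappa> (u [^] k) = k"
  using rep_mult[of \<one> k] \<kappa>_mult[of \<one> k] by simp_all

lemma rep_eq_one_iff: assumes "h \<in> carrier G" shows "rep h = \<one> \<longleftrightarrow> h \<in> U"
proof
  assume "rep h = \<one>"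
  then have "h = u [^] \<kappa> h" using rep_\<kappa>[OF assms] by simp
  then show "h \<in> U" by (auto simp: U_def)
qed (simp add: rep_def)

text \<open>\<open>(h, [(t1, i1), (t2, i2), ...])\<close> is the normal form
  \<open>h x^i1 t1 x^i2 t2 ...\<close>. Only the last representative may be trivial, so that a
  product can end in a power of \<open>x\<close>.\<close>

fun valid :: "('a \<times> int) list \<Rightarrow> bool" where
  "valid [] = True"
| "valid ((t, i) # \<nu>) = (t \<in> carrier G \<and> rep t = t \<and> 0 < i \<and> i < e \<and> (t \<noteq> \<one> \<or> \<nu> = []) \<and> valid \<nu>)"

definition \<Omega> where "\<Omega> = carrier G \<times> {\<nu>. valid \<nu>}"

definition block where "block = {(t, \<nu>). t \<in> carrier G \<and> rep t = t \<and> (t \<noteq> \<one> \<or> \<nu> = []) \<and> valid \<nu>}"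

text \<open>Coordinates in which a point is a power of \<open>x\<close> times a block, so that
  \<open>x\<close> acts by translation, as \<open>H\<close> does in the original ones. If
  \<open>h\<close> lies in \<open>U\<close>, the exponent at the head of \<open>\<nu>\<close> is
  merged into the power.\<close>

definition enc :: "'a \<times> ('a \<times> int) list \<Rightarrow> int \<times> ('a \<times> ('a \<times> int) list)" where
  "enc p = (case p of (h, \<nu>) \<Rightarrow>
     if rep h \<noteq> \<one> \<or> \<nu> = [] then (e * \<kappa> h, (rep h, \<nu>))
     else (e * \<kappa> h + snd (hd \<nu>), (fst (hd \<nu>), tl \<nu>)))"

definition dec :: "int \<times> ('a \<times> ('a \<times> int) list) \<Rightarrow> 'a \<times> ('a \<times> int) list" where
  "dec z = (case z of (k, (t, \<nu>)) \<Rightarrow>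
     if k mod e = 0 then (u [^] (k div e) \<otimes> t, \<nu>) else (u [^] (k div e), (t, k mod e) # \<nu>))"

lemma enc_block: "p \<in> \<Omega> \<Longrightarrow> snd (enc p) \<in> block"
  by (cases p; cases "snd p") (auto simp: \<Omega>_def enc_def block_def)

lemma dec_\<Omega>: "snd z \<in> block \<Longrightarrow> dec z \<in> \<Omega>"
proof -
  assume z: "snd z \<in> block"
  have "0 \<le> fst z mod e" "fst z mod e < e" using e by simp_all
  then have "fst z mod e \<noteq> 0 \<Longrightarrow> 0 < fst z mod e \<and> fst z mod e < e" by linarith
  with z show ?thesis by (auto simp: \<Omega>_def dec_def block_def split: prod.splits)
qed

lemma dec_enc: assumes "p \<in> \<Omega>" shows "dec (enc p) = p"
proof -
  obtain h \<nu> where p: "p = (h, \<nu>)" "h \<in> carrier G" "valid \<nu>" using assms by (auto simp: \<Omega>_def)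
  show ?thesis
  proof (cases "rep h \<noteq> \<one> \<or> \<nu> = []")
    case True
    then show ?thesis using p e rep_\<kappa>[OF p(2)] by (simp add: enc_def dec_def)
  next
    case False
    then obtain t i \<nu>' where \<nu>: "\<nu> = (t, i) # \<nu>'" by (cases \<nu>) auto
    have "h = u [^] \<kappa> h" using rep_\<kappa>[OF p(2)] False by simp
    moreover have "0 < i" "i < e" using p(3) \<nu> by auto
    ultimately show ?thesis using False by (simp add: p(1) \<nu> enc_def dec_def)
  qed
qed

lemma enc_dec: assumes "snd z \<in> block" shows "enc (dec z) = z"
proof -
  obtain k t \<nu> where z: "z = (k, (t, \<nu>))" using prod_cases3 by blast
  have "e * (k div e) + k mod e = k" by simp
  then show ?thesis using assms by (auto simp: z enc_def dec_def block_def)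
qed

section \<open>The two actions on normal forms\<close>

definition shift :: "int \<Rightarrow> 'a \<times> ('a \<times> int) list \<Rightarrow> 'a \<times> ('a \<times> int) list" where
  "shift j p = (if p \<in> \<Omega> then dec (fst (enc p) + j, snd (enc p)) else p)"

definition left :: "'a \<Rightarrow> 'a \<times> ('a \<times> int) list \<Rightarrow> 'a \<times> ('a \<times> int) list" where
  "left h p = (if p \<in> \<Omega> then (h \<otimes> fst p, snd p) else p)"

lemma shift_\<Omega>: "p \<in> \<Omega> \<Longrightarrow> shift j p \<in> \<Omega>"
  by (simp add: shift_def dec_\<Omega> enc_block)

lemma shift_add: "shift i (shift j p) = shift (i + j) p"
  using shift_\<Omega>[of p j] by (auto simp: shift_def enc_dec enc_block add_ac)

lemma shift_0: "shift 0 = id"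
  by (auto simp: shift_def dec_enc)

lemma left_\<Omega>: "h \<in> carrier G \<Longrightarrow> p \<in> \<Omega> \<Longrightarrow> left h p \<in> \<Omega>"
  by (auto simp: left_def \<Omega>_def)

lemma left_mult: "h \<in> carrier G \<Longrightarrow> k \<in> carrier G \<Longrightarrow> left h (left k p) = left (h \<otimes> k) p"
  using left_\<Omega>[of k p] by (auto simp: left_def \<Omega>_def m_assoc)

lemma left_one: "left \<one> = id"
  by (auto simp: left_def \<Omega>_def)

lemma shift_hom: "shift \<in> hom integer_group (perm_group \<Omega>)"
proof (rule homI)
  fix i show "shift i \<in> carrier (perm_group \<Omega>)"
    unfolding perm_group_sel mem_Collect_eq
  proof (rule bij_imp_permutes)
    show "bij_betw (shift i) \<Omega> \<Omega>"
      by (rule bij_betw_byWitness[of _ "shift (- i)"]) (auto simp: shift_add shift_0 shift_\<Omega>)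
  qed (simp add: shift_def)
qed (auto simp: shift_add)

lemma left_hom: "left \<in> hom G (perm_group \<Omega>)"
proof (rule homI)
  fix h assume h: "h \<in> carrier G"
  show "left h \<in> carrier (perm_group \<Omega>)"
    unfolding perm_group_sel mem_Collect_eq
  proof (rule bij_imp_permutes)
    show "bij_betw (left h) \<Omega> \<Omega>"
      by (rule bij_betw_byWitness[of _ "left (inv h)"]) (use h in \<open>auto simp: left_mult left_one left_\<Omega>\<close>)
  qed (simp add: left_def)
qed (auto simp: left_mult)

lemma shift_pow: "shift j = shift 1 [^]\<^bsub>perm_group \<Omega>\<^esub> j"
  using hom_int_pow[OF shift_hom, of 1 j] by (simp add: group_perm_group)

lemma dec_add: "snd z \<in> block \<Longrightarrow> dec (fst z + e, snd z) = (u \<otimes> fst (dec z), snd (dec z))"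
  using e by (auto simp: dec_def block_def int_pow_mult m_assoc add.commute[of _ 1] split: prod.splits)

text \<open>Adding \<open>e\<close> to the exponent leaves its residue alone and raises the quotient
  by one, which is a factor \<open>u\<close> on the left. So both actions agree on the amalgamated
  subgroup.\<close>

lemma shift_e: "shift e = left u"
proof
  fix p
  show "shift e p = left u p"
    using dec_add[OF enc_block, of p] by (simp add: shift_def left_def dec_enc)
qed

end

text \<open>\<open>perm_ext\<close> is the instance of the universal property from which the normal
  form theorem follows.\<close>

locale root_extension = G: group G + H: infinite_order H u e
  for G (structure) and H and u and e +
  fixes \<iota> and x
  assumes \<iota>: "\<iota> \<in> hom H G" and x [simp]: "x \<in> carrier G" and \<iota>_u: "\<iota> u = x [^]\<^bsub>G\<^esub> e"
    and generated: "generate G (insert x (\<iota> ` carrier H)) = carrier G"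
    and perm_ext: "\<exists>T \<in> hom G (perm_group H.\<Omega>). (\<forall>h\<in>carrier H. T (\<iota> h) = H.left h) \<and> T x = H.shift 1"
begin

sublocale \<iota>: group_hom H G \<iota>
  using \<iota> by (simp add: group_hom_def group_hom_axioms_def)

definition factor :: "bool \<Rightarrow> 'a set" where
  "factor i = (if i then \<iota> ` carrier H else range (\<lambda>k::int. x [^] k))"

definition edge_group :: "'a set" where
  "edge_group = range (\<lambda>k::int. x [^] (e * k))"

lemma \<iota>_U: "h \<in> H.U \<Longrightarrow> \<iota> h \<in> edge_group"
  unfolding H.U_def edge_group_def
  by (auto simp: \<iota>.hom_int_pow \<iota>_u G.int_pow_pow)

lemma edge_group_\<iota>: "edge_group = \<iota> ` H.U"
  unfolding H.U_def edge_group_def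
  by (auto simp: \<iota>.hom_int_pow \<iota>_u G.int_pow_pow image_image)

lemma action:
  obtains T where "T \<in> hom G (perm_group H.\<Omega>)" "\<And>h. h \<in> carrier H \<Longrightarrow> T (\<iota> h) = H.left h"
    "\<And>j::int. T (x [^] j) = H.shift j"
proof -
  obtain T where T: "T \<in> hom G (perm_group H.\<Omega>)" "\<forall>h\<in>carrier H. T (\<iota> h) = H.left h" "T x = H.shift 1"
    using perm_ext by blast
  have "T (x [^] j) = H.shift j" for j :: int
    using hom_int_pow[OF T(1) x, of j] T(3) H.shift_pow[of j] by (simp add: group_perm_group)
  then show thesis using that T by blast
qed

lemma \<iota>_inj: "inj_on \<iota> (carrier H)"
proof (rule inj_onI)
  obtain T where T: "\<And>h. h \<in> carrier H \<Longrightarrow> T (\<iota> h) = H.left h" by (rule action) (rule that)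
  have p: "(\<one>\<^bsub>H\<^esub>, []) \<in> H.\<Omega>" by (simp add: H.\<Omega>_def)
  fix g h assume gh: "g \<in> carrier H" "h \<in> carrier H" "\<iota> g = \<iota> h"
  then have "H.left g (\<one>\<^bsub>H\<^esub>, []) = H.left h (\<one>\<^bsub>H\<^esub>, [])" using T by metis
  then show "g = h" using p gh by (simp add: H.left_def)
qed

theorem alternating_ne_one:
  assumes "alternating G factor edge_group i g" shows "g \<noteq> \<one>"
proof -
  obtain T where T: "T \<in> hom G (perm_group H.\<Omega>)" "\<And>h. h \<in> carrier H \<Longrightarrow> T (\<iota> h) = H.left h"
    "\<And>j::int. T (x [^] j) = H.shift j" by (rule action) (rule that)
  interpret T: group_hom G "perm_group H.\<Omega>" T
    using T(1) by (simp add: group_hom_def group_hom_axioms_def group_perm_group)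
  let ?p = "(\<one>\<^bsub>H\<^esub>, []) :: 'c \<times> ('c \<times> int) list"
  have p: "?p \<in> H.\<Omega>" by (simp add: H.\<Omega>_def)
  have fc: "g \<in> carrier G" if "g \<in> factor i" for g i
    using that by (auto simp: factor_def split: if_splits)
  have step_True: "\<exists>h \<nu>. T g q = (h, \<nu>) \<and> (h, \<nu>) \<in> H.\<Omega> \<and> H.rep h \<noteq> \<one>\<^bsub>H\<^esub>"
    if a: "g \<in> factor True" "g \<notin> edge_group" "q \<in> H.\<Omega>" "H.rep (fst q) = \<one>\<^bsub>H\<^esub>" for g q
  proof -
    obtain h where h: "h \<in> carrier H" "g = \<iota> h" using a(1) by (auto simp: factor_def)
    obtain k \<nu> where q: "q = (k, \<nu>)" "k \<in> carrier H" "H.valid \<nu>" using a(3) by (auto simp: H.\<Omega>_def)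
    have kU: "k \<in> H.U" using a(4) q by (simp add: H.rep_eq_one_iff)
    have "h \<otimes>\<^bsub>H\<^esub> k \<notin> H.U"
    proof
      assume "h \<otimes>\<^bsub>H\<^esub> k \<in> H.U"
      then have "h \<otimes>\<^bsub>H\<^esub> k \<otimes>\<^bsub>H\<^esub> inv\<^bsub>H\<^esub> k \<in> H.U"
        using kU subgroup.m_closed[OF H.subgroup_U] subgroup.m_inv_closed[OF H.subgroup_U] by blast
      then have "h \<in> H.U" using h q by (simp add: H.m_assoc)
      then show False using \<iota>_U h a(2) by blast
    qed
    then have "H.rep (h \<otimes>\<^bsub>H\<^esub> k) \<noteq> \<one>\<^bsub>H\<^esub>" using h q by (simp add: H.rep_eq_one_iff)
    moreover have "T g q = (h \<otimes>\<^bsub>H\<^esub> k, \<nu>)" using h q a(3) T(2) by (simp add: H.left_def)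
    ultimately show ?thesis using h q by (simp add: H.\<Omega>_def)
  qed
  have step_False: "\<exists>h \<nu>. T g q = (h, \<nu>) \<and> (h, \<nu>) \<in> H.\<Omega> \<and> H.rep h = \<one>\<^bsub>H\<^esub> \<and> \<nu> \<noteq> []"
    if a: "g \<in> factor False" "g \<notin> edge_group" "q \<in> H.\<Omega>" "H.rep (fst q) \<noteq> \<one>\<^bsub>H\<^esub> \<or> snd q = []" for g q
  proof -
    obtain j :: int where j: "g = x [^] j" using a(1) by (auto simp: factor_def)
    have "\<not> e dvd j" using a(2) by (auto simp: j edge_group_def)
    then have je: "j mod e \<noteq> 0" by (simp add: dvd_eq_mod_eq_0)
    obtain k \<nu> where q: "q = (k, \<nu>)" "k \<in> carrier H" "H.valid \<nu>" using a(3) by (auto simp: H.\<Omega>_def)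
    have "T g q = H.dec (e * H.\<kappa> k + j, (H.rep k, \<nu>))"
      using q a(3,4) T(3) j by (simp add: H.shift_def H.enc_def)
    also have "\<dots> = (u [^]\<^bsub>H\<^esub> ((e * H.\<kappa> k + j) div e), (H.rep k, j mod e) # \<nu>)"
      using je by (simp add: H.dec_def)
    finally have "T g q = (u [^]\<^bsub>H\<^esub> ((e * H.\<kappa> k + j) div e), (H.rep k, j mod e) # \<nu>)" .
    moreover have "T g q \<in> H.\<Omega>" using H.shift_\<Omega>[OF a(3)] by (simp add: j T(3))
    ultimately show ?thesis by auto
  qed
  have "g \<in> carrier G \<and> (\<exists>h \<nu>. T g ?p = (h, \<nu>) \<and> (h, \<nu>) \<in> H.\<Omega> \<and>
      (if i then H.rep h \<noteq> \<one>\<^bsub>H\<^esub> else H.rep h = \<one>\<^bsub>H\<^esub> \<and> \<nu> \<noteq> []))"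
    using assms
  proof (induction rule: alternating.induct)
    case (alternating_single g i)
    then show ?case using step_True[of g ?p] step_False[of g ?p] p fc by (cases i) auto
  next
    case (alternating_Cons g i k)
    then obtain h \<nu> where h: "T k ?p = (h, \<nu>)" "(h, \<nu>) \<in> H.\<Omega>"
      "if \<not> i then H.rep h \<noteq> \<one>\<^bsub>H\<^esub> else H.rep h = \<one>\<^bsub>H\<^esub> \<and> \<nu> \<noteq> []" by blast
    have "T (g \<otimes> k) ?p = T g (h, \<nu>)" using alternating_Cons fc h by auto
    then show ?case
      using alternating_Cons fc h step_True[of g "(h, \<nu>)"] step_False[of g "(h, \<nu>)"] by (cases i) auto
  qed
  then have "T g ?p \<noteq> ?p" by (auto split: if_splits)
  then show ?thesis by auto
qed

end

section \<open>Freeness of the kernel\<close>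

text \<open>Free groups are projective: the basis elements are lifted one by one.\<close>

lemma free_group_lift:
  assumes N: "is_free_group N" and G: "group G" and f: "f \<in> hom N G"
    and F: "group F" and \<pi>: "\<pi> \<in> hom F G" and sub: "f ` carrier N \<subseteq> \<pi> ` carrier F"
  obtains l where "l \<in> hom N F" "\<And>n. n \<in> carrier N \<Longrightarrow> \<pi> (l n) = f n"
proof -
  obtain B where B: "B \<subseteq> carrier N" "word_eval N (\<lambda>g. g) \<in> iso (free_group B) N" and gN: "group N"
    using N by (auto simp: is_free_group_def)
  define ev where "ev = word_eval N (\<lambda>g. g)"
  have ev: "ev \<in> iso (free_group B) N" using B(2) by (simp add: ev_def)
  define k where "k = inv_into (carrier (free_group B)) ev"
  have k: "k \<in> iso N (free_group B)"
    unfolding k_def by (rule group.iso_set_sym[OF group_free_group ev])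
  have ev_k: "ev (k n) = n" "k n \<in> carrier (free_group B)" if "n \<in> carrier N" for n
  proof -
    have im: "ev ` carrier (free_group B) = carrier N" using ev by (simp only: iso_def bij_betw_def mem_Collect_eq)
    show "ev (k n) = n" unfolding k_def by (rule f_inv_into_f) (simp only: im that)
    show "k n \<in> carrier (free_group B)" unfolding k_def by (rule inv_into_into) (simp only: im that)
  qed
  define c where "c b = (SOME z. z \<in> carrier F \<and> \<pi> z = f b)" for b
  have c: "c b \<in> carrier F \<and> \<pi> (c b) = f b" if "b \<in> B" for b
    unfolding c_def
  proof (rule someI_ex)
    have "f b \<in> \<pi> ` carrier F" using sub B(1) that by blast
    then show "\<exists>z. z \<in> carrier F \<and> \<pi> z = f b" by auto
  qed
  define m where "m = word_eval F c"
  have m: "m \<in> hom (free_group B) F"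
    unfolding m_def by (rule word_eval_hom[OF F]) (use c in blast)
  have h1: "(\<lambda>w. \<pi> (m w)) \<in> hom (free_group B) G"
    using hom_compose[OF m \<pi>] by (simp add: comp_def)
  have h2: "(\<lambda>w. f (ev w)) \<in> hom (free_group B) G"
    using hom_compose[OF _ f] ev by (auto simp: comp_def iso_def simp del: free_group_sel)
  have gens: "gen ` B \<subseteq> carrier (free_group B)" by (auto simp del: free_group_sel)
  have eq: "\<pi> (m w) = f (ev w)" if "w \<in> carrier (free_group B)" for w
  proof (rule hom_eq_on_generate[OF group_free_group G h1 h2 gens])
    show "w \<in> generate (free_group B) (gen ` B)" using that by (simp only: generate_free_group)
    fix v assume "v \<in> gen ` B"
    then obtain b where b: "v = gen b" "b \<in> B" by blast
    have "m (gen b) = c b" unfolding m_def using c[OF b(2)] by (intro word_eval_gen F) simp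
    moreover have "ev (gen b) = b" unfolding ev_def using b B(1) by (intro word_eval_gen gN) auto
    ultimately show "\<pi> (m v) = f (ev v)" using c[OF b(2)] b by simp
  qed
  show thesis
  proof
    show "(\<lambda>n. m (k n)) \<in> hom N F"
      using hom_compose[OF _ m, of k N] k by (simp add: comp_def iso_def)
    show "\<pi> (m (k n)) = f n" if "n \<in> carrier N" for n
      using eq[OF ev_k(2)[OF that]] ev_k(1)[OF that] by simp
  qed
qed

section \<open>Degrees and compatible transversals\<close>

locale graded_root_extension = root_extension +
  fixes \<phi> :: "'a \<Rightarrow> int" and b d :: int
  assumes \<phi>_mult: "g \<in> carrier G \<Longrightarrow> h \<in> carrier G \<Longrightarrow> \<phi> (g \<otimes> h) = \<phi> g + \<phi> h"
    and \<phi>_x: "\<phi> x = b" and b: "b \<noteq> 0"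
    and \<phi>_surj: "\<phi> ` carrier G = UNIV"
    and \<phi>_\<iota>: "(\<lambda>h. \<phi> (\<iota> h)) ` carrier H = {k. d dvd k}" and d: "d > 0"
begin

lemma \<phi>_hom: "\<phi> \<in> hom G integer_group"
  by (auto simp: hom_def \<phi>_mult)

lemma \<phi>_pow: "g \<in> carrier G \<Longrightarrow> \<phi> (g [^] (k::int)) = k * \<phi> g"
  using hom_int_pow[OF \<phi>_hom, of g k] by simp

text \<open>The constants are the indices of the images under \<open>\<phi>\<close> of the powers of
  \<open>x^e\<close>, of \<open>H\<close> and of the powers of \<open>x\<close>.\<close>

sublocale graded_amalgam G factor edge_group \<phi> "e * \<bar>b\<bar>" "\<lambda>i. if i then d else \<bar>b\<bar>"
proof (intro graded_amalgam.intro graded_amalgam_axioms.intro G.is_group)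
  have pow: "subgroup (range (\<lambda>k::int. x [^] (n * k))) G" for n
  proof (rule G.subgroupI)
    fix y z assume "y \<in> range (\<lambda>k::int. x [^] (n * k))" "z \<in> range (\<lambda>k::int. x [^] (n * k))"
    then obtain i j where yz: "y = x [^] (n * i)" "z = x [^] (n * j)" by blast
    have "y \<otimes> z = x [^] (n * (i + j))" using x by (simp add: yz distrib_left flip: G.int_pow_mult)
    then show "y \<otimes> z \<in> range (\<lambda>k::int. x [^] (n * k))" by blast
    have "inv y = x [^] (n * (- i))" using x by (simp add: yz flip: G.int_pow_neg)
    then show "inv y \<in> range (\<lambda>k::int. x [^] (n * k))" by blast
  qed (use x in auto)
  show fac: "subgroup (factor i) G" for i
    using pow[of 1] \<iota>.img_is_subgroup by (simp add: factor_def)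
  show "subgroup edge_group G" using pow[of e] by (simp add: edge_group_def)
  show sub: "edge_group \<subseteq> factor i" for i
  proof (cases i)
    case True
    then show ?thesis using subgroup.subset[OF H.subgroup_U] by (auto simp: edge_group_\<iota> factor_def)
  qed (auto simp: edge_group_def factor_def)
  show "c = \<one>" if "c \<in> edge_group" "\<phi> c = 0" for c
    using that b H.e by (auto simp: edge_group_def \<phi>_pow \<phi>_x)
  show "\<phi> ` factor i = {k. (if i then d else \<bar>b\<bar>) dvd k}" for i
  proof (cases i)
    case True
    then show ?thesis using \<phi>_\<iota> by (simp add: factor_def image_image)
  next
    case False
    have "\<phi> ` range (\<lambda>k::int. x [^] k) = range (\<lambda>k. b * k)"
      by (simp add: image_image \<phi>_pow \<phi>_x mult.commute[of _ b])
    also have "\<dots> = {k. b dvd k}" by (auto simp: dvd_def)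
    finally show ?thesis using False by (simp add: factor_def)
  qed
  show "\<phi> ` edge_group = {k. e * \<bar>b\<bar> dvd k}"
  proof -
    have "\<phi> ` edge_group = range (\<lambda>k. (e * b) * k)"
      by (auto simp: edge_group_def image_image \<phi>_pow \<phi>_x mult_ac)
    also have "\<dots> = {k. e * b dvd k}" by (auto simp: dvd_def)
    also have "\<dots> = {k. \<bar>e * b\<bar> dvd k}" by simp
    also have "\<bar>e * b\<bar> = e * \<bar>b\<bar>" using H.e by (simp add: abs_mult)
    finally show ?thesis .
  qed
  show "\<phi> ` carrier G = UNIV" by (rule \<phi>_surj)
  show "e * \<bar>b\<bar> > 0" "(if i then d else \<bar>b\<bar>) > 0" for i using H.e b d by simp_all
  show "generate G (\<Union> (range factor)) = carrier G"
  proof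
    show "generate G (\<Union> (range factor)) \<subseteq> carrier G"
      using subgroup.subset[OF fac] by (intro G.generate_incl) blast
    have "x \<in> factor False" using x G.int_pow_1[OF x] by (force simp: factor_def)
    then have "insert x (\<iota> ` carrier H) \<subseteq> \<Union> (range factor)"
      by (auto simp: factor_def intro!: exI[of _ True])
    then show "carrier G \<subseteq> generate G (\<Union> (range factor))" using G.mono_generate generated by blast
  qed
  show "g \<noteq> \<one>" if "alternating G factor edge_group i g" for i g
    using alternating_ne_one[OF that] .
qed (rule \<phi>_mult)

text \<open>Compatibility with right multiplication by \<open>x\<close> makes the cocycle of this
  transversal trivial at \<open>x\<close>, so that \<open>x\<close> can be sent to a pure
  translation.\<close>

lemma transversal_G:
  obtains t where "\<And>n. t n \<in> carrier G" "\<And>n. \<phi> (t n) = n" "\<And>n k. t (n + b * k) = t n \<otimes> x [^] k" "t 0 = \<one>"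
proof -
  have "\<exists>g. g \<in> carrier G \<and> \<phi> g = n" for n using \<phi>_surj by (metis UNIV_I imageE)
  then obtain s where s: "\<And>n. s n \<in> carrier G" "\<And>n. \<phi> (s n) = n" by metis
  define t where "t n = (s(0 := \<one>)) (n mod b) \<otimes> x [^] (n div b)" for n
  have s': "(s(0 := \<one>)) n \<in> carrier G" "\<phi> ((s(0 := \<one>)) n) = n" for n using s by auto
  show thesis
  proof
    show "t n \<in> carrier G" for n unfolding t_def using s' by simp
    show "\<phi> (t n) = n" for n
      unfolding t_def using s' x by (simp add: \<phi>_mult \<phi>_pow \<phi>_x del: fun_upd_apply)
    show "t (n + b * k) = t n \<otimes> x [^] k" for n k
      unfolding t_def using s' x b by (simp add: G.int_pow_mult G.m_assoc add.commute[of k] del: fun_upd_apply)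
    show "t 0 = \<one>" by (simp add: t_def)
  qed
qed

lemma \<phi>_\<iota>_u: "\<phi> (\<iota> u) = e * b"
  using x by (simp add: \<iota>_u \<phi>_pow \<phi>_x)

text \<open>The degrees of \<open>H\<close> are the multiples of \<open>d\<close>, so
  \<open>n\<close> is reached only up to \<open>n mod d\<close>. Compatibility with \<open>u\<close>
  makes the cocycle trivial at \<open>u\<close>, as required by \<open>u = x^e\<close>.\<close>

lemma transversal_H:
  obtains h where "\<And>n. h n \<in> carrier H" "\<And>n. \<phi> (\<iota> (h n)) = n - n mod d"
    "\<And>n. h (n + e * b) = h n \<otimes>\<^bsub>H\<^esub> u" "\<And>n. (n + e * b) mod d = n mod d"
proof -
  have "e * b \<in> (\<lambda>h. \<phi> (\<iota> h)) ` carrier H" using \<phi>_\<iota>_u H.u by (metis imageI)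
  then have dvd: "d dvd e * b" unfolding \<phi>_\<iota> by simp
  have "\<exists>h. h \<in> carrier H \<and> \<phi> (\<iota> h) = n - n mod d" for n
  proof -
    have "n - n mod d \<in> (\<lambda>h. \<phi> (\<iota> h)) ` carrier H"
      unfolding \<phi>_\<iota> by (simp add: mod_eq_dvd_iff[symmetric])
    then show ?thesis by force
  qed
  then obtain s where s: "\<And>n. s n \<in> carrier H" "\<And>n. \<phi> (\<iota> (s n)) = n - n mod d" by metis
  define h where "h n = s (n mod (e * b)) \<otimes>\<^bsub>H\<^esub> u [^]\<^bsub>H\<^esub> (n div (e * b))" for n
  have eb: "e * b \<noteq> 0" using H.e b by simp
  show thesis
  proof
    show "h n \<in> carrier H" for n by (simp add: h_def s)
    have "\<phi> (\<iota> (h n)) = (n mod (e * b) - n mod (e * b) mod d) + (n div (e * b)) * (e * b)" for n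
      using s by (simp add: h_def \<phi>_mult \<iota>.hom_int_pow \<phi>_pow \<phi>_\<iota>_u)
    then show "\<phi> (\<iota> (h n)) = n - n mod d" for n
      using dvd mod_div_mult_eq[of n "e * b"] by (simp add: mod_mod_cancel)
    show "h (n + e * b) = h n \<otimes>\<^bsub>H\<^esub> u" for n
      using s eb by (simp add: h_def H.int_pow_mult H.m_assoc add.commute[of 1])
    show "(n + e * b) mod d = n mod d" for n
      using dvd by (metis dvd_eq_mod_eq_0 mod_add_right_eq add.right_neutral)
  qed
qed

text \<open>The surjection \<open>\<pi>\<close> from a free group onto \<open>K\<close> splits: \<open>G\<close> embeds into the wreath product of \<open>K\<close>
  with the integers, \<open>x\<close> being mapped to a translation, and this embedding lifts along \<open>\<pi>\<close>, since it does so on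
  \<open>H\<close>, whose kernel is free.\<close>

theorem is_free_kernel:
  assumes free: "is_free_group (H\<lparr>carrier := {h \<in> carrier H. \<phi> (\<iota> h) = 0}\<rparr>)"
    and ext: "\<And>\<Sigma> Y. \<Sigma> \<in> hom H (wreath integer_group (free_group K)) \<Longrightarrow>
      Y \<in> carrier (wreath integer_group (free_group K)) \<Longrightarrow>
      Y [^]\<^bsub>wreath integer_group (free_group K)\<^esub> e = \<Sigma> u \<Longrightarrow>
      \<exists>T \<in> hom G (wreath integer_group (free_group K)). (\<forall>h\<in>carrier H. T (\<iota> h) = \<Sigma> h) \<and> T x = Y"
  shows "is_free_group (G\<lparr>carrier := K\<rparr>)"
proof -
  define F where "F = free_group K"
  interpret F: group F by (simp add: F_def group_free_group)
  define W where "W = wreath integer_group F"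
  interpret W: group W unfolding W_def by (intro group_wreath F.is_group group_integer_group)
  note ext = ext[folded F_def, folded W_def]
  have W_carrier: "(f, n) \<in> carrier W \<longleftrightarrow> (\<forall>a. f a \<in> carrier F)" for f n
    by (auto simp: W_def PiE_iff extensional_def)
  have W_mult: "(f, n) \<otimes>\<^bsub>W\<^esub> (g, m) = (\<lambda>a. f a \<otimes>\<^bsub>F\<^esub> g (a + n), n + m)" for f g n m
    by (simp add: W_def fun_eq_iff)
  define \<pi> where "\<pi> = word_eval G (\<lambda>k. k)"
  have KG: "K \<subseteq> carrier G" by (auto simp: K_def)
  interpret \<pi>: group_hom F G \<pi>
    unfolding group_hom_def group_hom_axioms_def \<pi>_def F_def
    using KG by (intro conjI group_free_group G.is_group word_eval_hom) auto
  have gen_F: "gen k \<in> carrier F \<longleftrightarrow> k \<in> K" for k by (simp add: F_def del: free_group_sel)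
  have \<pi>_gen: "\<pi> (gen k) = k" if "k \<in> K" for k
    unfolding \<pi>_def using that KG by (intro word_eval_gen G.is_group) auto
  define KH where "KH = {h \<in> carrier H. \<phi> (\<iota> h) = 0}"
  obtain t where t: "\<And>n. t n \<in> carrier G" "\<And>n. \<phi> (t n) = n"
    "\<And>n k. t (n + b * k) = t n \<otimes> x [^] k" "t 0 = \<one>" by (rule transversal_G) (rule that)
  obtain h where h: "\<And>n. h n \<in> carrier H" "\<And>n. \<phi> (\<iota> (h n)) = n - n mod d"
    "\<And>n. h (n + e * b) = h n \<otimes>\<^bsub>H\<^esub> u" "\<And>n. (n + e * b) mod d = n mod d"
    by (rule transversal_H) (rule that)
  note [simp] = t(1) h(1)

  \<comment> \<open>One lift for each conjugate of the kernel in \<open>H\<close>. In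
    \<open>\<Sigma>\<close> the lift is taken at \<open>n mod d\<close>, which the degrees of
    \<open>H\<close> do not change.\<close>
  have "\<exists>l. l \<in> hom (H\<lparr>carrier := KH\<rparr>) F \<and> (\<forall>k\<in>KH. \<pi> (l k) = t n \<otimes> \<iota> k \<otimes> inv t n)" for n
  proof -
    have "(\<lambda>k. t n \<otimes> \<iota> k \<otimes> inv t n) \<in> hom (H\<lparr>carrier := KH\<rparr>) G"
      by (rule homI) (auto simp: KH_def G.m_assoc G.inv_cancel)
    moreover have "(\<lambda>k. t n \<otimes> \<iota> k \<otimes> inv t n) ` carrier (H\<lparr>carrier := KH\<rparr>) \<subseteq> \<pi> ` carrier F"
    proof
      fix y assume "y \<in> (\<lambda>k. t n \<otimes> \<iota> k \<otimes> inv t n) ` carrier (H\<lparr>carrier := KH\<rparr>)"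
      then have "y \<in> K" by (auto simp: KH_def K_def \<phi>_mult)
      then show "y \<in> \<pi> ` carrier F" using \<pi>_gen gen_F by (metis image_eqI)
    qed
    ultimately obtain l where "l \<in> hom (H\<lparr>carrier := KH\<rparr>) F"
      "\<And>k. k \<in> carrier (H\<lparr>carrier := KH\<rparr>) \<Longrightarrow> \<pi> (l k) = t n \<otimes> \<iota> k \<otimes> inv t n"
      using free_group_lift[OF free[folded KH_def] G.is_group _ F.is_group \<pi>.homh] by metis
    then show ?thesis by auto
  qed
  then obtain l where l_hom: "\<And>n. l n \<in> hom (H\<lparr>carrier := KH\<rparr>) F"
    and \<pi>_l: "\<And>n k. k \<in> KH \<Longrightarrow> \<pi> (l n k) = t n \<otimes> \<iota> k \<otimes> inv t n" by metis
  have l_closed [simp]: "l n k \<in> carrier F" if "k \<in> KH" for n k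
    using l_hom[of n] that by (auto simp: hom_def)
  have l_mult: "l n (k \<otimes>\<^bsub>H\<^esub> k') = l n k \<otimes>\<^bsub>F\<^esub> l n k'" if "k \<in> KH" "k' \<in> KH" for n k k'
    using l_hom[of n] that by (auto simp: hom_def)
  have KH_one: "\<one>\<^bsub>H\<^esub> \<in> KH" by (simp add: KH_def)
  have l_one: "l n \<one>\<^bsub>H\<^esub> = \<one>\<^bsub>F\<^esub>" for n
    using l_mult[OF KH_one KH_one, of n] l_closed[OF KH_one, of n] by simp

  \<comment> \<open>\<open>c n\<close> lifts the element of \<open>K\<close> that compares
    \<open>t n\<close> with \<open>t (n mod d) \<otimes> \<iota> (h n)\<close>. Its period
    \<open>e * b\<close> is what makes \<open>\<Sigma> u\<close> a pure translation.\<close>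
  define c where "c n = gen (t (n mod d) \<otimes> \<iota> (h n) \<otimes> inv t n)" for n
  have c_K: "t (n mod d) \<otimes> \<iota> (h n) \<otimes> inv t n \<in> K" for n
    by (simp add: K_def \<phi>_mult t(2) h(2))
  have c_F [simp]: "c n \<in> carrier F" for n using c_K by (simp add: c_def gen_F)
  have \<pi>_c: "\<pi> (c n) = t (n mod d) \<otimes> \<iota> (h n) \<otimes> inv t n" for n using c_K by (simp add: c_def \<pi>_gen)
  have c_per: "c (n + e * b) = c n" for n
  proof -
    have "t (n + e * b) = t n \<otimes> x [^] e" using t(3)[of n e] by (simp add: mult.commute)
    then have "t ((n + e * b) mod d) \<otimes> \<iota> (h (n + e * b)) \<otimes> inv t (n + e * b)
      = t (n mod d) \<otimes> \<iota> (h n) \<otimes> inv t n"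
      using x by (simp add: h(3,4) \<iota>_u G.m_assoc G.inv_mult_group G.inv_cancel)
    then show ?thesis by (simp add: c_def)
  qed

  define \<psi> where "\<psi> y = \<phi> (\<iota> y)" for y
  have \<psi>_mult: "\<psi> (y \<otimes>\<^bsub>H\<^esub> z) = \<psi> y + \<psi> z" if "y \<in> carrier H" "z \<in> carrier H" for y z
    using that by (simp add: \<psi>_def \<phi>_mult)
  have \<psi>_dvd: "d dvd \<psi> y" if "y \<in> carrier H" for y
    using \<phi>_\<iota> that by (auto simp: \<psi>_def)
  have \<psi>_mod: "(n + \<psi> y) mod d = n mod d" if "y \<in> carrier H" for n y
    using \<psi>_dvd[OF that] by (metis dvd_eq_mod_eq_0 mod_add_right_eq add.right_neutral)
  \<comment> \<open>The Schreier cocycle of \<open>H\<close> for the transversal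
    \<open>h\<close>.\<close>
  define \<kappa> where "\<kappa> n y = h n \<otimes>\<^bsub>H\<^esub> y \<otimes>\<^bsub>H\<^esub> inv\<^bsub>H\<^esub> h (n + \<psi> y)" for n y
  have \<kappa>: "\<kappa> n y \<in> KH" if "y \<in> carrier H" for n y
    using that \<psi>_mod[OF that, of n] by (simp add: KH_def \<kappa>_def \<phi>_mult h(2)) (simp add: \<psi>_def)
  have \<kappa>_mult: "\<kappa> n (y \<otimes>\<^bsub>H\<^esub> z) = \<kappa> n y \<otimes>\<^bsub>H\<^esub> \<kappa> (n + \<psi> y) z"
    if "y \<in> carrier H" "z \<in> carrier H" for n y z
    using that by (simp add: \<kappa>_def \<psi>_mult H.m_assoc H.inv_cancel add.assoc)
  \<comment> \<open>Under \<open>\<pi>\<close> the three factors become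
    \<open>t n \<otimes> \<iota> y \<otimes> inv t (n + \<psi> y)\<close>, the cocycle of
    \<open>G\<close> restricted to \<open>H\<close>.\<close>
  define \<Sigma> where "\<Sigma> y = (\<lambda>n. inv\<^bsub>F\<^esub> c n \<otimes>\<^bsub>F\<^esub> l (n mod d) (\<kappa> n y) \<otimes>\<^bsub>F\<^esub> c (n + \<psi> y), \<psi> y)" for y
  have \<Sigma>: "\<Sigma> \<in> hom H W"
  proof (rule homI)
    fix y z assume y: "y \<in> carrier H" and z: "z \<in> carrier H"
    show "\<Sigma> (y \<otimes>\<^bsub>H\<^esub> z) = \<Sigma> y \<otimes>\<^bsub>W\<^esub> \<Sigma> z"
      using y z \<kappa> \<psi>_mod[OF y]
      by (simp add: \<Sigma>_def W_mult \<psi>_mult \<kappa>_mult l_mult F.m_assoc F.inv_cancel add.assoc)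
  qed (simp add: \<Sigma>_def W_carrier \<kappa>)
  define Y where "Y = (\<lambda>_::int. \<one>\<^bsub>F\<^esub>, b)"
  have Y_pow: "Y [^]\<^bsub>W\<^esub> k = (\<lambda>_. \<one>\<^bsub>F\<^esub>, k * b)" for k :: int
  proof -
    have "(\<lambda>k. (\<lambda>_. \<one>\<^bsub>F\<^esub>, k * b)) \<in> hom integer_group W"
      by (rule homI) (auto simp: W_carrier W_mult distrib_right)
    from hom_int_pow[OF this, of 1 k] W.is_group show ?thesis by (simp add: Y_def)
  qed
  have "\<psi> u = e * b" by (simp add: \<psi>_def \<phi>_\<iota>_u)
  then have "\<kappa> n u = \<one>\<^bsub>H\<^esub>" for n
    by (simp add: \<kappa>_def h(3))
  then have "\<Sigma> u = Y [^]\<^bsub>W\<^esub> e"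
    using \<open>\<psi> u = e * b\<close> by (simp add: \<Sigma>_def Y_pow l_one c_per)
  then obtain T where T: "T \<in> hom G W" "\<forall>h\<in>carrier H. T (\<iota> h) = \<Sigma> h" "T x = Y"
    using ext[OF \<Sigma>, of Y] by (auto simp: W_carrier Y_def)
  interpret T: group_hom G W T
    using T(1) by (simp add: group_hom_def group_hom_axioms_def)

  define \<tau> where "\<tau> g n = fst (T g) n" for g n
  have \<tau>_closed [simp]: "\<tau> g n \<in> carrier F" if "g \<in> carrier G" for g n
    using T.hom_closed[OF that] by (cases "T g") (simp add: \<tau>_def W_carrier)
  have T_mult: "snd (T (g \<otimes> k)) = snd (T g) + snd (T k)"
    "\<tau> (g \<otimes> k) n = \<tau> g n \<otimes>\<^bsub>F\<^esub> \<tau> k (n + snd (T g))"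
    if "g \<in> carrier G" "k \<in> carrier G" for g k n
    using that by (cases "T g"; cases "T k"; simp add: \<tau>_def W_mult)+
  have \<tau>_one: "\<tau> \<one> n = \<one>\<^bsub>F\<^esub>" for n by (simp add: \<tau>_def) (simp add: W_def)
  have snd_one: "snd (T \<one>) = 0" by simp (simp add: W_def)
  define S where "S = insert x (\<iota> ` carrier H)"
  have S: "S \<subseteq> carrier G" by (auto simp: S_def)
  \<comment> \<open>\<open>T\<close> lifts the cocycle of \<open>t\<close> on all of
    \<open>G\<close>, since it does so on generators. At \<open>n = 0\<close> and
    \<open>\<phi> g = 0\<close> the cocycle is \<open>g\<close> itself.\<close>
  have main: "snd (T g) = \<phi> g \<and> (\<forall>n. \<pi> (\<tau> g n) = t n \<otimes> g \<otimes> inv t (n + \<phi> g))" if "g \<in> carrier G" for g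
  proof -
    have base: "snd (T s) = \<phi> s \<and> (\<forall>n. \<pi> (\<tau> s n) = t n \<otimes> s \<otimes> inv t (n + \<phi> s))" if s: "s \<in> S" for s
    proof (cases "s = x")
      case True
      have "t (n + b) = t n \<otimes> x" for n using t(3)[of n 1] by simp
      then show ?thesis unfolding True using T(3) x by (simp add: \<tau>_def Y_def \<phi>_x G.m_assoc G.r_inv)
    next
      case False
      then obtain y where y: "y \<in> carrier H" "s = \<iota> y" using s by (auto simp: S_def)
      have "\<tau> s n = inv\<^bsub>F\<^esub> c n \<otimes>\<^bsub>F\<^esub> l (n mod d) (\<kappa> n y) \<otimes>\<^bsub>F\<^esub> c (n + \<psi> y)" for n
        using T(2) y by (simp add: \<tau>_def \<Sigma>_def)
      then have "\<pi> (\<tau> s n) = t n \<otimes> s \<otimes> inv t (n + \<psi> y)" for n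
        using y \<kappa>[OF y(1)] \<psi>_mod[OF y(1), of n]
        by (simp add: \<pi>_c \<pi>_l) (simp add: \<kappa>_def G.inv_mult_group G.m_assoc G.inv_cancel)
      then show ?thesis using T(2) y by (simp add: \<Sigma>_def \<psi>_def)
    qed
    have inv_closed: "\<tau> (inv s) n = inv\<^bsub>F\<^esub> \<tau> s (n - snd (T s))" "snd (T (inv s)) = - snd (T s)"
      if s: "s \<in> carrier G" for s n
    proof -
      have "snd (T s) + snd (T (inv s)) = 0" using T_mult(1)[of s "inv s"] s snd_one by simp
      then show 1: "snd (T (inv s)) = - snd (T s)" by simp
      have "\<tau> (inv s) n \<otimes>\<^bsub>F\<^esub> \<tau> s (n - snd (T s)) = \<one>\<^bsub>F\<^esub>"
        using T_mult(2)[of "inv s" s n] s by (simp add: 1 \<tau>_one del: T.hom_inv)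
      then show "\<tau> (inv s) n = inv\<^bsub>F\<^esub> \<tau> s (n - snd (T s))"
        using s by (intro F.inv_equality[symmetric]) simp_all
    qed
    have "g \<in> generate G S" using that generated by (simp add: S_def)
    then have "g \<in> carrier G \<and> snd (T g) = \<phi> g \<and> (\<forall>n. \<pi> (\<tau> g n) = t n \<otimes> g \<otimes> inv t (n + \<phi> g))"
    proof induction
      case one
      then show ?case by (simp add: \<tau>_one snd_one del: T.hom_one)
    next
      case (incl s)
      then show ?case using base S by blast
    next
      case (inv s)
      have s: "s \<in> carrier G" using S inv by blast
      then show ?case using base[OF inv]
        by (simp add: inv_closed G.inv_mult_group G.m_assoc del: T.hom_inv)
    next
      case (eng y z)
      then show ?case
        by (simp add: T_mult \<phi>_mult G.m_assoc G.inv_cancel add.assoc del: T.hom_mult)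
    qed
    then show ?thesis by simp
  qed

  interpret KG: group "G\<lparr>carrier := K\<rparr>" by (rule G.subgroup_imp_group[OF subgroup_K])
  \<comment> \<open>This section of \<open>\<pi>\<close> over \<open>K\<close> is injective, hence
    embeds \<open>K\<close> into a free group.\<close>
  have "(\<lambda>k. \<tau> k 0) \<in> hom (G\<lparr>carrier := K\<rparr>) F"
    by (rule homI) (auto simp: K_def T_mult main simp del: T.hom_mult)
  moreover have "inj_on (\<lambda>k. \<tau> k 0) (carrier (G\<lparr>carrier := K\<rparr>))"
  proof (rule inj_on_inverseI)
    fix k assume "k \<in> carrier (G\<lparr>carrier := K\<rparr>)"
    then have "k \<in> carrier G" "\<phi> k = 0" by (auto simp: K_def)
    then show "\<pi> (\<tau> k 0) = k" using main[of k] by (simp add: t(4))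
  qed
  ultimately show ?thesis
    by (rule is_free_group_if_embeds[OF KG.is_group F_def])
qed

end

section \<open>Infinite cyclic extensions and ranks\<close>

text \<open>A generator identifies the infinite cyclic quotient with the integers, so an extension
  becomes an epimorphism with prescribed kernel.\<close>

lemma infinite_cyclic_extensionE:
  assumes "infinite_cyclic_extension G N"
  obtains \<chi> where "\<chi> \<in> hom G integer_group" "\<chi> ` carrier G = UNIV"
    "G\<lparr>carrier := {g \<in> carrier G. \<chi> g = 0}\<rparr> \<cong> N"
proof -
  obtain K where gG: "group G" and K: "K \<lhd> G" and iso: "G\<lparr>carrier := K\<rparr> \<cong> N"
    and cyc: "cyclic_group (G Mod K)" "infinite (carrier (G Mod K))"
    using assms by (auto simp: infinite_cyclic_extension_def)
  interpret G: group G by fact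
  interpret K: normal K G by fact
  interpret Q: group "G Mod K" by (rule K.factorgroup_is_group)
  obtain z where z: "z \<in> carrier (G Mod K)" "carrier (G Mod K) = range (\<lambda>n::int. z [^]\<^bsub>G Mod K\<^esub> n)"
    using cyc(1) by (auto simp: Q.cyclic_group)
  have "infinite (carrier (subgroup_generated (G Mod K) {z}))"
    using cyc(2) z Q.carrier_subgroup_generated_by_singleton[OF z(1)] by simp
  then have inj: "z [^]\<^bsub>G Mod K\<^esub> i = z [^]\<^bsub>G Mod K\<^esub> j \<Longrightarrow> i = j" for i j :: int
    using Q.infinite_cyclic_subgroup_int[OF z(1)] by blast
  define f where "f = (\<lambda>n::int. z [^]\<^bsub>G Mod K\<^esub> n)"
  have f: "f \<in> iso integer_group (G Mod K)"
    using z inj unfolding iso_def bij_betw_def f_def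
    by (auto intro!: inj_onI simp: Q.hom_integer_group_pow)
  define k where "k = inv_into (carrier integer_group) f"
  have k: "k \<in> iso (G Mod K) integer_group"
    unfolding k_def by (rule group.iso_set_sym[OF group_integer_group f])
  define \<chi> where "\<chi> g = k (K #>\<^bsub>G\<^esub> g)" for g
  have \<chi>: "\<chi> \<in> hom G integer_group"
    using hom_compose[OF K.r_coset_hom_Mod, of k integer_group] k by (simp add: \<chi>_def [abs_def] comp_def iso_def)
  have k_bij: "bij_betw k (carrier (G Mod K)) UNIV" using k by (simp add: iso_def)
  have "\<chi> ` carrier G = k ` carrier (G Mod K)"
    by (auto simp: \<chi>_def carrier_FactGroup)
  then have surj: "\<chi> ` carrier G = UNIV" using k_bij by (simp add: bij_betw_def)
  have k_K: "k K = 0" using hom_one[of k "G Mod K" integer_group] k by (auto simp: iso_def)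
  have "{g \<in> carrier G. \<chi> g = 0} = K"
  proof (rule Set.set_eqI)
    fix g
    show "g \<in> {g \<in> carrier G. \<chi> g = 0} \<longleftrightarrow> g \<in> K"
    proof
      assume g: "g \<in> {g \<in> carrier G. \<chi> g = 0}"
      then have "k (K #>\<^bsub>G\<^esub> g) = k K" by (simp add: k_K \<chi>_def)
      moreover have "K #>\<^bsub>G\<^esub> g \<in> carrier (G Mod K)" "K \<in> carrier (G Mod K)"
        using g Q.one_closed by (auto simp: carrier_FactGroup)
      ultimately have "K #>\<^bsub>G\<^esub> g = K" using k_bij by (auto simp: bij_betw_def inj_on_def)
      then show "g \<in> K" using g G.rcos_self[of g K] K.subgroup_axioms by auto
    next
      assume g: "g \<in> K"
      then have "K #>\<^bsub>G\<^esub> g = K" using G.coset_join2 K.subgroup_axioms K.subset by blast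
      then show "g \<in> {g \<in> carrier G. \<chi> g = 0}" using g K.subset k_K by (auto simp: \<chi>_def)
    qed
  qed
  then show thesis using that \<chi> surj iso by simp
qed

text \<open>The image may be a proper subgroup, as for \<open>H\<close>, where it is generated by
  \<open>gcd a e\<close>; division by \<open>d\<close> makes the map surjective.\<close>

lemma infinite_cyclic_extension_kernel:
  assumes G: "group G" and \<chi>: "\<chi> \<in> hom G integer_group" and im: "\<chi> ` carrier G = {k. d dvd k}"
    and d: "d \<noteq> 0"
  shows "infinite_cyclic_extension G (G\<lparr>carrier := {g \<in> carrier G. \<chi> g = 0}\<rparr>)"
proof -
  interpret \<chi>: group_hom G integer_group \<chi>
    using G \<chi> by (simp add: group_hom_def group_hom_axioms_def)
  have dvd: "d dvd \<chi> g" if "g \<in> carrier G" for g using im that by blast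
  have "(\<lambda>g. \<chi> g div d) \<in> hom G integer_group"
    using dvd by (auto intro!: homI simp: div_plus_div_distrib_dvd_left)
  then interpret c: group_hom G integer_group "\<lambda>g. \<chi> g div d"
    using G by (simp add: group_hom_def group_hom_axioms_def)
  define K where "K = {g \<in> carrier G. \<chi> g = 0}"
  have K: "kernel G integer_group (\<lambda>g. \<chi> g div d) = K"
    using dvd d by (auto simp: kernel_def K_def dvd_div_eq_0_iff)
  have "(\<lambda>g. \<chi> g div d) ` carrier G = carrier integer_group"
  proof -
    have "n \<in> (\<lambda>g. \<chi> g div d) ` carrier G" for n
    proof -
      have "d * n \<in> \<chi> ` carrier G" unfolding im by simp
      then obtain g where "g \<in> carrier G" "\<chi> g = d * n" by force
      then show ?thesis using d by (intro image_eqI[of _ _ g]) simp_all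
    qed
    then show ?thesis by auto
  qed
  then have iso: "G Mod K \<cong> integer_group" using c.FactGroup_iso K by simp
  interpret K: normal K G using c.normal_kernel K by simp
  interpret Q: group "G Mod K" by (rule K.factorgroup_is_group)
  have "cyclic_group (G Mod K)"
    using isomorphic_group_cyclicity[OF iso Q.is_group group_integer_group] by simp
  moreover have "infinite (carrier (G Mod K))"
    using iso_same_card iso infinite_UNIV_int bij_betw_finite
    unfolding is_iso_def iso_def by fastforce
  moreover have "group (G\<lparr>carrier := K\<rparr>)" by (rule K.subgroup_is_group[OF G])
  ultimately show ?thesis
    unfolding infinite_cyclic_extension_def K_def[symmetric]
    using G K.normal_axioms iso_refl[of "G\<lparr>carrier := K\<rparr>"] by blast
qed

text \<open>Both the rank and finite generation are functions of this predicate, so they transfer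
  along isomorphisms together.\<close>

definition generated_by :: "('g, 'm) monoid_scheme \<Rightarrow> nat \<Rightarrow> bool" where
  "generated_by N k \<longleftrightarrow> (\<exists>T\<subseteq>carrier N. finite T \<and> card T = k \<and> generate N T = carrier N)"

lemma finitely_generated_iff: "finitely_generated N \<longleftrightarrow> (\<exists>k. generated_by N k)"
  by (auto simp: finitely_generated_def generated_by_def)

lemma group_rank_eq: "group_rank N = (LEAST k. generated_by N k)"
  by (simp add: group_rank_def generated_by_def)

lemma generated_by_iso_imp:
  assumes "group N" "group M" "f \<in> iso N M" "generated_by N k"
  shows "generated_by M k"
proof -
  interpret f: group_hom N M f
    using assms by (simp add: group_hom_def group_hom_axioms_def iso_def)
  have bij: "inj_on f (carrier N)" "f ` carrier N = carrier M"
    using assms(3) by (auto simp: iso_def bij_betw_def)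
  obtain T where T: "T \<subseteq> carrier N" "finite T" "card T = k" "generate N T = carrier N"
    using assms(4) by (auto simp: generated_by_def)
  have "generate M (f ` T) = carrier M" using f.generate_img[OF T(1)] T(4) bij by simp
  moreover have "card (f ` T) = k" using T bij by (metis card_image inj_on_subset)
  moreover have "f ` T \<subseteq> carrier M" using T(1) by auto
  ultimately show ?thesis using T(2) by (auto simp: generated_by_def)
qed

lemma generated_by_iso:
  assumes "group N" "group M" "N \<cong> M"
  shows "generated_by N = generated_by M"
proof -
  obtain f where f: "f \<in> iso N M" using assms by (auto simp: is_iso_def)
  have "inv_into (carrier N) f \<in> iso M N" by (rule group.iso_set_sym[OF assms(1) f])
  then show ?thesis using generated_by_iso_imp[OF assms(1,2) f] generated_by_iso_imp[OF assms(2,1)] by blast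
qed

lemma (in group) generated_by_subgroup:
  assumes "subgroup A G"
  shows "generated_by (G\<lparr>carrier := A\<rparr>) k \<longleftrightarrow> (\<exists>T\<subseteq>A. finite T \<and> card T = k \<and> generate G T = A)"
proof -
  have "generate (G\<lparr>carrier := A\<rparr>) T = generate G T" if "T \<subseteq> A" for T
    by (rule generate_consistent[OF that assms])
  then show ?thesis unfolding generated_by_def by (metis (no_types, lifting) partial_object.select_convs(1) partial_object.surjective partial_object.update_convs(1))
qed

lemma is_free_group_iso:
  assumes "is_free_group N" "group M" "M \<cong> N"
  shows "is_free_group M"
proof -
  obtain f where f: "f \<in> iso M N" using assms by (auto simp: is_iso_def)
  then show ?thesis using is_free_group_embedding[OF assms(1,2), of f] by (auto simp: iso_def bij_betw_def)
qed

section \<open>The rank formula for the kernels\<close>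

context graded_root_extension
begin

definition KH :: "'c set" where "KH = {h \<in> carrier H. \<phi> (\<iota> h) = 0}"

abbreviation "GK \<equiv> G\<lparr>carrier := K\<rparr>"
abbreviation "HK \<equiv> H\<lparr>carrier := KH\<rparr>"

lemma subgroup_KH: "subgroup KH H"
  by (rule H.subgroupI) (auto simp: KH_def \<phi>_mult)

lemma kernel_iso: "HK \<cong> G\<lparr>carrier := factor True \<inter> K\<rparr>"
proof -
  have "\<iota> \<in> hom HK (G\<lparr>carrier := factor True \<inter> K\<rparr>)"
    by (rule homI) (auto simp: KH_def K_def factor_def)
  moreover have "bij_betw \<iota> KH (factor True \<inter> K)"
    using \<iota>_inj by (auto simp: bij_betw_def KH_def K_def factor_def inj_on_def)
  ultimately show ?thesis by (auto simp: is_iso_def iso_def)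
qed

lemma generated_by_KH:
  "generated_by HK l \<longleftrightarrow>
     (\<exists>T\<subseteq>factor True \<inter> K. finite T \<and> card T = l \<and> generate G T = factor True \<inter> K)"
  using generated_by_iso[OF _ _ kernel_iso] G.generated_by_subgroup[OF subgroup_AK, of True]
    H.subgroup_imp_group[OF subgroup_KH] G.subgroup_imp_group[OF subgroup_AK] by simp

lemma factor_False_K: "factor False \<inter> K = {\<one>}"
  using b x by (auto simp: factor_def K_def \<phi>_pow \<phi>_x intro: rev_image_eqI[of 0])

lemma generated_by_K:
  assumes "generated_by HK l"
  shows "\<exists>k. generated_by GK k \<and> int k \<le> 1 + d * (int l - 1) + \<bar>b\<bar> * (e - 1)"
proof -
  obtain T where T: "T \<subseteq> factor True \<inter> K" "finite T" "card T = l" "generate G T = factor True \<inter> K"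
    using assms by (auto simp: generated_by_KH)
  \<comment> \<open>Only \<open>\<one>\<close> is both in \<open>K\<close> and a power of
    \<open>x\<close>, so the empty set generates this factor and contributes
    \<open>- \<bar>b\<bar>\<close>.\<close>
  define T' where "T' i = (if i then T else {})" for i
  have T': "finite (T' i)" "T' i \<subseteq> factor i \<inter> K" "generate G (T' i) = factor i \<inter> K" for i
    using T factor_False_K by (cases i; simp add: T'_def G.generate_empty)+
  obtain S where S: "finite S" "S \<subseteq> K" "generate G S = K"
    and "int (card S) \<le> (\<Sum>i\<in>UNIV. (if i then d else \<bar>b\<bar>) * (int (card (T' i)) - 1)) + e * \<bar>b\<bar> + 1"
    by (rule generators_of_kernel[OF T']) (rule that)
  then have "int (card S) \<le> 1 + d * (int l - 1) + \<bar>b\<bar> * (e - 1)"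
    by (simp add: UNIV_bool T'_def T(3) algebra_simps)
  then show ?thesis using S by (auto simp: G.generated_by_subgroup[OF subgroup_K])
qed

lemma generated_by_KH':
  assumes "generated_by GK k"
  shows "\<exists>l. generated_by HK l \<and> 1 + d * (int l - 1) + \<bar>b\<bar> * (e - 1) \<le> int k"
proof -
  obtain S where S: "finite S" "S \<subseteq> K" "generate G S = K" and k: "card S = k"
    using assms by (auto simp: G.generated_by_subgroup[OF subgroup_K])
  obtain T where T: "\<And>i. finite (T i)" "\<And>i. T i \<subseteq> factor i \<inter> K" "\<And>i. generate G (T i) = factor i \<inter> K"
    and le: "(\<Sum>i\<in>UNIV. (if i then d else \<bar>b\<bar>) * (int (card (T i)) - 1)) + e * \<bar>b\<bar> + 1 \<le> int (card S)"
    by (rule generators_of_factors[OF S]) (rule that)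
  have "d * (int (card (T True)) - 1) + \<bar>b\<bar> * (int (card (T False)) - 1) + e * \<bar>b\<bar> + 1 \<le> int k"
    using le by (simp add: UNIV_bool k)
  \<comment> \<open>\<open>T False\<close> is a subset of \<open>{\<one>}\<close> but possibly not
    empty; the bound from below needs only that its size is nonnegative.\<close>
  moreover have "- \<bar>b\<bar> \<le> \<bar>b\<bar> * (int (card (T False)) - 1)" by (simp add: right_diff_distrib)
  moreover have "\<bar>b\<bar> * (e - 1) = e * \<bar>b\<bar> - \<bar>b\<bar>" by (simp add: algebra_simps)
  ultimately have "1 + d * (int (card (T True)) - 1) + \<bar>b\<bar> * (e - 1) \<le> int k" by linarith
  then show ?thesis using T[of True] by (auto simp: generated_by_KH)
qed

text \<open>Each inequality is applied to a least generating set on one side. As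
  \<open>d > 0\<close>, the bound is monotone in the number of generators of
  \<open>HK\<close>.\<close>

theorem rank_kernel:
  assumes k: "generated_by GK k" and l: "generated_by HK l"
  shows "int (group_rank GK)
    = 1 + d * (int (group_rank HK) - 1) + \<bar>b\<bar> * (e - 1)"
proof (rule antisym)
  define k0 where "k0 = group_rank GK"
  define l0 where "l0 = group_rank HK"
  have k0: "generated_by GK k0" and l0: "generated_by HK l0"
    unfolding k0_def l0_def group_rank_eq using k l by (auto intro: LeastI)
  have k0_le: "k0 \<le> i" if "generated_by GK i" for i
    unfolding k0_def group_rank_eq using that by (rule Least_le)
  have l0_le: "l0 \<le> i" if "generated_by HK i" for i
    unfolding l0_def group_rank_eq using that by (rule Least_le)
  obtain k1 where "generated_by GK k1" "int k1 \<le> 1 + d * (int l0 - 1) + \<bar>b\<bar> * (e - 1)"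
    using generated_by_K[OF l0] by blast
  then show "int k0 \<le> 1 + d * (int l0 - 1) + \<bar>b\<bar> * (e - 1)" using k0_le[of k1] by linarith
  obtain l1 where l1: "generated_by HK l1" "1 + d * (int l1 - 1) + \<bar>b\<bar> * (e - 1) \<le> int k0"
    using generated_by_KH'[OF k0] by blast
  have "d * (int l0 - 1) \<le> d * (int l1 - 1)" using l0_le[OF l1(1)] d by (intro mult_left_mono) simp_all
  then show "1 + d * (int l0 - 1) + \<bar>b\<bar> * (e - 1) \<le> int k0" using l1(2) by linarith
qed

end

section \<open>One-relator groups_presented\<close>

lemma hom_image_two_generators:
  assumes G: "group G" and gh: "g \<in> carrier G" "h \<in> carrier G" and gen: "generate G {g, h} = carrier G"
    and \<chi>: "\<chi> \<in> hom G integer_group"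
  shows "\<chi> ` carrier G = {k. gcd (\<chi> g) (\<chi> h) dvd k}"
proof
  interpret \<chi>: group_hom G integer_group \<chi>
    using G \<chi> by (simp add: group_hom_def group_hom_axioms_def)
  show "\<chi> ` carrier G \<subseteq> {k. gcd (\<chi> g) (\<chi> h) dvd k}"
  proof
    fix k assume "k \<in> \<chi> ` carrier G"
    then obtain z where z: "z \<in> generate G {g, h}" "k = \<chi> z" using gen by auto
    have "z \<in> carrier G \<and> gcd (\<chi> g) (\<chi> h) dvd \<chi> z" using z(1)
    proof induction
      case (inv a)
      then show ?case using gh by auto
    qed (use gh in auto)
    then show "k \<in> {k. gcd (\<chi> g) (\<chi> h) dvd k}" using z by simp
  qed
  show "{k. gcd (\<chi> g) (\<chi> h) dvd k} \<subseteq> \<chi> ` carrier G"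
  proof
    fix k assume "k \<in> {k. gcd (\<chi> g) (\<chi> h) dvd k}"
    then obtain c where c: "k = gcd (\<chi> g) (\<chi> h) * c" by (auto simp: dvd_def)
    obtain i j where ij: "i * \<chi> g + j * \<chi> h = gcd (\<chi> g) (\<chi> h)" using bezout_int by blast
    have "\<chi> (g [^]\<^bsub>G\<^esub> (i * c) \<otimes>\<^bsub>G\<^esub> h [^]\<^bsub>G\<^esub> (j * c)) = (i * \<chi> g + j * \<chi> h) * c"
      using gh by (simp add: \<chi>.hom_int_pow algebra_simps)
    then have "k = \<chi> (g [^]\<^bsub>G\<^esub> (i * c) \<otimes>\<^bsub>G\<^esub> h [^]\<^bsub>G\<^esub> (j * c))" by (simp only: ij c)
    then show "k \<in> \<chi> ` carrier G" by (rule image_eqI) (use gh in simp)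
  qed
qed

text \<open>As the exponent sum of \<open>y\<close> is nonzero, the abelianization has rank one.\<close>

lemma kernel_unique:
  assumes G_def: "G = presented_group {x, y} {r}" and ne: "x \<noteq> y" and r: "r \<in> carrier (free_group {x, y})" and q: "exponent_sum y r \<noteq> 0"
    and \<Phi>: "\<Phi> \<in> hom G integer_group"
    and \<chi>: "\<chi> \<in> hom G integer_group"
    and \<Phi>_x: "\<Phi> (pgen {x, y} {r} x) \<noteq> 0" and surj: "\<chi> ` carrier G = UNIV"
  shows "{g \<in> carrier G. \<chi> g = 0} = {g \<in> carrier G. \<Phi> g = 0}"
proof -
  have R: "{r} \<subseteq> carrier (free_group {x, y})" using r by simp
  interpret G: group G unfolding G_def by (rule group_presented_group[OF R])
  let ?g = "pgen {x, y} {r}"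
  have g: "?g x \<in> carrier G" "?g y \<in> carrier G" unfolding G_def by (simp_all add: pgen_closed[OF R])
  have letters: "snd ` set r \<subseteq> {x, y}" using r by simp
  have rel: "f (?g x) * exponent_sum x r + f (?g y) * exponent_sum y r = 0"
    if f: "f \<in> hom G integer_group" for f
  proof -
    have "?g ` snd ` set r \<subseteq> carrier G" using letters g by blast
    from hom_word_eval[OF G.is_group group_integer_group f this]
    have "word_eval integer_group (\<lambda>a. f (?g a)) r = f (word_eval G ?g r)" by simp
    also have "word_eval G ?g r = \<one>\<^bsub>G\<^esub>" unfolding G_def by (rule word_eval_relator[OF R]) simp
    also have "f \<one>\<^bsub>G\<^esub> = 0" using hom_one[OF f] G.is_group by simp
    finally show ?thesis using word_eval_integer[OF letters ne, of "\<lambda>a. f (?g a)"] by simp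
  qed
  \<comment> \<open>The values of \<open>\<Phi>\<close> and \<open>\<chi>\<close> solve the same
    linear equation. Eliminating the exponent sum of \<open>x\<close> shows that they are
    proportional, as that of \<open>y\<close> can be cancelled.\<close>
  have "exponent_sum y r * (\<Phi> (?g x) * \<chi> (?g y)) = exponent_sum y r * (\<chi> (?g x) * \<Phi> (?g y))"
  proof -
    have 1: "\<chi> (?g y) * exponent_sum y r = - (\<chi> (?g x) * exponent_sum x r)"
      "\<Phi> (?g y) * exponent_sum y r = - (\<Phi> (?g x) * exponent_sum x r)"
      using rel[OF \<chi>] rel[OF \<Phi>] by linarith+
    have "exponent_sum y r * (\<Phi> (?g x) * \<chi> (?g y)) = \<Phi> (?g x) * (\<chi> (?g y) * exponent_sum y r)"
      by (simp add: mult_ac)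
    also have "\<dots> = \<chi> (?g x) * (\<Phi> (?g y) * exponent_sum y r)" unfolding 1 by (simp add: mult_ac)
    finally show ?thesis by (simp add: mult_ac)
  qed
  then have y: "\<Phi> (?g x) * \<chi> (?g y) = \<chi> (?g x) * \<Phi> (?g y)" using q by simp
  have mult: "(\<lambda>g. c * f g) \<in> hom G integer_group" if "f \<in> hom G integer_group" for f and c :: int
    using that by (auto simp: hom_def algebra_simps)
  have proportional: "\<Phi> (?g x) * \<chi> g = \<chi> (?g x) * \<Phi> g" if "g \<in> carrier G" for g
  proof (rule hom_eq_on_generate[OF G.is_group group_integer_group mult[OF \<chi>] mult[OF \<Phi>], of "?g ` {x, y}"])
    show "g \<in> generate G (?g ` {x, y})" using that unfolding G_def by (simp only: generate_pgen[OF R])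
  qed (use g y in auto)
  \<comment> \<open>Otherwise \<open>\<chi>\<close> would vanish identically, by
    proportionality.\<close>
  have "\<chi> (?g x) \<noteq> 0"
  proof
    assume "\<chi> (?g x) = 0"
    then have "\<chi> g = 0" if "g \<in> carrier G" for g using proportional[OF that] \<Phi>_x by simp
    then have "\<chi> ` carrier G \<subseteq> {0}" by auto
    then have "(1::int) \<in> {0}" using surj by blast
    then show False by simp
  qed
  then have "\<chi> g = 0 \<longleftrightarrow> \<Phi> g = 0" if "g \<in> carrier G" for g
    using proportional[OF that] \<Phi>_x by (metis mult_eq_0_iff)
  then show ?thesis by blast
qed

lemma infinite_cyclic_extension_iso_kernel:
  assumes G_def: "G = presented_group {x, y} {r}" and "x \<noteq> y" "r \<in> carrier (free_group {x, y})" "exponent_sum y r \<noteq> 0"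
    and \<Phi>: "\<Phi> \<in> hom G integer_group" "\<Phi> (pgen {x, y} {r} x) \<noteq> 0"
    and "infinite_cyclic_extension G N"
  shows "G\<lparr>carrier := {g \<in> carrier G. \<Phi> g = 0}\<rparr> \<cong> N"
proof -
  obtain \<chi> where \<chi>: "\<chi> \<in> hom G integer_group"
    "\<chi> ` carrier G = UNIV"
    and iso: "G\<lparr>carrier := {g \<in> carrier G. \<chi> g = 0}\<rparr> \<cong> N"
    by (rule infinite_cyclic_extensionE[OF assms(7)]) (rule that)
  show ?thesis using iso unfolding kernel_unique[OF assms(1-4) \<Phi>(1) \<chi>(1) \<Phi>(2) \<chi>(2)] .
qed

section \<open>The universal property of the substitution \<open>u = x^e\<close>\<close>

context
  fixes x u y :: 'a and r s :: "'a word" and e :: int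
  assumes ne: "x \<noteq> y" "u \<noteq> y"
    and r: "r \<in> carrier (free_group {x, y})" and s: "s \<in> carrier (free_group {u, y})"
    and r_eq: "r = word_eval (free_group {x, y})
               ((\<lambda>_. gen y)(u := gen x [^]\<^bsub>free_group {x, y}\<^esub> e)) s"
begin

text \<open>Evaluation is a homomorphism, so it may be pushed through the substitution in
  \<open>r_eq\<close>. Both the map from \<open>H\<close> to \<open>G\<close> and the maps out of
  \<open>G\<close> rest on this.\<close>

lemma word_eval_substitution:
  assumes W: "group W" and f: "f x \<in> carrier W" "f y \<in> carrier W"
  shows "word_eval W f r = word_eval W ((\<lambda>_. f y)(u := f x [^]\<^bsub>W\<^esub> e)) s"
proof -
  let ?F = "free_group {x, y}"
  interpret F: group ?F by (rule group_free_group)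
  have hom: "word_eval W f \<in> hom ?F W" by (rule word_eval_hom[OF W]) (use f in auto)
  have c: "gen x \<in> carrier ?F" "gen y \<in> carrier ?F" by (simp_all del: free_group_sel)
  have "word_eval W f r = word_eval W (\<lambda>a. word_eval W f (((\<lambda>_. gen y)(u := gen x [^]\<^bsub>?F\<^esub> e)) a)) s"
    unfolding r_eq using c by (intro hom_word_eval[OF F.is_group W hom]) (auto simp del: free_group_sel)
  also have "\<dots> = word_eval W ((\<lambda>_. f y)(u := f x [^]\<^bsub>W\<^esub> e)) s"
    using hom_int_pow[OF hom c(1) F.is_group W] f W
    by (intro word_eval_cong) (simp add: word_eval_gen del: free_group_sel)
  finally show ?thesis .
qed

text \<open>Evaluation in the integers at 0 for \<open>x\<close> and 1 for \<open>y\<close>: the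
  substituted power of \<open>x\<close> still has value 0.\<close>

lemma exponent_sum_substitution: "exponent_sum y r = exponent_sum y s"
proof -
  have l: "snd ` set r \<subseteq> {x, y}" "snd ` set s \<subseteq> {u, y}" using r s by simp_all
  let ?f = "\<lambda>a. if a = y then 1 else 0 :: int"
  have "word_eval integer_group ?f r = word_eval integer_group ((\<lambda>_. ?f y)(u := ?f x [^]\<^bsub>integer_group\<^esub> e)) s"
    by (rule word_eval_substitution) simp_all
  then show ?thesis
    using word_eval_integer[OF l(1) ne(1), of ?f] word_eval_integer[OF l(2) ne(2)] ne by simp
qed

abbreviation (input) "Gr \<equiv> presented_group {x, y} {r}"
abbreviation (input) "Hs \<equiv> presented_group {u, y} {s}"
abbreviation (input) "gx \<equiv> pgen {x, y} {r} x"
abbreviation (input) "gy \<equiv> pgen {x, y} {r} y"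
abbreviation (input) "hu \<equiv> pgen {u, y} {s} u"
abbreviation (input) "hy \<equiv> pgen {u, y} {s} y"

lemma relator_closed: "{r} \<subseteq> carrier (free_group {x, y})" "{s} \<subseteq> carrier (free_group {u, y})"
  using r s by simp_all

lemma groups_presented: "group Gr" "group Hs"
  using group_presented_group relator_closed by blast+

lemma generators_closed: "gx \<in> carrier Gr" "gy \<in> carrier Gr" "hu \<in> carrier Hs" "hy \<in> carrier Hs"
  using pgen_closed[OF relator_closed(1)] pgen_closed[OF relator_closed(2)] by simp_all

lemma generate_generators: "generate Gr {gx, gy} = carrier Gr" "generate Hs {hu, hy} = carrier Hs"
  using generate_pgen[OF relator_closed(1)] generate_pgen[OF relator_closed(2)] by simp_all

lemma substitution_hom:
  obtains \<iota> where "\<iota> \<in> hom Hs Gr" "\<iota> hu = gx [^]\<^bsub>Gr\<^esub> e" "\<iota> hy = gy"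
proof -
  interpret Gr: group Gr by (rule groups_presented)
  have "word_eval Gr ((\<lambda>_. gy)(u := gx [^]\<^bsub>Gr\<^esub> e)) s = \<one>\<^bsub>Gr\<^esub>"
    using word_eval_substitution[OF groups_presented(1), of "pgen {x, y} {r}"] word_eval_relator[OF relator_closed(1), of r] generators_closed
    by simp
  then have rel: "word_eval Gr ((\<lambda>_. gy)(u := gx [^]\<^bsub>Gr\<^esub> e)) \<rho> = \<one>\<^bsub>Gr\<^esub>" if "\<rho> \<in> {s}" for \<rho>
    using that by simp
  have f: "(\<lambda>_. gy)(u := gx [^]\<^bsub>Gr\<^esub> e) \<in> {u, y} \<rightarrow> carrier Gr"
    using generators_closed ne by auto
  obtain \<iota> where \<iota>: "\<iota> \<in> hom Hs Gr"
    "\<And>a. a \<in> {u, y} \<Longrightarrow> \<iota> (pgen {u, y} {s} a) = ((\<lambda>_. gy)(u := gx [^]\<^bsub>Gr\<^esub> e)) a"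
    by (rule presented_group_hom_exists[OF relator_closed(2) groups_presented(1) f]) (erule rel, rule that)
  show thesis by (rule that[OF \<iota>(1)]) (use \<iota>(2)[of u] \<iota>(2)[of y] ne in auto)
qed

text \<open>The relator \<open>r\<close> takes the value of \<open>s\<close> under
  \<open>\<Sigma>\<close>, hence \<open>\<one>\<close>. This is the existence part of the universal
  property of the pushout of \<open>H\<close> and an infinite cyclic group along
  \<open>u = x^e\<close>.\<close>

lemma pushout_hom:
  assumes W: "group W" and \<Sigma>: "\<Sigma> \<in> hom Hs W" and Y: "Y \<in> carrier W" and eq: "Y [^]\<^bsub>W\<^esub> e = \<Sigma> hu"
    and \<iota>: "\<iota> \<in> hom Hs Gr" "\<iota> hu = gx [^]\<^bsub>Gr\<^esub> e" "\<iota> hy = gy"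
  shows "\<exists>T\<in>hom Gr W. (\<forall>h\<in>carrier Hs. T (\<iota> h) = \<Sigma> h) \<and> T gx = Y"
proof -
  interpret Hs: group Hs by (rule groups_presented)
  interpret Gr: group Gr by (rule groups_presented)
  interpret \<Sigma>: group_hom Hs W \<Sigma> using W \<Sigma> groups_presented by (simp add: group_hom_def group_hom_axioms_def)
  let ?f = "\<lambda>a. if a = x then Y else \<Sigma> hy"
  have l: "snd ` set s \<subseteq> {u, y}" using s by simp
  have "word_eval W ?f r = word_eval W ((\<lambda>_. ?f y)(u := ?f x [^]\<^bsub>W\<^esub> e)) s"
    by (rule word_eval_substitution[OF W]) (use Y generators_closed in simp_all)
  also have "\<dots> = word_eval W (\<lambda>a. \<Sigma> (pgen {u, y} {s} a)) s"
    using l ne eq by (intro word_eval_cong) auto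
  also have "\<dots> = \<Sigma> (word_eval Hs (pgen {u, y} {s}) s)"
    using l generators_closed by (intro hom_word_eval[symmetric, OF groups_presented(2) W \<Sigma>]) auto
  also have "\<dots> = \<one>\<^bsub>W\<^esub>" using word_eval_relator[OF relator_closed(2), of s] by simp
  finally have rel: "word_eval W ?f \<rho> = \<one>\<^bsub>W\<^esub>" if "\<rho> \<in> {r}" for \<rho> using that by simp
  have f: "?f \<in> {x, y} \<rightarrow> carrier W" using Y generators_closed by simp
  obtain T where T: "T \<in> hom Gr W" "\<And>a. a \<in> {x, y} \<Longrightarrow> T (pgen {x, y} {r} a) = ?f a"
    by (rule presented_group_hom_exists[OF relator_closed(1) W f]) (erule rel, rule that)
  have Tx: "T gx = Y" and Ty: "T gy = \<Sigma> hy" using T(2)[of x] T(2)[of y] ne by simp_all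
  have T\<iota>: "(\<lambda>h. T (\<iota> h)) \<in> hom Hs W" using hom_compose[OF \<iota>(1) T(1)] by (simp add: comp_def)
  have "T (\<iota> hu) = \<Sigma> hu"
    using hom_int_pow[OF T(1) generators_closed(1) groups_presented(1) W, of e] \<iota>(2) Tx eq by simp
  then have eq_on: "T (\<iota> t) = \<Sigma> t" if "t \<in> {hu, hy}" for t using that Ty \<iota>(3) by auto
  have sub: "{hu, hy} \<subseteq> carrier Hs" using generators_closed by simp
  have "T (\<iota> h) = \<Sigma> h" if "h \<in> carrier Hs" for h
    using hom_eq_on_generate[OF groups_presented(2) W T\<iota> \<Sigma> sub eq_on, of h] that
    unfolding generate_generators by simp
  then show ?thesis using T(1) Tx by blast
qed

end

theorem theorem3p2:
  fixes x u y :: 'a and r s :: "'a word" and e p q m a b :: int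
    and G H :: "'a word set monoid"
  assumes "x \<noteq> y" and "u \<noteq> y"
    and "r \<in> carrier (free_group {x, y})" and "s \<in> carrier (free_group {u, y})"
    and "G = presented_group {x, y} {r}" and "H = presented_group {u, y} {s}"
    and "e > 0"
    and "r = word_eval (free_group {x, y})
               ((\<lambda>_. gen y)(u := gen x [^]\<^bsub>free_group {x, y}\<^esub> e)) s"
    and "p = exponent_sum x r" and "q = exponent_sum y r" and "q \<noteq> 0"
    and "m = gcd p q" and "a = p div m" and "b = q div m"
  shows "((\<exists>N :: 'a word set monoid. infinite_cyclic_extension G N
              \<and> is_free_group N \<and> finitely_generated N)
          \<longleftrightarrow> (\<exists>L :: 'a word set monoid. infinite_cyclic_extension H L
              \<and> is_free_group L \<and> finitely_generated L))
       \<and> (\<forall>(N :: 'b monoid) (L :: 'c monoid).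
            infinite_cyclic_extension G N \<and> finitely_generated N \<and>
            infinite_cyclic_extension H L \<and> finitely_generated L \<longrightarrow>
            int (group_rank N)
              = 1 + gcd a e * (int (group_rank L) - 1) + \<bar>b\<bar> * (e - 1))"
proof -
  note G_def = assms(5) and H_def = assms(6) and e = assms(7)
  note ctx = assms(1-4,8)
  note gens = generators_closed[OF ctx, folded G_def H_def]
  have gG: "group G" and gH: "group H" using groups_presented[OF ctx] by (simp_all add: G_def H_def)
  define gx where "gx = pgen {x, y} {r} x"
  define gy where "gy = pgen {x, y} {r} y"
  define hu where "hu = pgen {u, y} {s} u"
  define hy where "hy = pgen {u, y} {s} y"
  note gens = gens[folded gx_def gy_def hu_def hy_def]
  have m: "m \<noteq> 0" "p = m * a" "q = m * b" using assms(11-14) by auto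
  have b: "b \<noteq> 0" using m assms(11) by auto
  have cop: "gcd b a = 1" using div_gcd_coprime[of p q] assms(11-14) by (simp add: gcd.commute)

  have l: "snd ` set r \<subseteq> {x, y}" using assms(3) by simp
  \<comment> \<open>Both products equal \<open>m * a * b\<close>, so the chosen values define a
    homomorphism on \<open>G\<close>.\<close>
  have "word_eval integer_group (\<lambda>c. if c = x then b else - a) r = b * p - a * q"
    using word_eval_integer[OF l assms(1)] assms(1,9,10) by simp
  also have "\<dots> = 0" using m by (simp add: algebra_simps)
  finally have rel: "word_eval integer_group (\<lambda>c. if c = x then b else - a) \<rho> = \<one>\<^bsub>integer_group\<^esub>"
    if "\<rho> \<in> {r}" for \<rho> using that by simp
  have f: "(\<lambda>c. if c = x then b else - a) \<in> {x, y} \<rightarrow> carrier integer_group" by simp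
  obtain \<phi> where \<phi>: "\<phi> \<in> hom G integer_group"
    "\<And>c. c \<in> {x, y} \<Longrightarrow> \<phi> (pgen {x, y} {r} c) = (if c = x then b else - a)"
    by (rule presented_group_hom_exists[OF relator_closed(1)[OF ctx] group_integer_group f])
       (erule rel, rule that, simp_all only: G_def)
  have \<phi>_x: "\<phi> gx = b" and \<phi>_y: "\<phi> gy = - a" using \<phi>(2)[of x] \<phi>(2)[of y] assms(1) by (simp_all add: gx_def gy_def)
  obtain \<iota> where \<iota>: "\<iota> \<in> hom H G" "\<iota> hu = gx [^]\<^bsub>G\<^esub> e" "\<iota> hy = gy"
    using substitution_hom[OF ctx] unfolding G_def H_def gx_def gy_def hu_def hy_def by blast
  define \<psi> where "\<psi> h = \<phi> (\<iota> h)" for h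
  have \<psi>: "\<psi> \<in> hom H integer_group" using hom_compose[OF \<iota>(1) \<phi>(1)] by (simp add: \<psi>_def [abs_def] comp_def)
  have \<psi>_u: "\<psi> hu = e * b" and \<psi>_y: "\<psi> hy = - a"
    using hom_int_pow[OF \<phi>(1) gens(1) gG group_integer_group, of e] by (simp_all add: \<psi>_def \<iota> \<phi>_x \<phi>_y)
  have gen_G: "generate G {gx, gy} = carrier G" and gen_H: "generate H {hu, hy} = carrier H"
    using generate_generators[OF ctx] by (simp_all add: G_def H_def gx_def gy_def hu_def hy_def)
  have im_\<phi>: "\<phi> ` carrier G = UNIV"
    using hom_image_two_generators[OF gG gens(1,2) gen_G \<phi>(1)] cop by (simp add: \<phi>_x \<phi>_y)
  have "coprime a b" using cop by (simp add: coprime_iff_gcd_eq_1 gcd.commute)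
  then have "gcd (e * b) a = gcd a e"
    by (metis gcd.commute gcd_mult_right_right_cancel)
  then have im_\<psi>: "\<psi> ` carrier H = {k. gcd a e dvd k}"
    using hom_image_two_generators[OF gH gens(3,4) gen_H \<psi>] by (simp add: \<psi>_u \<psi>_y)
  have d: "gcd a e > 0" using e by simp

  interpret G: group G by (rule gG)
  interpret H0: group H by (rule gH)
  interpret H: infinite_order H hu e
  proof
    show "hu \<in> carrier H" by (rule gens)
    \<comment> \<open>The degree \<open>e * b\<close> of \<open>u\<close> is nonzero, so distinct
      powers of \<open>u\<close> have distinct degrees.\<close>
    show "k = 0" if "hu [^]\<^bsub>H\<^esub> k = \<one>\<^bsub>H\<^esub>" for k :: int
    proof -
      have "\<psi> (hu [^]\<^bsub>H\<^esub> k) = k * (e * b)"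
        using hom_int_pow[OF \<psi> gens(3) gH group_integer_group, of k] by (simp add: \<psi>_u)
      moreover have "\<psi> \<one>\<^bsub>H\<^esub> = 0" using hom_one[OF \<psi> gH group_integer_group] by simp
      ultimately show ?thesis using that e b by simp
    qed
    show "e > 0" by (rule e)
  qed
  have ext: "\<exists>T\<in>hom G (perm_group H.\<Omega>). (\<forall>h\<in>carrier H. T (\<iota> h) = H.left h) \<and> T gx = H.shift 1"
  proof -
    have "H.shift 1 \<in> carrier (perm_group H.\<Omega>)" using H.shift_hom by (auto simp: hom_def)
    moreover have "H.shift 1 [^]\<^bsub>perm_group H.\<Omega>\<^esub> e = H.left hu" using H.shift_pow[of e] H.shift_e by simp
    ultimately show ?thesis
      using pushout_hom[OF ctx group_perm_group, of "H.left" "H.\<Omega>" "H.shift 1" \<iota>] \<iota> H.left_hom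
      unfolding G_def H_def gx_def gy_def hu_def hy_def by blast
  qed
  have gen_ext: "generate G (insert gx (\<iota> ` carrier H)) = carrier G"
  proof
    have "\<iota> ` carrier H \<subseteq> carrier G" using \<iota>(1) by (auto simp: hom_def)
    then show "generate G (insert gx (\<iota> ` carrier H)) \<subseteq> carrier G"
      using gens(1) by (intro G.generate_incl) simp
    have "{gx, gy} \<subseteq> insert gx (\<iota> ` carrier H)" using \<iota>(3) gens(4) by blast
    then show "carrier G \<subseteq> generate G (insert gx (\<iota> ` carrier H))"
      using G.mono_generate gen_G by metis
  qed
  interpret E: graded_root_extension G H hu e \<iota> gx \<phi> b "gcd a e"
  proof (intro graded_root_extension.intro root_extension.intro root_extension_axioms.intro
      graded_root_extension_axioms.intro gG H.infinite_order_axioms)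
    show "\<phi> (g \<otimes>\<^bsub>G\<^esub> h) = \<phi> g + \<phi> h" if "g \<in> carrier G" "h \<in> carrier G" for g h
      using \<phi>(1) that by (auto simp: hom_def)
    show "(\<lambda>h. \<phi> (\<iota> h)) ` carrier H = {k. gcd a e dvd k}" using im_\<psi> by (simp add: \<psi>_def [abs_def])
  qed (use \<iota> gens gen_ext ext \<phi>_x b im_\<phi> d in simp_all)
  define GK where "GK = G\<lparr>carrier := E.K\<rparr>"
  define HK where "HK = H\<lparr>carrier := E.KH\<rparr>"
  have gGK: "group GK" and gHK: "group HK"
    using G.subgroup_imp_group[OF E.subgroup_K] H0.subgroup_imp_group[OF E.subgroup_KH]
    by (simp_all add: GK_def HK_def)
  have iso_G: "GK = G\<lparr>carrier := {g \<in> carrier G. \<phi> g = 0}\<rparr>"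
    by (simp add: GK_def E.K_def)
  have iso_H: "HK = H\<lparr>carrier := {h \<in> carrier H. \<psi> h = 0}\<rparr>"
    by (simp add: HK_def E.KH_def \<psi>_def)
  have qr: "exponent_sum y r \<noteq> 0" and qs: "exponent_sum y s \<noteq> 0"
    using assms(10,11) exponent_sum_substitution[OF ctx] by simp_all
  have \<phi>_ne: "\<phi> (pgen {x, y} {r} x) \<noteq> 0" and \<psi>_ne: "\<psi> (pgen {u, y} {s} u) \<noteq> 0"
    using \<phi>_x \<psi>_u b e by (simp_all add: gx_def hu_def)
  note iso_G = infinite_cyclic_extension_iso_kernel[OF G_def assms(1,3) qr \<phi>(1) \<phi>_ne, folded iso_G]
  note iso_H = infinite_cyclic_extension_iso_kernel[OF H_def assms(2,4) qs \<psi> \<psi>_ne, folded iso_H]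
  \<comment> \<open>The two kernels serve as witnesses for \<open>N\<close> and \<open>L\<close>;
    being restrictions of \<open>G\<close> and \<open>H\<close>, they have the required
    type.\<close>
  have ext_G: "infinite_cyclic_extension G GK"
    using infinite_cyclic_extension_kernel[OF gG \<phi>(1), of 1] im_\<phi> by (simp add: GK_def E.K_def)
  have ext_H: "infinite_cyclic_extension H HK"
    using infinite_cyclic_extension_kernel[OF gH \<psi> im_\<psi>] d by (simp add: HK_def E.KH_def \<psi>_def)
  have free_H: "is_free_group HK" if "is_free_group GK"
  proof (rule is_free_group_embedding[OF that gHK])
    show "\<iota> \<in> hom HK GK" by (rule homI) (auto simp: GK_def HK_def E.KH_def E.K_def)
    show "inj_on \<iota> (carrier HK)"
      by (rule inj_on_subset[OF E.\<iota>_inj]) (auto simp: HK_def E.KH_def)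
  qed
  have free_G: "is_free_group GK" if "is_free_group HK"
    unfolding GK_def
  proof (rule E.is_free_kernel)
    show "is_free_group (H\<lparr>carrier := {h \<in> carrier H. \<phi> (\<iota> h) = 0}\<rparr>)"
      using that by (simp add: HK_def E.KH_def)
    fix \<Sigma> Y
    assume "\<Sigma> \<in> hom H (wreath integer_group (free_group E.K))"
      "Y \<in> carrier (wreath integer_group (free_group E.K))"
      "Y [^]\<^bsub>wreath integer_group (free_group E.K)\<^esub> e = \<Sigma> hu"
    then show "\<exists>T\<in>hom G (wreath integer_group (free_group E.K)). (\<forall>h\<in>carrier H. T (\<iota> h) = \<Sigma> h) \<and> T gx = Y"
      using pushout_hom[OF ctx group_wreath[OF group_integer_group group_free_group], of \<Sigma> E.K Y \<iota>] \<iota>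
      unfolding G_def H_def gx_def gy_def hu_def hy_def by blast
  qed
  show ?thesis
  proof (intro conjI allI impI iffI; (elim exE conjE)?)
    fix N :: "'a word set monoid"
    assume N: "infinite_cyclic_extension G N" "is_free_group N" "finitely_generated N"
    have gN: "group N" using N(1) by (simp add: infinite_cyclic_extension_def)
    have "is_free_group GK" by (rule is_free_group_iso[OF N(2) gGK iso_G[OF N(1)]])
    moreover obtain k where "generated_by GK k"
      using N(3) generated_by_iso[OF gGK gN iso_G[OF N(1)]] by (auto simp: finitely_generated_iff)
    then have "finitely_generated HK"
      using E.generated_by_KH' unfolding GK_def HK_def finitely_generated_iff by blast
    ultimately show "\<exists>L :: 'a word set monoid. infinite_cyclic_extension H L \<and> is_free_group L \<and> finitely_generated L"
      using free_H ext_H by blast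
  next
    fix L :: "'a word set monoid"
    assume L: "infinite_cyclic_extension H L" "is_free_group L" "finitely_generated L"
    have gL: "group L" using L(1) by (simp add: infinite_cyclic_extension_def)
    have "is_free_group HK" by (rule is_free_group_iso[OF L(2) gHK iso_H[OF L(1)]])
    moreover obtain l where "generated_by HK l"
      using L(3) generated_by_iso[OF gHK gL iso_H[OF L(1)]] by (auto simp: finitely_generated_iff)
    then have "finitely_generated GK"
      using E.generated_by_K unfolding GK_def HK_def finitely_generated_iff by blast
    ultimately show "\<exists>N :: 'a word set monoid. infinite_cyclic_extension G N \<and> is_free_group N \<and> finitely_generated N"
      using free_G ext_G by blast
  next
    fix N :: "'b monoid" and L :: "'c monoid"
    assume N: "infinite_cyclic_extension G N" "finitely_generated N"
      and L: "infinite_cyclic_extension H L" "finitely_generated L"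
    have gN: "group N" and gL: "group L" using N(1) L(1) by (simp_all add: infinite_cyclic_extension_def)
    have eq: "generated_by GK = generated_by N" "generated_by HK = generated_by L"
      using generated_by_iso[OF gGK gN iso_G[OF N(1)]] generated_by_iso[OF gHK gL iso_H[OF L(1)]]
      by simp_all
    obtain k l where "generated_by GK k" "generated_by HK l"
      using N(2) L(2) by (auto simp: finitely_generated_iff eq)
    then have "int (group_rank GK) = 1 + gcd a e * (int (group_rank HK) - 1) + \<bar>b\<bar> * (e - 1)"
      unfolding GK_def HK_def by (rule E.rank_kernel)
    then show "int (group_rank N) = 1 + gcd a e * (int (group_rank L) - 1) + \<bar>b\<bar> * (e - 1)"
      by (simp only: group_rank_eq eq)
  qed
qed

end
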